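(* Let $n\ge2$ and let $f:\mathbb{B}^n\to\mathbb{R}^n\setminus\{0\}$ be a $K$-quasiregular mapping in the Miniowitz class (Min) satisfying the multiplicity condition (M) with some $0\le a<n-1$. Then $\ln|\tilde f|\in BMO(\mathbb{S}^{n-1})$.
   Context: $\mathbb{B}^n=B(0,1)$ is the open unit ball of $\mathbb{R}^n$, $\mathbb{S}^{n-1}=\partial\mathbb{B}^n$, with surface measure $\sigma$. Quasiregular: a continuous map $f:\Omega\to\mathbb{R}^n$ on a domain $\Omega\subset\mathbb{R}^n$ is $K$-quasiregular ($K\ge1$) if $f\in W^{1,n}_{loc}(\Omega,\mathbb{R}^n)$ and $|Df(x)|^n\le K J_f(x)$ for a.e. $x\in\Omega$, where $|Df|$ is the operator norm and $J_f$ the Jacobian determinant. Multiplicity: $N(f,E):=\sup_{y\in\mathbb{R}^n}\#\{x\in E: f(x)=y\}$. Conformal automorphisms: for $x\in\mathbb{B}^n\setminus\{0\}$, $T_x:\mathbb{B}^n\to\mathbb{B}^n$ is the Möbius self-map $T_x(y)=\dfrac{(1-|x|^2)(y-x)-|y-x|^2x}{|x|^2\,|y-x/|x|^2|^2}$, with $T_x(x)=0$; $T_0=\mathrm{id}$. Put $B_\rho(x,r):=T_x^{-1}(B(0,r))$ for $0<r<1$. Condition (M) with exponent $a\in[0,n-1)$: there is $C>0$ with $\sup_{x\in\mathbb{B}^n}N(f,B_\rho(x,r))\le \frac{C}{(1-r)^a}$ for all $0<r<1$. Miniowitz class (Min): $f$ takes values in $\mathbb{R}^n\setminus\{0\}$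 and there are constants $C,m>0$ depending only on $n$ and $K$ such that for every $x\in\mathbb{B}^n$ the map $g_x:=f\circ T_x^{-1}$ satisfies $\frac1C\Big(\frac{1-r}{1+r}\Big)^m\le\frac{|g_x(y)|}{|g_x(0)|}\le C\Big(\frac{1+r}{1-r}\Big)^m$ for all $y\in\mathbb{B}^n$, $r=|y|$. The non-tangential limit map is $\tilde f(\omega):=\lim_{r\to1}f(r\omega)$; under (M) and (Min) it exists for $\sigma$-a.e. $\omega\in\mathbb{S}^{n-1}$. $v\in BMO(\mathbb{S}^{n-1})$ if $\sup_{\Delta}\frac{1}{\sigma(\Delta)}\int_\Delta|v-v_\Delta|\,d\sigma<\infty$, the supremum being over all $\Delta=B(\omega,r)\cap\mathbb{S}^{n-1}$, $\omega\in\mathbb{S}^{n-1}$, $r>0$, with $v_\Delta$ the mean of $v$ over $\Delta$. *)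

theory Defs
  imports "HOL-Analysis.Analysis"
begin

subsection \<open>Sobolev spaces and quasiregular mappings\<close>

primrec continuously_differentiable :: "nat \<Rightarrow> (real^'n \<Rightarrow> real) \<Rightarrow> bool" where
  "continuously_differentiable 0 \<phi> \<longleftrightarrow> continuous_on UNIV \<phi>"
| "continuously_differentiable (Suc k) \<phi> \<longleftrightarrow>
     (\<forall>x. \<phi> differentiable (at x)) \<and>
     (\<forall>v. continuously_differentiable k (\<lambda>x. frechet_derivative \<phi> (at x) v))"

definition test_function :: "(real^'n) set \<Rightarrow> (real^'n \<Rightarrow> real) \<Rightarrow> bool" where
  "test_function \<Omega> \<phi> \<longleftrightarrow>
     (\<forall>k. continuously_differentiable k \<phi>) \<and>
     compact (closure {x. \<phi> x \<noteq> 0}) \<and> closure {x. \<phi> x \<noteq> 0} \<subseteq> \<Omega>"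

definition Lp_loc :: "real \<Rightarrow> (real^'n) set \<Rightarrow> (real^'n \<Rightarrow> 'b::euclidean_space) \<Rightarrow> bool" where
  "Lp_loc p \<Omega> u \<longleftrightarrow>
     u \<in> borel_measurable (lebesgue_on \<Omega>) \<and>
     (\<forall>S. compact S \<and> S \<subseteq> \<Omega> \<longrightarrow> set_integrable lebesgue S (\<lambda>x. norm (u x) powr p))"

text \<open>The entry \<open>G x $ i $ j\<close> is the weak partial derivative of the \<open>i\<close>-th component of \<open>u\<close> in the
  \<open>j\<close>-th coordinate direction. The integrals are Bochner integrals; they are meaningful when
  \<open>u\<close> and \<open>G\<close> are locally integrable, as is the case in \<open>weak_Jacobian_W1p_loc\<close> for \<open>p \<ge> 1\<close>.\<close>

definition weak_Jacobian ::
  "(real^'n) set \<Rightarrow> (real^'n \<Rightarrow> real^'m) \<Rightarrow> (real^'n \<Rightarrow> real^'n^'m) \<Rightarrow> bool" where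
  "weak_Jacobian \<Omega> u G \<longleftrightarrow>
     (\<forall>\<phi> i j. test_function \<Omega> \<phi> \<longrightarrow>
        (LINT x:\<Omega>|lebesgue. u x $ i * frechet_derivative \<phi> (at x) (axis j 1))
          = - (LINT x:\<Omega>|lebesgue. G x $ i $ j * \<phi> x))"

text \<open>\<open>u\<close> belongs to \<open>W\<^sup>1\<^sup>,\<^sup>p\<close> locally on \<open>\<Omega>\<close>, and \<open>G\<close> is (a representative of) its
  weak derivative \<open>Du\<close>, which is unique up to null sets.\<close>

definition weak_Jacobian_W1p_loc ::
  "real \<Rightarrow> (real^'n) set \<Rightarrow> (real^'n \<Rightarrow> real^'m) \<Rightarrow> (real^'n \<Rightarrow> real^'n^'m) \<Rightarrow> bool" where
  "weak_Jacobian_W1p_loc p \<Omega> u G \<longleftrightarrow> Lp_loc p \<Omega> u \<and> Lp_loc p \<Omega> G \<and> weak_Jacobian \<Omega> u G"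

definition quasiregular_on :: "real \<Rightarrow> (real^'n) set \<Rightarrow> (real^'n \<Rightarrow> real^'n) \<Rightarrow> bool" where
  "quasiregular_on K \<Omega> f \<longleftrightarrow>
     K \<ge> 1 \<and> open \<Omega> \<and> connected \<Omega> \<and> \<Omega> \<noteq> {} \<and> continuous_on \<Omega> f \<and>
     (\<exists>Df. weak_Jacobian_W1p_loc (real CARD('n)) \<Omega> f Df \<and>
       (AE x in lebesgue_on \<Omega>. onorm ((*v) (Df x)) ^ CARD('n) \<le> K * det (Df x)))"

subsection \<open>Multiplicity and conformal automorphisms of the ball\<close>

text \<open>The counting measure renders the number of preimages, with value \<open>\<infinity>\<close> for infinite fibres.\<close>

definition multiplicity_on :: "('a \<Rightarrow> 'b) \<Rightarrow> 'a set \<Rightarrow> ennreal" where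
  "multiplicity_on f E = (SUP y. emeasure (count_space UNIV) {x \<in> E. f x = y})"

definition ball_aut :: "real^'n \<Rightarrow> real^'n \<Rightarrow> real^'n" where
  "ball_aut x y =
     (if x = 0 then y
      else ((1 - (norm x)\<^sup>2) *\<^sub>R (y - x) - (norm (y - x))\<^sup>2 *\<^sub>R x)
             /\<^sub>R ((norm x)\<^sup>2 * (norm (y - x /\<^sub>R (norm x)\<^sup>2))\<^sup>2))"

text \<open>\<open>ball_aut x\<close> is a self-map of the unit ball, so its inverse and preimages are taken there.\<close>

definition ball_aut_inv :: "real^'n \<Rightarrow> real^'n \<Rightarrow> real^'n" where
  "ball_aut_inv x = inv_into (ball 0 1) (ball_aut x)"

definition hball :: "real^'n \<Rightarrow> real \<Rightarrow> (real^'n) set" where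
  "hball x r = {y \<in> ball 0 1. ball_aut x y \<in> ball 0 r}"

definition multiplicity_condition :: "real \<Rightarrow> (real^'n \<Rightarrow> real^'n) \<Rightarrow> bool" where
  "multiplicity_condition a f \<longleftrightarrow>
     (\<exists>C>0. \<forall>r. 0 < r \<and> r < 1 \<longrightarrow>
        (SUP x \<in> ball 0 1. multiplicity_on f (hball x r)) \<le> ennreal (C / (1 - r) powr a))"

text \<open>The constants are passed as functions of the dimension and of \<open>K\<close>: they depend on nothing
  else.\<close>

definition miniowitz_class ::
  "(nat \<Rightarrow> real \<Rightarrow> real) \<Rightarrow> (nat \<Rightarrow> real \<Rightarrow> real) \<Rightarrow> real \<Rightarrow> (real^'n \<Rightarrow> real^'n) \<Rightarrow> bool" where
  "miniowitz_class C m K f \<longleftrightarrow>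
     (\<forall>x \<in> ball 0 1. f x \<noteq> 0) \<and>
     (let c = C CARD('n) K; \<mu> = m CARD('n) K in
       c > 0 \<and> \<mu> > 0 \<and>
       (\<forall>x \<in> ball 0 1. let g = f \<circ> ball_aut_inv x in
          \<forall>y \<in> ball 0 1.
            1 / c * ((1 - norm y) / (1 + norm y)) powr \<mu> \<le> norm (g y) / norm (g 0) \<and>
            norm (g y) / norm (g 0) \<le> c * ((1 + norm y) / (1 - norm y)) powr \<mu>))"

subsection \<open>The boundary map and BMO on the sphere\<close>

text \<open>Where the limit does not exist, this is an unspecified value.\<close>

definition boundary_map :: "(real^'n \<Rightarrow> real^'n) \<Rightarrow> real^'n \<Rightarrow> real^'n" where
  "boundary_map f \<omega> = Lim (at_left 1) (\<lambda>r. f (r *\<^sub>R \<omega>))"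

text \<open>Surface measure, from polar coordinates: a Borel set \<open>E\<close> of the sphere has measure \<open>n\<close> times
  the Lebesgue measure of the cone \<open>{x. 0 < norm x < 1 \<and> x / norm x \<in> E}\<close>.\<close>

definition sphere_measure :: "(real^'n) measure" where
  "sphere_measure =
     distr (scale_measure (of_nat CARD('n)) (restrict_space lborel (ball 0 1 - {0})))
       (restrict_space borel (sphere 0 1)) (\<lambda>x. x /\<^sub>R norm x)"

lemma emeasure_sphere_measure:
  fixes E :: "(real^'n) set"
  assumes "E \<in> sets borel" "E \<subseteq> sphere 0 1"
  shows "emeasure sphere_measure E =
    of_nat CARD('n) * emeasure lborel {x. 0 < norm x \<and> norm x < 1 \<and> x /\<^sub>R norm x \<in> E}"
proof -
  let ?S = "ball 0 1 - {0} :: (real^'n) set"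
  let ?p = "\<lambda>x::real^'n. x /\<^sub>R norm x"
  have "?p \<in> restrict_space lborel ?S \<rightarrow>\<^sub>M restrict_space borel (sphere 0 1)"
    by (rule measurable_restrict_space2)
       (auto simp: space_restrict_space intro!: measurable_restrict_space1)
  then have "?p \<in> scale_measure (of_nat CARD('n)) (restrict_space lborel ?S)
      \<rightarrow>\<^sub>M restrict_space borel (sphere 0 1)"
    by simp
  moreover have "E \<in> sets (restrict_space borel (sphere 0 1))"
    using assms by (auto simp: sets_restrict_space)
  ultimately have "emeasure sphere_measure E =
      of_nat CARD('n) * emeasure (restrict_space lborel ?S) (?p -` E \<inter> ?S)"
    by (simp add: sphere_measure_def emeasure_distr space_restrict_space space_scale_measure)
  also have "emeasure (restrict_space lborel ?S) (?p -` E \<inter> ?S) = emeasure lborel (?p -` E \<inter> ?S)"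
    by (rule emeasure_restrict_space) auto
  also have "?p -` E \<inter> ?S = {x. 0 < norm x \<and> norm x < 1 \<and> x /\<^sub>R norm x \<in> E}"
    by auto
  finally show ?thesis .
qed

definition sphere_cap :: "real^'n \<Rightarrow> real \<Rightarrow> (real^'n) set" where
  "sphere_cap \<omega> r = ball \<omega> r \<inter> sphere 0 1"

definition cap_mean :: "(real^'n) set \<Rightarrow> (real^'n \<Rightarrow> real) \<Rightarrow> real" where
  "cap_mean \<Delta> v = (LINT \<omega>:\<Delta>|sphere_measure. v \<omega>) / measure sphere_measure \<Delta>"

text \<open>The integrability clause makes the means and mean oscillations genuine integrals.\<close>

definition bmo_sphere :: "(real^'n \<Rightarrow> real) \<Rightarrow> bool" where
  "bmo_sphere v \<longleftrightarrow>
     integrable sphere_measure v \<and>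
     bdd_above {cap_mean \<Delta> (\<lambda>\<omega>. \<bar>v \<omega> - cap_mean \<Delta> v\<bar>) | \<Delta>.
       \<exists>\<omega> r. \<omega> \<in> sphere 0 1 \<and> r > 0 \<and> \<Delta> = sphere_cap \<omega> r}"

end

theory Submission
  imports Defs
begin

text \<open>
  Write \<open>u = ln |f|\<close>, so that \<open>|Du| \<le> |Df| / |f|\<close>. On a set where \<open>|u - L| \<le> B\<close> and \<open>f\<close> is at most
  \<open>N\<close>-to-one, quasiregularity and the area inequality bound the integral of \<open>(|Df| / |f|)\<^sup>n\<close> by a
  constant times \<open>N (B + 1)\<close>, because the measure \<open>|y|\<^sup>-\<^sup>n dy\<close> of a spherical shell is logarithmic in
  the ratio of its radii.

  Consider the Carleson box of size \<open>r\<close> over a cap. Its layer at distance about \<open>r / 2\<^sup>k\<close> from the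
  sphere lies in a hyperbolic ball \<open>B\<^sub>\<rho>(x, 1 - c / 2\<^sup>k)\<close> around the top \<open>x\<close> of the box, so there
  \<open>N\<close> is at most a constant times \<open>2\<^sup>k\<^sup>a\<close> by (M), and \<open>|u - u(x)|\<close> grows at most linearly in \<open>k\<close>
  by (Min). Inserting a weight \<open>2\<^sup>-\<^sup>k\<^sup>b\<close> with \<open>a < b < n - 1\<close> makes the energies of the layers summable
  and keeps the dual weight integrable along radii; hence the radial integrals of \<open>|Df| / |f|\<close> through the box,
  averaged over the cap, are bounded uniformly in the cap. They dominate
  the deviation of the radial limit of \<open>u\<close> from \<open>u(x)\<close>.

  The Sobolev regularity of \<open>f\<close> enters through mollifications whose derivatives converge rapidly in \<open>L\<^sup>1\<close>.
  By the weak type maximal inequality they show that almost all of the ball is exhausted by sets relative to which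
  \<open>f\<close> is differentiable, which is what the area inequality needs, and by Fubini in polar coordinates they
  give absolute continuity of \<open>f\<close> on almost every radius.
\<close>

subsection \<open>Polar coordinates\<close>

text \<open>Every choice keeps the estimate on a box free of scale. The exponent of the energy is
  the dimension, so the volume of an image shell cancels against \<open>1 / |f|^n\<close>, and the
  energy part of a box of size \<open>r\<close> costs \<open>r^(n - 1)\<close>, the order of the
  measure of its cap. In place of Hoelder's inequality, a pointwise Young inequality splits
  \<open>r |Df| / |f|\<close> in each layer into an energy term and a constant, and the constant
  merely integrates to a layer thickness. The condition \<open>a < n - 1\<close> is exactly the room
  for \<open>b\<close>.

  The obstacle is regularity: a weak derivative gives neither differentiability at a given point nor
  a chain rule for \<open>ln |f|\<close>. Only the inequality in the area formula is used, so null
  sets of the domain can be discarded whatever their images. The logarithm is taken of the smooth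
  approximations, on a compact ball where \<open>|f|\<close> has a positive lower bound, and the
  limit comes afterwards. Boundary values are compared with \<open>u\<close> at the top of the box
  instead of with a mean, at the price of a factor 2.\<close>

lemma nn_integral_lborel_scaleR:
  fixes F :: "'a::euclidean_space \<Rightarrow> ennreal"
  assumes [measurable]: "F \<in> borel_measurable borel" and c: "c > 0"
  shows "(\<integral>\<^sup>+x. F (c *\<^sub>R x) \<partial>lborel) = ennreal (1 / c ^ DIM('a)) * (\<integral>\<^sup>+x. F x \<partial>lborel)"
proof -
  have "(\<integral>\<^sup>+x. F x \<partial>lborel) = (\<integral>\<^sup>+x. F x \<partial>density (distr lborel borel (\<lambda>x. 0 + c *\<^sub>R x)) (\<lambda>_. ennreal (\<bar>c\<bar> ^ DIM('a))))"
    using lborel_affine[of c "0::'a"] c by simp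
  also have "\<dots> = (\<integral>\<^sup>+x. ennreal (c ^ DIM('a)) * F (c *\<^sub>R x) \<partial>lborel)"
    using c by (subst nn_integral_density) (simp_all add: nn_integral_distr)
  also have "\<dots> = ennreal (c ^ DIM('a)) * (\<integral>\<^sup>+x. F (c *\<^sub>R x) \<partial>lborel)"
    by (rule nn_integral_cmult) simp
  finally have "ennreal (1 / c ^ DIM('a)) * (\<integral>\<^sup>+x. F x \<partial>lborel)
      = ennreal (1 / c ^ DIM('a)) * (ennreal (c ^ DIM('a)) * (\<integral>\<^sup>+x. F (c *\<^sub>R x) \<partial>lborel))" by simp
  also have "\<dots> = (\<integral>\<^sup>+x. F (c *\<^sub>R x) \<partial>lborel)"
    using c by (simp add: mult.assoc[symmetric] ennreal_mult'[symmetric])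
  finally show ?thesis by simp
qed

lemma nn_integral_sphere_measure:
  fixes F :: "real^'n \<Rightarrow> ennreal"
  assumes [measurable]: "F \<in> borel_measurable borel"
  shows "(\<integral>\<^sup>+w. F w \<partial>sphere_measure)
    = of_nat CARD('n) * (\<integral>\<^sup>+x. F (x /\<^sub>R norm x) * indicator (ball 0 1 - {0}) x \<partial>lborel)"
proof -
  let ?S = "ball 0 1 - {0} :: (real^'n) set"
  have 1: "(\<lambda>x::real^'n. x /\<^sub>R norm x) \<in> restrict_space lborel ?S \<rightarrow>\<^sub>M restrict_space borel (sphere 0 1)"
    by (rule measurable_restrict_space2)
       (auto simp: space_restrict_space intro!: measurable_restrict_space1)
  have "(\<integral>\<^sup>+w. F w \<partial>sphere_measure)
      = (\<integral>\<^sup>+x. F (x /\<^sub>R norm x) \<partial>scale_measure (of_nat CARD('n)) (restrict_space lborel ?S))"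
    unfolding sphere_measure_def using 1
    by (subst nn_integral_distr) (auto intro!: measurable_restrict_space1)
  also have "\<dots> = of_nat CARD('n) * (\<integral>\<^sup>+x. F (x /\<^sub>R norm x) \<partial>restrict_space lborel ?S)"
    by (rule nn_integral_scale_measure) (auto intro!: measurable_restrict_space1)
  also have "(\<integral>\<^sup>+x. F (x /\<^sub>R norm x) \<partial>restrict_space lborel ?S) = (\<integral>\<^sup>+x. F (x /\<^sub>R norm x) * indicator ?S x \<partial>lborel)"
    by (rule nn_integral_restrict_space) auto
  finally show ?thesis .
qed

text \<open>Used with \<open>a = norm z\<close>: integrating out an auxiliary dilation
  \<open>t\<close> produces the weight of polar coordinates.\<close>

lemma nn_integral_inverse_power_tail:
  assumes "a > 0" "n > 0"
  shows "(\<integral>\<^sup>+t. ennreal (1 / t ^ Suc n) * indicator {a<..} t \<partial>lborel) = ennreal (1 / (real n * a ^ n))"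
proof -
  have "(\<integral>\<^sup>+t. ennreal (1 / t ^ Suc n) * indicator {a<..} t \<partial>lborel)
      = (\<integral>\<^sup>+t. ennreal (1 / t ^ Suc n) * indicator {a..} t \<partial>lborel)"
    by (intro nn_integral_cong_AE AE_I[where N="{a}"]) (auto split: split_indicator)
  also have "\<dots> = ennreal (0 - (- 1 / (real n * a ^ n)))"
  proof (rule nn_integral_FTC_atLeast)
    show "((\<lambda>t. - 1 / (real n * t ^ n)) has_real_derivative 1 / t ^ Suc n) (at t)" if "a \<le> t" for t
    proof -
      have t: "t > 0" using that assms by simp
      have "((\<lambda>t. - (1 / real n) * inverse (t ^ n)) has_real_derivative
          - (1 / real n) * - (inverse (t ^ n) * (real n * t ^ (n - 1)) * inverse (t ^ n))) (at t)"
        using t by (auto intro!: derivative_eq_intros)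
      moreover have "- (1 / real n) * - (inverse (t ^ n) * (real n * t ^ (n - 1)) * inverse (t ^ n)) = 1 / t ^ Suc n"
      proof -
        have "t ^ n = t * t ^ (n - 1)" using assms by (cases n) auto
        then show ?thesis using t assms by (simp add: field_simps)
      qed
      moreover have "(\<lambda>t. - (1 / real n) * inverse (t ^ n)) = (\<lambda>t. - 1 / (real n * t ^ n))"
        by (simp add: fun_eq_iff field_simps)
      ultimately show ?thesis by simp
    qed
    show "((\<lambda>t. - 1 / (real n * t ^ n)) \<longlongrightarrow> 0) at_top"
    proof -
      have "((\<lambda>t::real. inverse (t ^ n)) \<longlongrightarrow> 0) at_top"
        by (intro tendsto_inverse_0_at_top filterlim_pow_at_top filterlim_ident assms)
      then have "((\<lambda>t::real. - (1 / real n) * inverse (t ^ n)) \<longlongrightarrow> - (1 / real n) * 0) at_top"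
        by (intro tendsto_mult tendsto_const)
      moreover have "(\<lambda>t. - (1 / real n) * inverse (t ^ n)) = (\<lambda>t. - 1 / (real n * t ^ n))"
        by (simp add: fun_eq_iff field_simps)
      ultimately show ?thesis by simp
    qed
  qed (use assms in auto)
  finally show ?thesis by simp
qed

text \<open>\<open>sphere_measure\<close> is the push-forward of \<open>n\<close> times Lebesgue
  measure on the ball, so the outer integral runs over points \<open>x\<close> of the ball. The
  substitution \<open>s = t * norm x\<close> turns the argument of \<open>h\<close> into
  \<open>t *\<^sub>R x\<close>. After exchanging the integrals, the dilation
  \<open>z = t *\<^sub>R x\<close> contributes \<open>1 / t^n\<close>, and the constraint
  \<open>norm x < 1\<close> becomes \<open>norm z < t\<close>. The remaining integral of
  \<open>1 / t^(n + 1)\<close> over \<open>t > norm z\<close> is \<open>1 / (n * norm z^n)\<close>,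
  whose \<open>n\<close> cancels the normalisation.\<close>

lemma nn_integral_sphere_radial:
  fixes h :: "real^'n \<Rightarrow> ennreal"
  assumes [measurable]: "h \<in> borel_measurable borel"
  shows "(\<integral>\<^sup>+w. (\<integral>\<^sup>+s. indicator {0<..<1} s * h (s *\<^sub>R w) \<partial>lborel) \<partial>sphere_measure)
    = (\<integral>\<^sup>+z. indicator (ball 0 1 - {0}) z * (h z * ennreal (1 / norm z ^ (CARD('n) - 1))) \<partial>lborel)"
proof -
  let ?n = "CARD('n)" and ?S = "ball 0 1 - {0} :: (real^'n) set"
  have [measurable]: "?S \<in> sets borel" by auto
  have "(\<integral>\<^sup>+w. (\<integral>\<^sup>+s. indicator {0<..<1} s * h (s *\<^sub>R w) \<partial>lborel) \<partial>sphere_measure)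
    = of_nat ?n * (\<integral>\<^sup>+x. (\<integral>\<^sup>+s. indicator {0<..<1} s * h (s *\<^sub>R (x /\<^sub>R norm x)) \<partial>lborel) * indicator ?S x \<partial>lborel)"
    by (rule nn_integral_sphere_measure) measurable
  also have "(\<integral>\<^sup>+x. (\<integral>\<^sup>+s. indicator {0<..<1} s * h (s *\<^sub>R (x /\<^sub>R norm x)) \<partial>lborel) * indicator ?S x \<partial>lborel)
    = (\<integral>\<^sup>+x. (\<integral>\<^sup>+t. indicator {0<..} t * (indicator {x. 0 < norm x \<and> norm x < 1} (t *\<^sub>R x) * ennreal (norm x) * h (t *\<^sub>R x) * indicator ?S x) \<partial>lborel) \<partial>lborel)"
  proof (rule nn_integral_cong)
    fix x :: "real^'n"
    show "(\<integral>\<^sup>+s. indicator {0<..<1} s * h (s *\<^sub>R (x /\<^sub>R norm x)) \<partial>lborel) * indicator ?S x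
      = (\<integral>\<^sup>+t. indicator {0<..} t * (indicator {x. 0 < norm x \<and> norm x < 1} (t *\<^sub>R x) * ennreal (norm x) * h (t *\<^sub>R x) * indicator ?S x) \<partial>lborel)"
    proof (cases "x \<in> ?S")
      case True
      then have nx: "norm x > 0" by simp
      have "(\<integral>\<^sup>+s. indicator {0<..<1} s * h (s *\<^sub>R (x /\<^sub>R norm x)) \<partial>lborel)
          = ennreal \<bar>norm x\<bar> * (\<integral>\<^sup>+t. indicator {0<..<1} (0 + norm x * t) * h ((0 + norm x * t) *\<^sub>R (x /\<^sub>R norm x)) \<partial>lborel)"
        using nx by (intro nn_integral_real_affine) auto
      also have "\<dots> = (\<integral>\<^sup>+t. ennreal \<bar>norm x\<bar> * (indicator {0<..<1} (0 + norm x * t) * h ((0 + norm x * t) *\<^sub>R (x /\<^sub>R norm x))) \<partial>lborel)"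
        by (rule nn_integral_cmult[symmetric]) measurable
      also have "\<dots> = (\<integral>\<^sup>+t. indicator {0<..} t * (indicator {x. 0 < norm x \<and> norm x < 1} (t *\<^sub>R x) * ennreal (norm x) * h (t *\<^sub>R x) * indicator ?S x) \<partial>lborel)"
      proof (rule nn_integral_cong)
        fix t :: real
        have "indicator {0<..<1} (0 + norm x * t) = (indicator {0<..} t * indicator {x. 0 < norm x \<and> norm x < 1} (t *\<^sub>R x) :: ennreal)"
          using nx by (auto simp: indicator_def zero_less_mult_iff mult.commute abs_if split: if_splits)
        moreover have "(0 + norm x * t) *\<^sub>R (x /\<^sub>R norm x) = t *\<^sub>R x" using nx by simp
        ultimately show "ennreal \<bar>norm x\<bar> * (indicator {0<..<1} (0 + norm x * t) * h ((0 + norm x * t) *\<^sub>R (x /\<^sub>R norm x)))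
          = indicator {0<..} t * (indicator {x. 0 < norm x \<and> norm x < 1} (t *\<^sub>R x) * ennreal (norm x) * h (t *\<^sub>R x) * indicator ?S x)"
          using True by (simp add: mult_ac)
      qed
      finally show ?thesis using True by simp
    qed simp
  qed
  also have "\<dots> = (\<integral>\<^sup>+t. (\<integral>\<^sup>+x. indicator {0<..} t * (indicator {x. 0 < norm x \<and> norm x < 1} (t *\<^sub>R x) * ennreal (norm x) * h (t *\<^sub>R x) * indicator ?S x) \<partial>lborel) \<partial>lborel)"
    by (rule lborel_pair.Fubini') measurable
  also have "\<dots> = (\<integral>\<^sup>+t. (\<integral>\<^sup>+z. indicator ?S z * (h z * ennreal (norm z)) * (ennreal (1 / t ^ Suc ?n) * indicator {norm z<..} t) \<partial>lborel) \<partial>lborel)"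
  proof (rule nn_integral_cong)
    fix t :: real
    show "(\<integral>\<^sup>+x. indicator {0<..} t * (indicator {x. 0 < norm x \<and> norm x < 1} (t *\<^sub>R x) * ennreal (norm x) * h (t *\<^sub>R x) * indicator ?S x) \<partial>lborel)
      = (\<integral>\<^sup>+z. indicator ?S z * (h z * ennreal (norm z)) * (ennreal (1 / t ^ Suc ?n) * indicator {norm z<..} t) \<partial>lborel)"
    proof (cases "t > 0")
      case True
      define F where "F = (\<lambda>z. indicator ?S z * (h z * ennreal (norm z)) * (ennreal (1 / t) * indicator {norm z<..} t))"
      have [measurable]: "F \<in> borel_measurable borel"
      proof -
        have "{norm z<..} = {u. norm z < u}" for z :: "real^'n" by auto
        then show ?thesis unfolding F_def indicator_def by simp
      qed
      have "(\<integral>\<^sup>+x. indicator {0<..} t * (indicator {x. 0 < norm x \<and> norm x < 1} (t *\<^sub>R x) * ennreal (norm x) * h (t *\<^sub>R x) * indicator ?S x) \<partial>lborel)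
         = (\<integral>\<^sup>+x. F (t *\<^sub>R x) \<partial>lborel)"
      proof (rule nn_integral_cong)
        fix x :: "real^'n"
        have 1: "ennreal (norm (t *\<^sub>R x)) * ennreal (1 / t) = ennreal (norm x)"
          using True by (simp add: ennreal_mult'[symmetric])
        have "norm (t *\<^sub>R x) < t \<longleftrightarrow> norm x < 1" using True by simp
        then have 2: "indicator ?S (t *\<^sub>R x) * indicator {norm (t *\<^sub>R x)<..} t
            = (indicator {x. 0 < norm x \<and> norm x < 1} (t *\<^sub>R x) * indicator ?S x :: ennreal)"
          using True by (auto simp: indicator_def)
        have "F (t *\<^sub>R x) = (indicator ?S (t *\<^sub>R x) * indicator {norm (t *\<^sub>R x)<..} t) * (ennreal (norm (t *\<^sub>R x)) * ennreal (1 / t)) * h (t *\<^sub>R x)"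
          by (simp only: F_def mult_ac)
        then show "indicator {0<..} t * (indicator {x. 0 < norm x \<and> norm x < 1} (t *\<^sub>R x) * ennreal (norm x) * h (t *\<^sub>R x) * indicator ?S x) = F (t *\<^sub>R x)"
          unfolding 1 2 using True by (simp add: mult_ac)
      qed
      also have "\<dots> = ennreal (1 / t ^ ?n) * (\<integral>\<^sup>+z. F z \<partial>lborel)"
        using nn_integral_lborel_scaleR[of F t] True by simp
      also have "\<dots> = (\<integral>\<^sup>+z. ennreal (1 / t ^ ?n) * F z \<partial>lborel)"
        by (rule nn_integral_cmult[symmetric]) simp
      also have "\<dots> = (\<integral>\<^sup>+z. indicator ?S z * (h z * ennreal (norm z)) * (ennreal (1 / t ^ Suc ?n) * indicator {norm z<..} t) \<partial>lborel)"
      proof (rule nn_integral_cong)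
        fix z
        have "ennreal (1 / t ^ Suc ?n) = ennreal (1 / t ^ ?n) * ennreal (1 / t)"
          using True by (simp add: ennreal_mult'[symmetric])
        then show "ennreal (1 / t ^ ?n) * F z = indicator ?S z * (h z * ennreal (norm z)) * (ennreal (1 / t ^ Suc ?n) * indicator {norm z<..} t)"
          by (simp only: F_def mult_ac)
      qed
      finally show ?thesis .
    next
      case False
      then have "indicator {norm z<..} t = (0::ennreal)" for z :: "real^'n"
        using norm_ge_zero[of z] by (auto simp: indicator_def simp del: norm_ge_zero)
      then show ?thesis using False by simp
    qed
  qed
  also have "\<dots> = (\<integral>\<^sup>+z. (\<integral>\<^sup>+t. indicator ?S z * (h z * ennreal (norm z)) * (ennreal (1 / t ^ Suc ?n) * indicator {norm z<..} t) \<partial>lborel) \<partial>lborel)"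
  proof (rule lborel_pair.Fubini')
    have "indicator {norm z<..} t = (if norm z < t then 1 else 0 :: ennreal)" for z :: "real^'n" and t
      by (auto simp: indicator_def)
    then show "(\<lambda>(z, t). indicator ?S z * (h z * ennreal (norm z)) * (ennreal (1 / t ^ Suc ?n) * indicator {norm z<..} t)) \<in> borel_measurable (lborel \<Otimes>\<^sub>M lborel)"
      by simp
  qed
  also have "\<dots> = (\<integral>\<^sup>+z. ennreal (1 / real ?n) * (indicator ?S z * (h z * ennreal (1 / norm z ^ (?n - 1)))) \<partial>lborel)"
  proof (rule nn_integral_cong)
    fix z :: "real^'n"
    show "(\<integral>\<^sup>+t. indicator ?S z * (h z * ennreal (norm z)) * (ennreal (1 / t ^ Suc ?n) * indicator {norm z<..} t) \<partial>lborel)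
      = ennreal (1 / real ?n) * (indicator ?S z * (h z * ennreal (1 / norm z ^ (?n - 1))))"
    proof (cases "z \<in> ?S")
      case True
      have n: "?n > 0" by simp
      have "norm z * (1 / (real ?n * norm z ^ ?n)) = 1 / real ?n * (1 / norm z ^ (?n - 1))"
      proof -
        have "norm z ^ ?n = norm z * norm z ^ (?n - 1)" using n by (cases ?n) auto
        then show ?thesis using True by simp
      qed
      then have e: "ennreal (norm z) * ennreal (1 / (real ?n * norm z ^ ?n)) = ennreal (1 / real ?n) * ennreal (1 / norm z ^ (?n - 1))"
        by (simp only: ennreal_mult'[symmetric] norm_ge_zero of_nat_0_le_iff zero_le_divide_1_iff)
      have "(\<integral>\<^sup>+t. indicator ?S z * (h z * ennreal (norm z)) * (ennreal (1 / t ^ Suc ?n) * indicator {norm z<..} t) \<partial>lborel)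
        = indicator ?S z * (h z * ennreal (norm z)) * (\<integral>\<^sup>+t. (ennreal (1 / t ^ Suc ?n) * indicator {norm z<..} t) \<partial>lborel)"
        by (rule nn_integral_cmult) simp
      also have "\<dots> = indicator ?S z * (h z * ennreal (norm z)) * ennreal (1 / (real ?n * norm z ^ ?n))"
        using nn_integral_inverse_power_tail[of "norm z" ?n] True n by simp
      also have "\<dots> = indicator ?S z * h z * (ennreal (norm z) * ennreal (1 / (real ?n * norm z ^ ?n)))"
        by (simp only: mult_ac)
      finally show ?thesis unfolding e by (simp only: mult_ac)
    qed simp
  qed
  also have "\<dots> = ennreal (1 / real ?n) * (\<integral>\<^sup>+z. indicator ?S z * (h z * ennreal (1 / norm z ^ (?n - 1))) \<partial>lborel)"
    by (rule nn_integral_cmult) simp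
  also have "of_nat ?n * \<dots> = (of_nat ?n * ennreal (1 / real ?n)) * (\<integral>\<^sup>+z. indicator ?S z * (h z * ennreal (1 / norm z ^ (?n - 1))) \<partial>lborel)"
    by (simp add: mult.assoc)
  also have "of_nat ?n * ennreal (1 / real ?n) = 1"
    by (simp add: ennreal_of_nat_eq_real_of_nat ennreal_mult'[symmetric])
  finally show ?thesis by simp
qed

subsection \<open>Maximal functions and differentiability on large sets\<close>

lemma norm_matrix_vector_mult_le:
  fixes A :: "real^'n^'m"
  shows "norm (A *v v) \<le> norm A * norm v"
proof -
  have "norm (A *v v) = L2_set (\<lambda>i. norm (A $ i \<bullet> v)) UNIV"
    by (simp add: norm_vec_def matrix_vector_mul_component)
  also have "\<dots> \<le> L2_set (\<lambda>i. norm (A $ i) * norm v) UNIV"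
    by (intro L2_set_mono) (auto simp: Cauchy_Schwarz_ineq2)
  also have "\<dots> = norm A * norm v"
    by (simp add: norm_vec_def L2_set_left_distrib)
  finally show ?thesis .
qed

section \<open>The weak type inequality for the maximal function\<close>

lemma emeasure_lborel_ball_scale:
  assumes "r > 0"
  shows "emeasure lborel (ball (x::'a::euclidean_space) r) = ennreal (r ^ DIM('a)) * emeasure lborel (ball (0::'a) 1)"
  using assms by (simp add: emeasure_ball ennreal_mult' mult.commute)

lemma emeasure_lborel_ball_mult:
  assumes "c > 0" "r > 0"
  shows "emeasure lborel (ball (x::'a::euclidean_space) (c * r)) = ennreal (c ^ DIM('a)) * emeasure lborel (ball x r)"
proof -
  have "ennreal ((c * r) ^ DIM('a)) = ennreal (c ^ DIM('a)) * ennreal (r ^ DIM('a))"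
    using assms by (simp add: power_mult_distrib ennreal_mult')
  then show ?thesis
    unfolding emeasure_lborel_ball_scale[OF mult_pos_pos[OF assms]] emeasure_lborel_ball_scale[OF assms(2)]
    by (simp add: mult.assoc)
qed

text \<open>Vitali: the balls on which the average of \<open>g\<close> exceeds
  \<open>\<kappa>\<close> have a countable disjoint subfamily whose fivefold enlargements cover all
  bad centres. The union \<open>W\<close> of these enlargements is open, so it is a Borel hull of
  the bad set, whose own measurability is left aside. The radii are bounded by \<open>r0\<close> as
  the covering argument demands, and \<open>\<kappa>\<close> stays a factor so that nothing is
  divided in \<open>ennreal\<close>.\<close>

lemma weak_type_maximal:
  fixes g :: "'a::euclidean_space \<Rightarrow> ennreal"
  assumes g [measurable]: "g \<in> borel_measurable borel"
  shows "\<exists>W\<in>sets borel. {x. \<exists>r. 0 < r \<and> r < r0 \<and> \<kappa> * emeasure lborel (ball x r) < (\<integral>\<^sup>+z. indicator (ball x r) z * g z \<partial>lborel)} \<subseteq> W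
    \<and> \<kappa> * emeasure lborel W \<le> ennreal (5 ^ DIM('a)) * (\<integral>\<^sup>+z. g z \<partial>lborel)"
proof -
  let ?n = "DIM('a)"
  define Z where "Z = {x. \<exists>r. 0 < r \<and> r < r0 \<and> \<kappa> * emeasure lborel (ball x r) < (\<integral>\<^sup>+z. indicator (ball x r) z * g z \<partial>lborel)}"
  define K where "K = {(x, r). 0 < r \<and> r < r0 \<and> \<kappa> * emeasure lborel (ball x r) < (\<integral>\<^sup>+z. indicator (ball x r) z * g z \<partial>lborel)}"
  have "Z \<subseteq> (\<Union>i\<in>K. ball (fst i) (snd i))"
    by (force simp: Z_def K_def)
  moreover have "0 < snd i \<and> snd i \<le> r0" if "i \<in> K" for i
    using that by (auto simp: K_def)
  ultimately obtain C where C: "countable C" "C \<subseteq> K"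
      "pairwise (\<lambda>i j. disjnt (ball (fst i) (snd i)) (ball (fst j) (snd j))) C"
      "Z \<subseteq> (\<Union>i\<in>C. ball (fst i) (5 * snd i))"
    by (rule Vitali_covering_lemma_balls)
  define W where "W = (\<Union>i\<in>C. ball (fst i) (5 * snd i))"
  have W: "W \<in> sets borel" unfolding W_def by (intro borel_open open_UN) auto
  have "emeasure lborel W = (\<integral>\<^sup>+x. indicator W x \<partial>lborel)"
    using W by simp
  also have "\<dots> \<le> (\<integral>\<^sup>+x. (\<integral>\<^sup>+i. indicator (ball (fst i) (5 * snd i)) x \<partial>count_space C) \<partial>lborel)"
  proof (rule nn_integral_mono)
    fix x
    show "indicator W x \<le> (\<integral>\<^sup>+i. indicator (ball (fst i) (5 * snd i)) x \<partial>count_space C)"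
    proof (cases "x \<in> W")
      case True
      then obtain i where i: "i \<in> C" "x \<in> ball (fst i) (5 * snd i)" by (auto simp: W_def)
      have "(\<integral>\<^sup>+j. indicator {i} j \<partial>count_space C) \<le> (\<integral>\<^sup>+i. indicator (ball (fst i) (5 * snd i)) x \<partial>count_space C)"
        using i by (intro nn_integral_mono) (auto split: split_indicator)
      then show ?thesis using i True by simp
    qed simp
  qed
  also have "\<dots> = (\<integral>\<^sup>+i. (\<integral>\<^sup>+x. indicator (ball (fst i) (5 * snd i)) x \<partial>lborel) \<partial>count_space C)"
    by (rule nn_integral_count_space_nn_integral[where f="\<lambda>i. indicator (ball (fst i) (5 * snd i))"])
       (use C in \<open>auto intro!: borel_measurable_indicator\<close>)
  finally have "\<kappa> * emeasure lborel W \<le> \<kappa> * (\<integral>\<^sup>+i. (\<integral>\<^sup>+x. indicator (ball (fst i) (5 * snd i)) x \<partial>lborel) \<partial>count_space C)"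
    by (rule mult_left_mono) simp
  also have "\<dots> = (\<integral>\<^sup>+i. \<kappa> * (\<integral>\<^sup>+x. indicator (ball (fst i) (5 * snd i)) x \<partial>lborel) \<partial>count_space C)"
    by (rule nn_integral_cmult[symmetric]) simp
  also have "\<dots> \<le> (\<integral>\<^sup>+i. ennreal (5 ^ ?n) * (\<integral>\<^sup>+z. indicator (ball (fst i) (snd i)) z * g z \<partial>lborel) \<partial>count_space C)"
  proof (rule nn_integral_mono)
    fix i assume "i \<in> space (count_space C)"
    then have i: "0 < snd i" "\<kappa> * emeasure lborel (ball (fst i) (snd i)) \<le> (\<integral>\<^sup>+z. indicator (ball (fst i) (snd i)) z * g z \<partial>lborel)"
      using C by (auto simp: K_def)
    have "\<kappa> * (\<integral>\<^sup>+x. indicator (ball (fst i) (5 * snd i)) x \<partial>lborel) = ennreal (5 ^ ?n) * (\<kappa> * emeasure lborel (ball (fst i) (snd i)))"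
      using i(1) by (simp add: emeasure_lborel_ball_mult[of 5] mult.left_commute)
    also have "\<dots> \<le> ennreal (5 ^ ?n) * (\<integral>\<^sup>+z. indicator (ball (fst i) (snd i)) z * g z \<partial>lborel)"
      using i(2) by (rule mult_left_mono) simp
    finally show "\<kappa> * (\<integral>\<^sup>+x. indicator (ball (fst i) (5 * snd i)) x \<partial>lborel) \<le> \<dots>" .
  qed
  also have "\<dots> = ennreal (5 ^ ?n) * (\<integral>\<^sup>+i. (\<integral>\<^sup>+z. indicator (ball (fst i) (snd i)) z * g z \<partial>lborel) \<partial>count_space C)"
    by (rule nn_integral_cmult) simp
  also have "(\<integral>\<^sup>+i. (\<integral>\<^sup>+z. indicator (ball (fst i) (snd i)) z * g z \<partial>lborel) \<partial>count_space C)
      = (\<integral>\<^sup>+i. emeasure (density lborel g) (ball (fst i) (snd i)) \<partial>count_space C)"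
    by (intro nn_integral_cong) (simp add: emeasure_density mult.commute)
  also have "\<dots> = emeasure (density lborel g) (\<Union>i\<in>C. ball (fst i) (snd i))"
    using C by (intro emeasure_UN_countable[symmetric]) (auto simp: disjoint_family_on_def pairwise_def disjnt_def)
  also have "\<dots> \<le> emeasure (density lborel g) (space (density lborel g))"
    by (rule emeasure_space)
  also have "\<dots> = (\<integral>\<^sup>+z. g z \<partial>lborel)"
    by (simp add: emeasure_density)
  finally have "\<kappa> * emeasure lborel W \<le> ennreal (5 ^ ?n) * (\<integral>\<^sup>+z. g z \<partial>lborel)"
    by (simp add: mult_left_mono)
  then show ?thesis
    using C(4) W unfolding Z_def W_def by blast
qed

section \<open>Differences of a smooth function controlled by maximal averages of its
  derivative\<close>

lemma nn_integral_lborel_translate: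
  fixes F :: "'a::euclidean_space \<Rightarrow> ennreal"
  assumes [measurable]: "F \<in> borel_measurable borel"
  shows "(\<integral>\<^sup>+x. F (a + x) \<partial>lborel) = (\<integral>\<^sup>+x. F x \<partial>lborel)"
proof -
  have "(\<integral>\<^sup>+x. F x \<partial>lborel) = (\<integral>\<^sup>+x. F x \<partial>distr lborel borel ((+) a))"
    by (simp add: lborel_distr_plus)
  also have "\<dots> = (\<integral>\<^sup>+x. F (a + x) \<partial>lborel)"
    by (simp add: nn_integral_distr)
  finally show ?thesis by simp
qed

text \<open>The majorant \<open>g\<close> is kept apart from \<open>D\<close>: it is a matrix norm
  in the maximal estimates, and along radii also a matrix norm divided by the norm of the function
  whose logarithm is taken.\<close>

lemma norm_diff_le_nn_integral_segment:
  fixes u :: "'a::euclidean_space \<Rightarrow> 'b::euclidean_space"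
  assumes "convex S" "x \<in> S" "z \<in> S"
    and der: "\<And>y. y \<in> S \<Longrightarrow> (u has_derivative D y) (at y)"
    and g: "continuous_on S g" "\<And>y v. y \<in> S \<Longrightarrow> norm (D y v) \<le> g y * norm v"
  shows "ennreal (norm (u z - u x)) \<le> ennreal (norm (z - x)) * (\<integral>\<^sup>+t. indicator {0..1} t * ennreal (g (x + t *\<^sub>R (z - x))) \<partial>lborel)"
proof -
  define \<gamma> where "\<gamma> t = x + t *\<^sub>R (z - x)" for t :: real
  have \<gamma>: "\<gamma> t \<in> S" if "t \<in> {0..1}" for t
  proof -
    have "\<gamma> t = (1 - t) *\<^sub>R x + t *\<^sub>R z" by (simp add: \<gamma>_def algebra_simps)
    then show ?thesis using assms(1-3) that by (auto intro: convexD_alt)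
  qed
  have "((\<lambda>t. u (\<gamma> t)) has_vector_derivative D (\<gamma> t) (z - x)) (at t within {0..1})" if t: "t \<in> {0..1}" for t
  proof -
    have 1: "(\<gamma> has_vector_derivative (z - x)) (at t within {0..1})"
      unfolding \<gamma>_def by (auto intro!: derivative_eq_intros)
    have 2: "(u has_derivative D (\<gamma> t)) (at (\<gamma> t) within \<gamma> ` {0..1})"
      using der[OF \<gamma>[OF t]] by (rule has_derivative_at_withinI)
    show ?thesis using vector_derivative_diff_chain_within[OF 1 2] by (simp add: comp_def)
  qed
  then have ftc: "((\<lambda>t. D (\<gamma> t) (z - x)) has_integral (u (\<gamma> 1) - u (\<gamma> 0))) {0..1}"
    by (intro fundamental_theorem_of_calculus) auto
  have cg: "continuous_on {0..1} (\<lambda>t. g (\<gamma> t) * norm (z - x))"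
  proof -
    have "continuous_on {0..1} \<gamma>" unfolding \<gamma>_def by (intro continuous_intros)
    then show ?thesis
      using \<gamma> by (intro continuous_intros continuous_on_compose2[OF g(1)]) auto
  qed
  have g0: "0 \<le> g (\<gamma> t) * norm (z - x)" if "t \<in> {0..1}" for t
    using g(2)[OF \<gamma>[OF that], of "z - x"] norm_ge_zero order_trans by blast
  have "norm (u (\<gamma> 1) - u (\<gamma> 0)) \<le> integral {0..1} (\<lambda>t. g (\<gamma> t) * norm (z - x))"
    using ftc g(2)[OF \<gamma>] integrable_continuous_interval[OF cg]
    by (metis (no_types, lifting) has_integral_iff integral_norm_bound_integral)
  moreover have "(\<integral>\<^sup>+t. ennreal (indicator {0..1} t * (g (\<gamma> t) * norm (z - x))) \<partial>lborel) = ennreal (integral {0..1} (\<lambda>t. g (\<gamma> t) * norm (z - x)))"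
    using integrable_continuous_interval[OF cg] g0 by (intro nn_integral_has_integral_lebesgue) (auto simp: has_integral_iff)
  ultimately have "ennreal (norm (u z - u x)) \<le> (\<integral>\<^sup>+t. ennreal (indicator {0..1} t * (g (\<gamma> t) * norm (z - x))) \<partial>lborel)"
    by (simp add: \<gamma>_def ennreal_leI)
  also have "\<dots> = (\<integral>\<^sup>+t. ennreal (norm (z - x)) * (indicator {0..1} t * ennreal (g (\<gamma> t))) \<partial>lborel)"
    by (intro nn_integral_cong) (auto simp: ennreal_mult'' mult.commute split: split_indicator)
  also have "\<dots> = ennreal (norm (z - x)) * (\<integral>\<^sup>+t. indicator {0..1} t * ennreal (g (\<gamma> t)) \<partial>lborel)"
  proof (rule nn_integral_cmult)
    have "continuous_on {0..1} (\<lambda>t. g (\<gamma> t))"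
      using \<gamma> unfolding \<gamma>_def by (intro continuous_on_compose2[OF g(1)] continuous_intros) auto
    then have "(\<lambda>t. indicator {0..1} t *\<^sub>R g (\<gamma> t)) \<in> borel_measurable borel"
      by (intro borel_measurable_continuous_on_indicator) auto
    then have "(\<lambda>t. ennreal (indicator {0..1} t *\<^sub>R g (\<gamma> t))) \<in> borel_measurable lborel" by simp
    also have "(\<lambda>t. ennreal (indicator {0..1} t *\<^sub>R g (\<gamma> t))) = (\<lambda>t. indicator {0..1} t * ennreal (g (\<gamma> t)))"
      by (auto simp: fun_eq_iff split: split_indicator)
    finally show "(\<lambda>t. indicator {0..1} t * ennreal (g (\<gamma> t))) \<in> borel_measurable lborel" .
  qed
  finally show ?thesis by (simp add: \<gamma>_def)
qed

text \<open>Integrate the segment estimate over \<open>z\<close> and exchange the integrals. For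
  fixed \<open>t\<close> the map taking \<open>z\<close> to \<open>x + t *\<^sub>R (z - x)\<close>
  carries the ball of radius \<open>d\<close> to the one of radius \<open>t * d\<close>; its
  Jacobian factor cancels exactly against the smaller volume in \<open>M\<close>, so all scales
  contribute equally and the integral over \<open>t\<close> in the unit interval loses
  nothing.\<close>

lemma nn_integral_ball_norm_diff_le:
  fixes u :: "'a::euclidean_space \<Rightarrow> 'b::euclidean_space"
  assumes d: "d > 0" and S: "convex S" "open S" "ball x d \<subseteq> S"
    and der: "\<And>y. y \<in> S \<Longrightarrow> (u has_derivative D y) (at y)"
    and g: "continuous_on S g" "\<And>y v. y \<in> S \<Longrightarrow> norm (D y v) \<le> g y * norm v"
    and M: "\<And>r. 0 < r \<Longrightarrow> r \<le> d \<Longrightarrow> (\<integral>\<^sup>+z. indicator (ball x r) z * ennreal (g z) \<partial>lborel) \<le> \<kappa> * emeasure lborel (ball x r)"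
  shows "(\<integral>\<^sup>+z. indicator (ball x d) z * ennreal (norm (u z - u x)) \<partial>lborel) \<le> ennreal d * \<kappa> * emeasure lborel (ball x d)"
proof -
  let ?n = "DIM('a)"
  define G where "G z = indicator S z * ennreal (g z)" for z
  have [measurable]: "G \<in> borel_measurable borel"
  proof -
    have "(\<lambda>t. indicator S t *\<^sub>R g t) \<in> borel_measurable borel"
      using S g by (intro borel_measurable_continuous_on_indicator) auto
    then have "(\<lambda>t. ennreal (indicator S t *\<^sub>R g t)) \<in> borel_measurable borel" by simp
    also have "(\<lambda>t. ennreal (indicator S t *\<^sub>R g t)) = G"
      by (auto simp: G_def fun_eq_iff split: split_indicator)
    finally show ?thesis .
  qed
  have [measurable]: "ball x r \<in> sets borel" for r by simp
  have inS: "x + t *\<^sub>R (z - x) \<in> ball x d" if "z \<in> ball x d" "t \<in> {0..1}" for z t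
  proof -
    have "norm (t *\<^sub>R (z - x)) \<le> norm (z - x)"
      using that by (simp add: mult_left_le_one_le)
    then show ?thesis using that by (simp add: dist_norm norm_minus_commute)
  qed
  have "(\<integral>\<^sup>+z. indicator (ball x d) z * ennreal (norm (u z - u x)) \<partial>lborel)
     \<le> (\<integral>\<^sup>+z. (\<integral>\<^sup>+t. ennreal d * (indicator (ball x d) z * indicator {0..1} t * G (x + t *\<^sub>R (z - x))) \<partial>lborel) \<partial>lborel)"
  proof (rule nn_integral_mono)
    fix z
    show "indicator (ball x d) z * ennreal (norm (u z - u x))
      \<le> (\<integral>\<^sup>+t. ennreal d * (indicator (ball x d) z * indicator {0..1} t * G (x + t *\<^sub>R (z - x))) \<partial>lborel)"
    proof (cases "z \<in> ball x d")
      case True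
      have "ennreal (norm (u z - u x)) \<le> ennreal (norm (z - x)) * (\<integral>\<^sup>+t. indicator {0..1} t * ennreal (g (x + t *\<^sub>R (z - x))) \<partial>lborel)"
        using True S d by (intro norm_diff_le_nn_integral_segment[OF S(1) _ _ der g]) auto
      also have "\<dots> \<le> ennreal d * (\<integral>\<^sup>+t. indicator {0..1} t * ennreal (g (x + t *\<^sub>R (z - x))) \<partial>lborel)"
        using True by (intro mult_right_mono ennreal_leI) (auto simp: dist_norm norm_minus_commute)
      also have "(\<integral>\<^sup>+t. indicator {0..1} t * ennreal (g (x + t *\<^sub>R (z - x))) \<partial>lborel)
          = (\<integral>\<^sup>+t. indicator (ball x d) z * indicator {0..1} t * G (x + t *\<^sub>R (z - x)) \<partial>lborel)"
      proof (rule nn_integral_cong)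
        fix t
        have "x + t *\<^sub>R (z - x) \<in> S" if "t \<in> {0..1}"
          using inS[OF True that] S(3) by blast
        then show "indicator {0..1} t * ennreal (g (x + t *\<^sub>R (z - x))) = indicator (ball x d) z * indicator {0..1} t * G (x + t *\<^sub>R (z - x))"
          using True by (cases "t \<in> {0..1}") (simp_all add: G_def)
      qed
      also have "ennreal d * \<dots> = (\<integral>\<^sup>+t. ennreal d * (indicator (ball x d) z * indicator {0..1} t * G (x + t *\<^sub>R (z - x))) \<partial>lborel)"
        by (rule nn_integral_cmult[symmetric]) measurable
      finally show ?thesis using True by simp
    qed simp
  qed
  also have "\<dots> = (\<integral>\<^sup>+t. (\<integral>\<^sup>+z. ennreal d * (indicator (ball x d) z * indicator {0..1} t * G (x + t *\<^sub>R (z - x))) \<partial>lborel) \<partial>lborel)"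
    by (rule lborel_pair.Fubini'[symmetric]) measurable
  also have "\<dots> \<le> (\<integral>\<^sup>+t. indicator {0..1::real} t * (ennreal d * \<kappa> * emeasure lborel (ball x d)) \<partial>lborel)"
  \<comment> \<open>The dilation with factor \<open>t\<close> degenerates at \<open>t = 0\<close>,
    so that single parameter is excluded.\<close>
  proof (rule nn_integral_mono_AE, rule AE_I[where N="{0::real}"])
    show "{t \<in> space lborel. \<not> (\<integral>\<^sup>+z. ennreal d * (indicator (ball x d) z * indicator {0..1} t * G (x + t *\<^sub>R (z - x))) \<partial>lborel)
        \<le> indicator {0..1} t * (ennreal d * \<kappa> * emeasure lborel (ball x d))} \<subseteq> {0::real}"
    proof clarify
      fix t :: real
      assume *: "\<not> (\<integral>\<^sup>+z. ennreal d * (indicator (ball x d) z * indicator {0..1} t * G (x + t *\<^sub>R (z - x))) \<partial>lborel)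
        \<le> indicator {0..1} t * (ennreal d * \<kappa> * emeasure lborel (ball x d))"
      show "t = 0"
      proof (rule ccontr)
        assume "t \<noteq> 0"
        have "t \<in> {0..1}"
        proof (rule ccontr)
          assume "t \<notin> {0..1}"
          then have "indicator {0..1} t = (0::ennreal)" by simp
          then show False using * by simp
        qed
        with \<open>t \<noteq> 0\<close> have t: "0 < t" "t \<le> 1" by auto
        define F where "F z = indicator (ball x (t * d)) z * ennreal (g z)" for z
        have F: "F z = indicator (ball x (t * d)) z * G z" for z
        proof -
          have "t * d \<le> d" using t d by (simp add: mult_left_le_one_le)
          then have "ball x (t * d) \<subseteq> S" using S(3) subset_ball by (meson order_trans)
          then show ?thesis by (auto simp: F_def G_def split: split_indicator)
        qed
        have [measurable]: "F \<in> borel_measurable borel"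
          unfolding F by measurable
        have "(\<integral>\<^sup>+z. ennreal d * (indicator (ball x d) z * indicator {0..1} t * G (x + t *\<^sub>R (z - x))) \<partial>lborel)
          = (\<integral>\<^sup>+z. ennreal d * (indicator (ball x d) (x + z) * indicator {0..1} t * G (x + t *\<^sub>R ((x + z) - x))) \<partial>lborel)"
          by (rule nn_integral_lborel_translate[symmetric]) measurable
        also have "\<dots> = (\<integral>\<^sup>+z. ennreal d * F (x + t *\<^sub>R z) \<partial>lborel)"
          unfolding F using t by (intro nn_integral_cong) (auto simp: dist_norm split: split_indicator)
        also have "\<dots> = ennreal d * (\<integral>\<^sup>+z. F (x + t *\<^sub>R z) \<partial>lborel)"
          by (rule nn_integral_cmult) measurable
        also have "(\<integral>\<^sup>+z. F (x + t *\<^sub>R z) \<partial>lborel) = ennreal (1 / t ^ ?n) * (\<integral>\<^sup>+z. F (x + z) \<partial>lborel)"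
          using t by (intro nn_integral_lborel_scaleR) auto
        also have "(\<integral>\<^sup>+z. F (x + z) \<partial>lborel) = (\<integral>\<^sup>+z. F z \<partial>lborel)"
          by (rule nn_integral_lborel_translate) measurable
        also have "ennreal d * (ennreal (1 / t ^ ?n) * (\<integral>\<^sup>+z. F z \<partial>lborel)) \<le> ennreal d * (ennreal (1 / t ^ ?n) * (\<kappa> * emeasure lborel (ball x (t * d))))"
          unfolding F_def using t d by (intro mult_left_mono M) (auto simp: mult_left_le_one_le)
        also have "emeasure lborel (ball x (t * d)) = ennreal (t ^ ?n) * emeasure lborel (ball x d)"
          using t d by (rule_tac emeasure_lborel_ball_mult)
        also have "ennreal d * (ennreal (1 / t ^ ?n) * (\<kappa> * (ennreal (t ^ ?n) * emeasure lborel (ball x d))))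
          = (ennreal (1 / t ^ ?n) * ennreal (t ^ ?n)) * (ennreal d * \<kappa> * emeasure lborel (ball x d))"
          by (simp only: mult_ac)
        also have "ennreal (1 / t ^ ?n) * ennreal (t ^ ?n) = 1"
          using t by (simp add: ennreal_mult'[symmetric])
        finally show False using * t by simp
      qed
    qed
  qed auto
  also have "\<dots> = ennreal d * \<kappa> * emeasure lborel (ball x d)"
    by (subst nn_integral_multc) auto
  finally show ?thesis .
qed

text \<open>Compare \<open>u x\<close> and \<open>u y\<close> with \<open>u z\<close> and average
  over \<open>z\<close> in the ball \<open>B\<close> that has the segment from \<open>x\<close> to
  \<open>y\<close> as a diameter. It lies in both balls of radius \<open>d\<close> and has
  \<open>2^n\<close> times smaller volume; with the two terms of the triangle inequality this gives
  the factor \<open>2^(n + 1)\<close>.\<close>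

lemma norm_diff_le_maximal:
  fixes u :: "'a::euclidean_space \<Rightarrow> 'b::euclidean_space"
  assumes S: "convex S" "open S" "ball x (norm (x - y)) \<subseteq> S" "ball y (norm (x - y)) \<subseteq> S"
    and der: "\<And>y. y \<in> S \<Longrightarrow> (u has_derivative D y) (at y)"
    and g: "continuous_on S g" "\<And>y v. y \<in> S \<Longrightarrow> norm (D y v) \<le> g y * norm v"
    and \<kappa>: "\<kappa> \<ge> 0"
    and M: "\<And>w r. w \<in> {x, y} \<Longrightarrow> 0 < r \<Longrightarrow> r \<le> norm (x - y) \<Longrightarrow>
      (\<integral>\<^sup>+z. indicator (ball w r) z * ennreal (g z) \<partial>lborel) \<le> ennreal \<kappa> * emeasure lborel (ball w r)"
  shows "norm (u x - u y) \<le> 2 ^ (DIM('a) + 1) * \<kappa> * norm (x - y)"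
proof (cases "x = y")
  case False
  let ?n = "DIM('a)"
  define d where "d = norm (x - y)"
  have d: "d > 0" using False by (simp add: d_def)
  define B where "B = ball ((1/2) *\<^sub>R (x + y)) (d / 2)"
  have B: "B \<subseteq> ball x d" "B \<subseteq> ball y d"
  proof -
    have "norm ((1/2) *\<^sub>R (x + y) - x) = d / 2" "norm ((1/2) *\<^sub>R (x + y) - y) = d / 2"
    proof -
      have "(1/2) *\<^sub>R (x + y) - x = (-1/2) *\<^sub>R (x - y)" "(1/2) *\<^sub>R (x + y) - y = (1/2) *\<^sub>R (x - y)"
        by (simp_all add: algebra_simps scaleR_2[symmetric] flip: scaleR_left_distrib)
      then show "norm ((1/2) *\<^sub>R (x + y) - x) = d / 2" "norm ((1/2) *\<^sub>R (x + y) - y) = d / 2"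
        unfolding d_def by simp_all
    qed
    then show "B \<subseteq> ball x d" "B \<subseteq> ball y d"
      unfolding B_def using d by (auto simp: ball_subset_ball_iff dist_norm)
  qed
  have cont: "continuous_on S u"
    using der has_derivative_continuous_on has_derivative_at_withinI by blast
  have mB: "emeasure lborel B = ennreal ((d/2) ^ ?n) * emeasure lborel (ball (0::'a) 1)"
    unfolding B_def using d by (intro emeasure_lborel_ball_scale) simp
  have mb: "emeasure lborel (ball w d) = ennreal (2 ^ ?n) * emeasure lborel B" for w :: 'a
    using emeasure_lborel_ball_mult[of 2 "d / 2" w] emeasure_lborel_ball_scale[of "d / 2" w] d mB by simp
  have [measurable]: "ball w d \<in> sets borel" "B \<in> sets borel" for w :: 'a by (auto simp: B_def)
  have meas: "(\<lambda>z. indicator (ball w d) z * ennreal (norm (u z - u w))) \<in> borel_measurable borel" if "ball w d \<subseteq> S" for w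
  proof -
    have "(\<lambda>z. indicator (ball w d) z *\<^sub>R norm (u z - u w)) \<in> borel_measurable borel"
      using that by (intro borel_measurable_continuous_on_indicator continuous_intros continuous_on_subset[OF cont]) auto
    then have "(\<lambda>z. ennreal (indicator (ball w d) z *\<^sub>R norm (u z - u w))) \<in> borel_measurable borel" by simp
    also have "(\<lambda>z. ennreal (indicator (ball w d) z *\<^sub>R norm (u z - u w))) = (\<lambda>z. indicator (ball w d) z * ennreal (norm (u z - u w)))"
      by (auto simp: fun_eq_iff split: split_indicator)
    finally show ?thesis .
  qed
  have "ennreal (norm (u x - u y)) * emeasure lborel B = (\<integral>\<^sup>+z. ennreal (norm (u x - u y)) * indicator B z \<partial>lborel)"
    by (subst nn_integral_cmult_indicator) auto
  also have "\<dots> \<le> (\<integral>\<^sup>+z. indicator (ball x d) z * ennreal (norm (u z - u x)) + indicator (ball y d) z * ennreal (norm (u z - u y)) \<partial>lborel)"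
  proof (rule nn_integral_mono)
    fix z
    have "norm (u x - u y) \<le> norm (u z - u x) + norm (u z - u y)" by norm
    then show "ennreal (norm (u x - u y)) * indicator B z \<le> indicator (ball x d) z * ennreal (norm (u z - u x)) + indicator (ball y d) z * ennreal (norm (u z - u y))"
      using B by (cases "z \<in> B") (auto simp: ennreal_plus[symmetric] simp del: ennreal_plus intro!: ennreal_leI split: split_indicator)
  qed
  also have "\<dots> = (\<integral>\<^sup>+z. indicator (ball x d) z * ennreal (norm (u z - u x)) \<partial>lborel) + (\<integral>\<^sup>+z. indicator (ball y d) z * ennreal (norm (u z - u y)) \<partial>lborel)"
    using meas[of x] meas[of y] S by (intro nn_integral_add) (auto simp: d_def)
  also have "\<dots> \<le> ennreal d * ennreal \<kappa> * emeasure lborel (ball x d) + ennreal d * ennreal \<kappa> * emeasure lborel (ball y d)"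
    using S M d by (intro add_mono nn_integral_ball_norm_diff_le[where S=S and D=D and g=g] der g) (auto simp: d_def)
  also have "\<dots> = ennreal (2 ^ (?n + 1) * \<kappa> * d) * emeasure lborel B"
    unfolding mb using d \<kappa> by (simp add: ennreal_mult' mult_ac mult_2[symmetric] distrib_left[symmetric])
  finally have "ennreal (norm (u x - u y)) * emeasure lborel B \<le> ennreal (2 ^ (?n + 1) * \<kappa> * d) * emeasure lborel B" .
  moreover have "emeasure lborel B \<noteq> 0" "emeasure lborel B \<noteq> \<infinity>"
  proof -
    show "emeasure lborel B \<noteq> \<infinity>"
      unfolding B_def using emeasure_lborel_ball_finite by (metis less_irrefl)
    show "emeasure lborel B \<noteq> 0"
    proof -
      have "unit_ball_vol (real DIM('a)) \<noteq> 0"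
        by (metis less_irrefl of_nat_0_le_iff unit_ball_vol_pos)
      then show ?thesis
        unfolding B_def using d by (simp add: emeasure_ball)
    qed
  qed
  ultimately have "ennreal (norm (u x - u y)) \<le> ennreal (2 ^ (?n + 1) * \<kappa> * d)"
    by (simp add: ennreal_mult_le_mult_iff mult.commute[of _ "emeasure lborel B"])
  then show ?thesis using \<kappa> d by (simp add: d_def)
qed simp

text \<open>The derivatives of \<open>F (Suc k) - F k\<close> have \<open>L1\<close> norm of order
  \<open>4^(-k)\<close>. The weak type inequality at height \<open>2^(-k)\<close> therefore fails
  only on a set of measure of order \<open>2^(-k)\<close>, and these measures are summable. Off the
  exceptional sets \<open>f - F k\<close> is Lipschitz with constant of order \<open>2^(-k)\<close>,
  and \<open>H k\<close> is within \<open>2^(-k)\<close> of \<open>G\<close>; differentiating the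
  smooth \<open>F k\<close> for one large \<open>k\<close> yields the derivative of
  \<open>f\<close>. The Lipschitz bound relates points of \<open>A j\<close> only, hence the
  derivative within \<open>A j\<close>, which need not be a neighbourhood of any of its
  points.\<close>

lemma lusin_differentiability:
  fixes f :: "real^'n \<Rightarrow> real^'m" and G :: "real^'n \<Rightarrow> real^'n^'m"
  assumes R: "R < R'" and G [measurable]: "G \<in> borel_measurable borel"
    and der: "\<And>k x. x \<in> ball 0 R' \<Longrightarrow> (F k has_derivative (*v) (H k x)) (at x)"
    and cont: "\<And>k. continuous_on (ball 0 R') (H k)"
    and lim: "\<And>x. x \<in> ball 0 R' \<Longrightarrow> (\<lambda>k. F k x) \<longlonglongrightarrow> f x"
    and L1: "\<And>k. (\<integral>\<^sup>+x. indicator (ball 0 R') x * ennreal (norm (H k x - G x)) \<partial>lborel) \<le> ennreal ((1/4) ^ k)"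
  obtains A where "\<And>j::nat. A j \<in> sets borel" "\<And>j. A j \<subseteq> ball 0 R"
    "\<And>j x. x \<in> A j \<Longrightarrow> (f has_derivative (*v) (G x)) (at x within A j)"
    "AE x in lborel. x \<in> ball 0 R \<longrightarrow> x \<in> (\<Union>j. A j)"
proof -
  let ?n = "CARD('n)"
  let ?B = "ball (0::real^'n) R'"
  define h where "h k x = indicator ?B x * ennreal (norm (H k x - G x))" for k x
  define g where "g k x = indicator ?B x * ennreal (norm (H (Suc k) x - H k x))" for k x
  have [measurable]: "?B \<in> sets borel" by simp
  have Hm [measurable]: "(\<lambda>x. indicator ?B x *\<^sub>R H k x) \<in> borel_measurable borel" for k
    using cont by (intro borel_measurable_continuous_on_indicator) auto
  have hm [measurable]: "h k \<in> borel_measurable borel" for k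
  proof -
    have "h k = (\<lambda>x. indicator ?B x * ennreal (norm (indicator ?B x *\<^sub>R H k x - G x)))"
      by (auto simp: h_def fun_eq_iff split: split_indicator)
    then show ?thesis by (rule ssubst) measurable
  qed
  have gm [measurable]: "g k \<in> borel_measurable borel" for k
  proof -
    have "g k = (\<lambda>x. ennreal (norm (indicator ?B x *\<^sub>R H (Suc k) x - indicator ?B x *\<^sub>R H k x)))"
      by (auto simp: g_def fun_eq_iff split: split_indicator)
    then show ?thesis by (rule ssubst) measurable
  qed
  have h1: "(\<integral>\<^sup>+x. h k x \<partial>lborel) \<le> ennreal ((1/4) ^ k)" for k
    using L1 by (simp add: h_def)
  have g1: "(\<integral>\<^sup>+x. g k x \<partial>lborel) \<le> ennreal (2 * (1/4) ^ k)" for k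
  proof -
    have "(\<integral>\<^sup>+x. g k x \<partial>lborel) \<le> (\<integral>\<^sup>+x. h (Suc k) x + h k x \<partial>lborel)"
    proof (rule nn_integral_mono)
      fix x
      have "norm (H (Suc k) x - H k x) \<le> norm (H (Suc k) x - G x) + norm (H k x - G x)"
        by norm
      then show "g k x \<le> h (Suc k) x + h k x"
        by (auto simp: g_def h_def ennreal_plus[symmetric] simp del: ennreal_plus intro!: ennreal_leI split: split_indicator)
    qed
    also have "\<dots> = (\<integral>\<^sup>+x. h (Suc k) x \<partial>lborel) + (\<integral>\<^sup>+x. h k x \<partial>lborel)"
      by (rule nn_integral_add) auto
    also have "\<dots> \<le> ennreal ((1/4) ^ Suc k) + ennreal ((1/4) ^ k)"
      by (intro add_mono h1)
    also have "\<dots> = ennreal ((1/4) ^ Suc k + (1/4) ^ k)"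
      by (rule ennreal_plus[symmetric]) auto
    also have "\<dots> \<le> ennreal (2 * (1/4) ^ k)"
      by (intro ennreal_leI) simp
    finally show ?thesis .
  qed
  \<comment> \<open>Balls of radius below \<open>r0\<close> about points of the smaller ball stay
    where the \<open>F k\<close> are differentiable.\<close>
  define r0 where "r0 = R' - R"
  have r0: "r0 > 0" using R by (simp add: r0_def)
  define Bad where "Bad k = {x. \<exists>r. 0 < r \<and> r < r0 \<and> ennreal ((1/2) ^ k) * emeasure lborel (ball x r) < (\<integral>\<^sup>+z. indicator (ball x r) z * g k z \<partial>lborel)}" for k
  have "\<exists>W\<in>sets borel. Bad k \<subseteq> W
    \<and> ennreal ((1/2) ^ k) * emeasure lborel W \<le> ennreal (5 ^ DIM(real^'n)) * (\<integral>\<^sup>+z. g k z \<partial>lborel)" for k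
    unfolding Bad_def by (rule weak_type_maximal) simp
  then have "\<forall>k. \<exists>W. W \<in> sets borel \<and> Bad k \<subseteq> W
    \<and> ennreal ((1/2) ^ k) * emeasure lborel W \<le> ennreal (5 ^ DIM(real^'n)) * (\<integral>\<^sup>+z. g k z \<partial>lborel)"
    by blast
  from choice[OF this] obtain W where W_all: "\<forall>k. W k \<in> sets borel \<and> Bad k \<subseteq> W k
    \<and> ennreal ((1/2) ^ k) * emeasure lborel (W k) \<le> ennreal (5 ^ DIM(real^'n)) * (\<integral>\<^sup>+z. g k z \<partial>lborel)"
    ..
  then have W [measurable]: "\<And>k. W k \<in> sets borel"
    and W2: "\<And>k. ennreal ((1/2) ^ k) * emeasure lborel (W k) \<le> ennreal (5 ^ DIM(real^'n)) * (\<integral>\<^sup>+z. g k z \<partial>lborel)"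
    by blast+
  have W1: "(\<integral>\<^sup>+z. indicator (ball x r) z * g k z \<partial>lborel) \<le> ennreal ((1/2) ^ k) * emeasure lborel (ball x r)"
    if "x \<notin> W k" "0 < r" "r < r0" for k x r
  proof (rule ccontr)
    assume "\<not> ?thesis"
    then have "x \<in> Bad k" using that by (auto simp: Bad_def not_le)
    then show False using W_all that by blast
  qed
  have half: "ennreal (2 ^ k) * (ennreal ((1/2) ^ k) * X) = X" for k X
    by (simp add: mult.assoc[symmetric] ennreal_mult'[symmetric] power_one_over)
  have two4: "2 ^ k * (1/4) ^ k = (1/2 :: real) ^ k" for k
    by (simp add: power_mult_distrib[symmetric])
  have W3: "emeasure lborel (W k) \<le> ennreal (5 ^ ?n * 2 * (1/2) ^ k)" for k
  proof -
    have "emeasure lborel (W k) = ennreal (2 ^ k) * (ennreal ((1/2) ^ k) * emeasure lborel (W k))"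
      by (simp add: half)
    also have "\<dots> \<le> ennreal (2 ^ k) * (ennreal (5 ^ DIM(real^'n)) * ennreal (2 * (1/4) ^ k))"
      using W2[of k] g1[of k] by (intro mult_left_mono order.trans[OF W2] g1) auto
    also have "\<dots> = ennreal (5 ^ ?n * 2 * (2 ^ k * (1/4) ^ k))"
      by (simp add: ennreal_mult'[symmetric] mult_ac)
    finally show ?thesis unfolding two4 .
  qed
  \<comment> \<open>Markov's inequality at height \<open>2^(-k)\<close>: off \<open>V k\<close> the
    matrices \<open>H k x\<close> and \<open>G x\<close> are close pointwise, which the bound on
    averages in \<open>W k\<close> does not provide.\<close>
  define V where "V k = {x \<in> UNIV. 1 \<le> ennreal (2 ^ k) * h k x}" for k
  have V [measurable]: "V k \<in> sets borel" for k unfolding V_def by simp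
  have V3: "emeasure lborel (V k) \<le> ennreal ((1/2) ^ k)" for k
  proof -
    have "emeasure lborel (V k) \<le> ennreal (2 ^ k) * (\<integral>\<^sup>+x. h k x * indicator UNIV x \<partial>lborel)"
      unfolding V_def by (rule nn_integral_Markov_inequality) auto
    also have "\<dots> \<le> ennreal (2 ^ k) * ennreal ((1/4) ^ k)"
      using h1[of k] by (intro mult_left_mono) auto
    also have "\<dots> = ennreal ((1/2) ^ k)"
      by (simp add: ennreal_mult'[symmetric] two4)
    finally show ?thesis .
  qed
  define Z where "Z k = W k \<union> V k" for k
  have Z [measurable]: "Z k \<in> sets borel" for k by (simp add: Z_def)
  have Z3: "emeasure lborel (Z k) \<le> ennreal ((5 ^ ?n * 2 + 1) * (1/2) ^ k)" for k
  proof -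
    have "emeasure lborel (Z k) \<le> emeasure lborel (W k) + emeasure lborel (V k)"
      unfolding Z_def by (rule emeasure_subadditive) auto
    also have "\<dots> \<le> ennreal (5 ^ ?n * 2 * (1/2) ^ k) + ennreal ((1/2) ^ k)"
      by (intro add_mono W3 V3)
    also have "\<dots> = ennreal ((5 ^ ?n * 2 + 1) * (1/2) ^ k)"
      by (simp add: ennreal_plus[symmetric] distrib_right del: ennreal_plus)
    finally show ?thesis .
  qed
  \<comment> \<open>Points that avoid every exceptional set from index \<open>j\<close> on; by
    Borel-Cantelli almost every point of the ball does so for some \<open>j\<close>.\<close>
  define A where "A j = ball 0 R - (\<Union>k\<in>{j..}. Z k)" for j
  have tele: "norm ((F (Suc k) x - F k x) - (F (Suc k) y - F k y)) \<le> 2 ^ (?n + 1) * (1/2) ^ k * norm (x - y)"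
    if "x \<in> A j" "y \<in> A j" "j \<le> k" "norm (x - y) < r0" for x y j k
  proof -
    have b: "ball w r \<subseteq> ?B" if "w \<in> {x, y}" "r < r0" for w r
    proof -
      have "norm w < R" using that \<open>x \<in> A j\<close> \<open>y \<in> A j\<close> by (auto simp: A_def)
      show ?thesis
      proof
        fix z assume "z \<in> ball w r"
        then have "norm (z - w) < r" by (simp add: dist_norm norm_minus_commute)
        moreover have "norm z \<le> norm w + norm (z - w)" by norm
        ultimately show "z \<in> ?B" using \<open>norm w < R\<close> that by (simp add: r0_def)
      qed
    qed
    have nW: "w \<notin> W k" if "w \<in> {x, y}" for w
      using that \<open>x \<in> A j\<close> \<open>y \<in> A j\<close> \<open>j \<le> k\<close> by (auto simp: A_def Z_def)
    have "norm ((\<lambda>x. F (Suc k) x - F k x) x - (\<lambda>x. F (Suc k) x - F k x) y) \<le> 2 ^ (DIM(real^'n) + 1) * (1/2) ^ k * norm (x - y)"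
    proof (rule norm_diff_le_maximal[where S="?B" and D="\<lambda>x v. (H (Suc k) x - H k x) *v v" and g="\<lambda>x. norm (H (Suc k) x - H k x)"])
      show "((\<lambda>x. F (Suc k) x - F k x) has_derivative (\<lambda>v. (H (Suc k) y - H k y) *v v)) (at y)" if "y \<in> ?B" for y
        using has_derivative_diff[OF der[OF that, of "Suc k"] der[OF that, of k]]
        by (simp add: matrix_vector_mult_diff_rdistrib)
      show "continuous_on ?B (\<lambda>x. norm (H (Suc k) x - H k x))"
        by (intro continuous_intros cont)
      show "norm ((H (Suc k) y - H k y) *v v) \<le> norm (H (Suc k) y - H k y) * norm v" for y v
        by (rule norm_matrix_vector_mult_le)
      fix w r assume w: "w \<in> {x, y}" "0 < r" "r \<le> norm (x - y)"
      have "indicator (ball w r) z * ennreal (norm (H (Suc k) z - H k z)) = indicator (ball w r) z * g k z" for z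
        using b[OF w(1), of r] w that by (auto simp: g_def split: split_indicator)
      then show "(\<integral>\<^sup>+z. indicator (ball w r) z * ennreal (norm (H (Suc k) z - H k z)) \<partial>lborel) \<le> ennreal ((1/2) ^ k) * emeasure lborel (ball w r)"
        using W1[OF nW[OF w(1)] w(2), of] w that by simp
    qed (use b that in auto)
    then show ?thesis by simp
  qed
  \<comment> \<open>The factor \<open>1 - (1/2) ^ l\<close> is the partial sum of the geometric
    series; carrying it along makes the induction close exactly.\<close>
  have tele2: "norm ((F (k + l) x - F k x) - (F (k + l) y - F k y)) \<le> 2 ^ (?n + 2) * (1/2) ^ k * (1 - (1/2) ^ l) * norm (x - y)"
    if "x \<in> A j" "y \<in> A j" "j \<le> k" "norm (x - y) < r0" for x y j k l
  proof (induction l)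
    case (Suc l)
    have "norm ((F (k + Suc l) x - F k x) - (F (k + Suc l) y - F k y))
      \<le> norm ((F (Suc (k + l)) x - F (k + l) x) - (F (Suc (k + l)) y - F (k + l) y)) + norm ((F (k + l) x - F k x) - (F (k + l) y - F k y))"
      by (rule order_trans[OF _ norm_triangle_ineq]) (simp add: algebra_simps)
    also have "\<dots> \<le> 2 ^ (?n + 1) * (1/2) ^ (k + l) * norm (x - y) + 2 ^ (?n + 2) * (1/2) ^ k * (1 - (1/2) ^ l) * norm (x - y)"
      using that by (intro add_mono Suc tele[of x j y]) auto
    also have "\<dots> = 2 ^ (?n + 2) * (1/2) ^ k * (1 - (1/2) ^ Suc l) * norm (x - y)"
      by (simp add: algebra_simps power_add)
    finally show ?case .
  qed simp
  have inB: "x \<in> ?B" if "x \<in> A j" for x j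
    using that R by (auto simp: A_def)
  have lip: "norm ((f x - F k x) - (f y - F k y)) \<le> 2 ^ (?n + 2) * (1/2) ^ k * norm (x - y)"
    if "x \<in> A j" "y \<in> A j" "j \<le> k" "norm (x - y) < r0" for x y j k
  proof (rule tendsto_upperbound)
    have "(\<lambda>l. F (l + k) x) \<longlonglongrightarrow> f x" "(\<lambda>l. F (l + k) y) \<longlonglongrightarrow> f y"
      using lim[OF inB] that by (auto intro: LIMSEQ_ignore_initial_segment)
    then show "(\<lambda>l. norm ((F (k + l) x - F k x) - (F (k + l) y - F k y))) \<longlonglongrightarrow> norm ((f x - F k x) - (f y - F k y))"
      by (intro tendsto_intros) (simp_all add: add.commute)
    show "\<forall>\<^sub>F l in sequentially. norm ((F (k + l) x - F k x) - (F (k + l) y - F k y)) \<le> 2 ^ (?n + 2) * (1/2) ^ k * norm (x - y)"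
    proof (rule always_eventually, rule allI)
      fix l
      have "norm ((F (k + l) x - F k x) - (F (k + l) y - F k y)) \<le> 2 ^ (?n + 2) * (1/2) ^ k * (1 - (1/2) ^ l) * norm (x - y)"
        using that by (rule tele2)
      also have "\<dots> \<le> 2 ^ (?n + 2) * (1/2) ^ k * 1 * norm (x - y)"
        by (intro mult_right_mono mult_left_mono) auto
      finally show "norm ((F (k + l) x - F k x) - (F (k + l) y - F k y)) \<le> 2 ^ (?n + 2) * (1/2) ^ k * norm (x - y)" by simp
    qed
  qed auto
  have hA: "norm (H k x - G x) \<le> (1/2) ^ k" if "x \<in> A j" "j \<le> k" for x j k
  proof -
    have "x \<notin> V k" using that by (auto simp: A_def Z_def)
    then have "ennreal (2 ^ k) * ennreal (norm (H k x - G x)) < 1"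
      using inB[OF that(1)] by (auto simp: V_def h_def not_le)
    then have "ennreal (2 ^ k * norm (H k x - G x)) < ennreal 1"
      by (simp add: ennreal_mult')
    then have "2 ^ k * norm (H k x - G x) < 1"
      by (subst (asm) ennreal_less_iff) auto
    then show ?thesis by (simp add: field_simps power_one_over)
  qed
  show ?thesis
  proof (rule that)
    show "A j \<in> sets borel" "A j \<subseteq> ball 0 R" for j unfolding A_def by auto
    show "(f has_derivative (*v) (G x)) (at x within A j)" if x: "x \<in> A j" for j x
      unfolding has_derivative_within_alt
    proof (intro conjI allI impI)
      show "bounded_linear ((*v) (G x))" by (simp add: matrix_vector_mul_bounded_linear)
      fix e :: real assume e: "e > 0"
      \<comment> \<open>\<open>c\<close> adds the Lipschitz constant of \<open>f - F k\<close> on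
        \<open>A j\<close> and the error of \<open>H k\<close> against \<open>G\<close>, both in
        units of \<open>2^(-k)\<close>. They are allotted half of \<open>e\<close>, and the
        differentiability of \<open>F k\<close> the other half.\<close>
      define c :: real where "c = 2 ^ (?n + 2) + 1"
      have c: "c > 0" by (simp add: c_def add_pos_pos)
      obtain k0 where k0: "(1/2) ^ k0 < e / (2 * c)"
        using real_arch_pow_inv[of "e / (2 * c)" "1/2"] e c by auto
      define k where "k = max j k0"
      have "(1/2) ^ k \<le> (1/2 :: real) ^ k0"
        by (rule power_decreasing) (auto simp: k_def)
      then have k2: "(1/2) ^ k \<le> e / (2 * c)"
        using k0 by linarith
      have k1: "j \<le> k" by (simp add: k_def)
      note k = k1 k2
      obtain d where d: "d > 0" "\<And>y. norm (y - x) < d \<Longrightarrow> norm (F k y - F k x - H k x *v (y - x)) \<le> e / 2 * norm (y - x)"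
        using der[OF inB[OF x], of k] e unfolding has_derivative_within_alt by (metis UNIV_I half_gt_zero)
      show "\<exists>d>0. \<forall>y\<in>A j. norm (y - x) < d \<longrightarrow> norm (f y - f x - G x *v (y - x)) \<le> e * norm (y - x)"
      proof (intro exI[of _ "min d r0"] conjI ballI impI)
        fix y assume y: "y \<in> A j" "norm (y - x) < min d r0"
        have "norm (f y - f x - G x *v (y - x)) \<le> norm ((f y - F k y) - (f x - F k x)) + norm (F k y - F k x - H k x *v (y - x)) + norm ((H k x - G x) *v (y - x))"
          by (simp add: matrix_vector_mult_diff_rdistrib) norm
        also have "\<dots> \<le> 2 ^ (?n + 2) * (1/2) ^ k * norm (y - x) + e / 2 * norm (y - x) + (1/2) ^ k * norm (y - x)"
          using y k x by (intro add_mono lip[of _ j] d order.trans[OF norm_matrix_vector_mult_le] mult_right_mono hA[of _ j]) auto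
        also have "\<dots> = (c * (1/2) ^ k + e / 2) * norm (y - x)"
          by (simp add: c_def algebra_simps)
        also have "\<dots> \<le> e * norm (y - x)"
          using k(2) c by (intro mult_right_mono) (auto simp: field_simps)
        finally show "norm (f y - f x - G x *v (y - x)) \<le> e * norm (y - x)" .
      qed (use d r0 in auto)
    qed
    have "AE x in lborel. eventually (\<lambda>k. x \<in> space lborel - Z k) sequentially"
    proof (rule borel_cantelli_AE1)
      show fin: "emeasure lborel (Z k) < \<infinity>" for k
        using Z3[of k] by (simp add: le_less_trans)
      show "summable (\<lambda>k. measure lborel (Z k))"
      proof (rule summable_comparison_test')
        show "summable (\<lambda>k. (5 ^ ?n * 2 + 1) * (1/2::real) ^ k)"
          by (intro summable_mult summable_geometric) auto
        show "norm (measure lborel (Z k)) \<le> (5 ^ ?n * 2 + 1) * (1/2) ^ k" for k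
        proof -
          have "ennreal (measure lborel (Z k)) \<le> ennreal ((5 ^ ?n * 2 + 1) * (1/2) ^ k)"
            using Z3[of k] fin[of k] by (simp add: emeasure_eq_ennreal_measure)
          then show ?thesis by simp
        qed
      qed
    qed simp
    then show "AE x in lborel. x \<in> ball 0 R \<longrightarrow> x \<in> (\<Union>j. A j)"
    proof eventually_elim
      case (elim x)
      then obtain j where "\<And>k. k \<ge> j \<Longrightarrow> x \<notin> Z k" by (auto simp: eventually_sequentially)
      then show ?case by (auto simp: A_def)
    qed
  qed
qed

subsection \<open>Mollification\<close>

text \<open>For \<open>k = 0\<close> this is the classical flat function; the powers of
  \<open>inverse t\<close> are the factors that its derivatives produce.\<close>

definition bump_profile :: "nat \<Rightarrow> real \<Rightarrow> real" where
  "bump_profile k t = (if t > 0 then exp (- inverse t) * inverse t ^ k else 0)"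

text \<open>The point where the two branches meet is the delicate one: there the difference quotient
  from the right is \<open>u^(k + 1) / exp u\<close> with \<open>u = 1 / h\<close>, which tends to
  0.\<close>

lemma has_real_derivative_bump_profile:
  "(bump_profile k has_real_derivative bump_profile (k + 2) t - real k * bump_profile (k + 1) t) (at t)"
proof -
  consider "t > 0" | "t < 0" | "t = 0" by linarith
  then show ?thesis
  proof cases
    case 1
    have "((\<lambda>t. exp (- inverse t) * inverse t ^ k) has_real_derivative bump_profile (k + 2) t - real k * bump_profile (k + 1) t) (at t)"
    proof -
      have 0: "(inverse has_real_derivative - (inverse t)\<^sup>2) (at t)"
        using 1 by (auto intro!: derivative_eq_intros simp: power2_eq_square)
      have A: "((\<lambda>t. exp (- inverse t)) has_real_derivative exp (- inverse t) * (inverse t)\<^sup>2) (at t)"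
        using 1 by (auto intro!: derivative_eq_intros simp: power2_eq_square)
      have B: "(inverse t)\<^sup>2 * (real k * inverse t ^ (k - Suc 0)) = real k * inverse t ^ (k + 1)"
        by (cases k) (auto simp: power2_eq_square)
      have "exp (- inverse t) * (inverse t)\<^sup>2 * inverse t ^ k + real k * (- (inverse t)\<^sup>2 * inverse t ^ (k - Suc 0)) * exp (- inverse t)
        = exp (- inverse t) * inverse t ^ (k + 2) - exp (- inverse t) * ((inverse t)\<^sup>2 * (real k * inverse t ^ (k - Suc 0)))"
        by (simp add: power_add power2_eq_square)
      also have "\<dots> = bump_profile (k + 2) t - real k * bump_profile (k + 1) t"
        unfolding B using 1 by (simp add: bump_profile_def)
      finally show ?thesis
        using DERIV_mult[OF A DERIV_power[OF 0, of k]] by simp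
    qed
    then show ?thesis
      by (rule has_field_derivative_transform_within_open[where S="{0<..}"]) (use 1 in \<open>auto simp: bump_profile_def\<close>)
  next
    case 2
    have "((\<lambda>t. 0) has_real_derivative 0) (at t)" by simp
    then have "(bump_profile k has_real_derivative 0) (at t)"
      by (rule has_field_derivative_transform_within_open[where S="{..<0}"]) (use 2 in \<open>auto simp: bump_profile_def\<close>)
    then show ?thesis using 2 by (simp add: bump_profile_def)
  next
    case 3
    have "((\<lambda>h. bump_profile k h / h) \<longlongrightarrow> 0) (at 0)"
      unfolding filterlim_at_split
    proof
      have "((\<lambda>h. bump_profile k h / h) \<longlongrightarrow> 0) (at_left 0) \<longleftrightarrow> ((\<lambda>h::real. 0::real) \<longlongrightarrow> 0) (at_left 0)"
        by (rule tendsto_cong) (auto simp: eventually_at_filter bump_profile_def)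
      then show "((\<lambda>h. bump_profile k h / h) \<longlongrightarrow> 0) (at_left 0)" by simp
      have "((\<lambda>h::real. inverse h ^ Suc k / exp (inverse h)) \<longlongrightarrow> 0) (at_right 0)"
        by (rule filterlim_compose[OF tendsto_power_div_exp_0 filterlim_inverse_at_top_right])
      moreover have "((\<lambda>h. bump_profile k h / h) \<longlongrightarrow> 0) (at_right 0) \<longleftrightarrow> ((\<lambda>h::real. inverse h ^ Suc k / exp (inverse h)) \<longlongrightarrow> 0) (at_right 0)"
        by (rule tendsto_cong) (auto simp: eventually_at_filter bump_profile_def exp_minus divide_inverse mult_ac)
      ultimately show "((\<lambda>h. bump_profile k h / h) \<longlongrightarrow> 0) (at_right 0)" by simp
    qed
    then have "(bump_profile k has_real_derivative 0) (at 0)"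
      by (simp add: DERIV_def bump_profile_def)
    then show ?thesis using 3 by (simp add: bump_profile_def)
  qed
qed

lemma continuous_on_bump_profile [continuous_intros]:
  assumes "continuous_on S f"
  shows "continuous_on S (\<lambda>x. bump_profile k (f x))"
proof -
  have "continuous_on UNIV (bump_profile k)"
    by (rule DERIV_continuous_on) (rule has_field_derivative_at_within, rule has_real_derivative_bump_profile)
  then show ?thesis
    using assms by (rule continuous_on_compose2) auto
qed

text \<open>This class is closed under differentiation because the derivative of \<open>bump_profile k\<close> is a
  combination of \<open>bump_profile (k + 1)\<close> and \<open>bump_profile (k + 2)\<close>; hence its members are smooth.\<close>

inductive bump_algebra :: "real \<Rightarrow> real^'n \<Rightarrow> (real^'n \<Rightarrow> real) \<Rightarrow> bool" for e c where
  const: "bump_algebra e c (\<lambda>x. a)"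
| inner: "bump_algebra e c (\<lambda>x. x \<bullet> v)"
| profile: "bump_algebra e c (\<lambda>x. bump_profile k (e\<^sup>2 - (norm (x - c))\<^sup>2))"
| add: "bump_algebra e c f \<Longrightarrow> bump_algebra e c g \<Longrightarrow> bump_algebra e c (\<lambda>x. f x + g x)"
| mult: "bump_algebra e c f \<Longrightarrow> bump_algebra e c g \<Longrightarrow> bump_algebra e c (\<lambda>x. f x * g x)"

lemma has_derivative_bump:
  fixes c :: "'a::real_inner"
  shows "((\<lambda>x. bump_profile k (e\<^sup>2 - (norm (x - c))\<^sup>2)) has_derivative
    (\<lambda>v. (bump_profile (k + 2) (e\<^sup>2 - (norm (x - c))\<^sup>2) - real k * bump_profile (k + 1) (e\<^sup>2 - (norm (x - c))\<^sup>2))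
        * (- 2 * ((x - c) \<bullet> v)))) (at x)"
proof -
  have "((\<lambda>x. e\<^sup>2 - (norm (x - c))\<^sup>2) has_derivative (\<lambda>v. - 2 * ((x - c) \<bullet> v))) (at x)"
    unfolding power2_norm_eq_inner
    by (auto intro!: derivative_eq_intros simp: inner_commute)
  from has_derivative_compose[OF this has_real_derivative_bump_profile[unfolded has_field_derivative_def]]
  show ?thesis by simp
qed

lemma bump_algebra_derivative:
  assumes "bump_algebra e c f"
  shows "\<exists>D. (\<forall>x. (f has_derivative D x) (at x)) \<and> (\<forall>v. bump_algebra e c (\<lambda>x. D x v))"
  using assms
proof induction
  case (const a)
  show ?case by (rule exI[of _ "\<lambda>x v. 0"]) (auto intro: bump_algebra.const)
next
  case (inner w)
  show ?case
    by (rule exI[of _ "\<lambda>x v. v \<bullet> w"]) (auto intro!: bump_algebra.const derivative_eq_intros)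
next
  case (profile k)
  have "bump_algebra e c (\<lambda>x. (bump_profile (k + 2) (e\<^sup>2 - (norm (x - c))\<^sup>2) + (- real k) * bump_profile (k + 1) (e\<^sup>2 - (norm (x - c))\<^sup>2))
        * ((- 2) * (x \<bullet> v + (- (c \<bullet> v)))))" for v
    by (intro bump_algebra.intros)
  then have "bump_algebra e c (\<lambda>x. (bump_profile (k + 2) (e\<^sup>2 - (norm (x - c))\<^sup>2) - real k * bump_profile (k + 1) (e\<^sup>2 - (norm (x - c))\<^sup>2))
        * (- 2 * ((x - c) \<bullet> v)))" for v
    by (simp add: inner_diff_left)
  then show ?case
    by (intro exI[of _ "\<lambda>x v. (bump_profile (k + 2) (e\<^sup>2 - (norm (x - c))\<^sup>2) - real k * bump_profile (k + 1) (e\<^sup>2 - (norm (x - c))\<^sup>2))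
        * (- 2 * ((x - c) \<bullet> v))"] conjI allI has_derivative_bump)
next
  case (add f g)
  then obtain D E where "\<And>x. (f has_derivative D x) (at x)" "\<And>v. bump_algebra e c (\<lambda>x. D x v)"
     "\<And>x. (g has_derivative E x) (at x)" "\<And>v. bump_algebra e c (\<lambda>x. E x v)" by blast
  then show ?case
    by (intro exI[of _ "\<lambda>x v. D x v + E x v"]) (auto intro: has_derivative_add bump_algebra.add)
next
  case (mult f g)
  then obtain D E where DE: "\<And>x. (f has_derivative D x) (at x)" "\<And>v. bump_algebra e c (\<lambda>x. D x v)"
     "\<And>x. (g has_derivative E x) (at x)" "\<And>v. bump_algebra e c (\<lambda>x. E x v)" by blast
  with mult show ?case
    by (intro exI[of _ "\<lambda>x v. f x * E x v + D x v * g x"]) (auto intro!: has_derivative_mult bump_algebra.add bump_algebra.mult)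
qed

lemma bump_algebra_continuously_differentiable:
  assumes "bump_algebra e c f"
  shows "continuously_differentiable k f"
  using assms
proof (induction k arbitrary: f)
  case 0
  from bump_algebra_derivative[OF 0] obtain D where D: "\<forall>x. (f has_derivative D x) (at x)"
    by (elim exE conjE)
  have "continuous_on UNIV f"
    by (rule has_derivative_continuous_on[where f'=D]) (use D in simp)
  then show ?case by simp
next
  case (Suc k)
  from bump_algebra_derivative[OF Suc.prems] obtain D
    where D: "\<forall>x. (f has_derivative D x) (at x)" "\<forall>v. bump_algebra e c (\<lambda>x. D x v)"
    by (elim exE conjE)
  have "frechet_derivative f (at x) = D x" for x
    using D(1) by (metis frechet_derivative_at)
  moreover have "f differentiable (at x)" for x
    using D(1) unfolding differentiable_def by blast
  ultimately show ?case
    using D(2) Suc.IH by simp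
qed

text \<open>The squared norm keeps the function smooth at the origin, and the vanishing of the
  profile on negative arguments provides the compact support.\<close>

definition bump :: "real \<Rightarrow> 'a::euclidean_space \<Rightarrow> real" where
  "bump e x = bump_profile 0 (e\<^sup>2 - (norm x)\<^sup>2)"

lemma bump_pos_iff: "e > 0 \<Longrightarrow> bump e x > 0 \<longleftrightarrow> norm x < e"
proof -
  assume "e > 0"
  then have "(norm x)\<^sup>2 < e\<^sup>2 \<longleftrightarrow> norm x < e"
    using power2_less_imp_less[of "norm x" e] power_strict_mono[of "norm x" e 2] by auto
  then show ?thesis
    by (simp add: bump_def bump_profile_def)
qed

lemma bump_nonneg: "bump e x \<ge> 0"
  by (simp add: bump_def bump_profile_def)

lemma bump_eq_0: "e > 0 \<Longrightarrow> norm x \<ge> e \<Longrightarrow> bump e x = 0"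
  using bump_pos_iff[of e x] bump_nonneg[of e x] by linarith

lemma bump_le_1: "bump e x \<le> 1"
  by (simp add: bump_def bump_profile_def)

lemma continuous_on_bump: "continuous_on S (bump e)"
  unfolding bump_def[abs_def] by (intro continuous_intros)

lemma borel_measurable_bump [measurable]: "bump e \<in> borel_measurable borel"
  by (intro borel_measurable_continuous_onI continuous_on_bump)

lemma test_function_bump:
  fixes x :: "real^'n"
  assumes e: "e > 0" and "cball x e \<subseteq> \<Omega>"
  shows "test_function \<Omega> (\<lambda>z. k * bump e (z - x))"
proof -
  have "closure {z. k * bump e (z - x) \<noteq> 0} \<subseteq> cball x e"
  proof (rule closure_minimal)
    show "{z. k * bump e (z - x) \<noteq> 0} \<subseteq> cball x e"
      using bump_eq_0[OF e] by (force simp: dist_norm norm_minus_commute)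
  qed simp
  moreover have "continuously_differentiable i (\<lambda>z. k * bump e (z - x))" for i
    unfolding bump_def
    by (rule bump_algebra_continuously_differentiable[where e=e and c=x]) (intro bump_algebra.intros)
  ultimately show ?thesis
    unfolding test_function_def using assms(2)
    by (meson bounded_cball bounded_subset closed_closure compact_eq_bounded_closed order_trans)
qed

lemma nn_integral_bump:
  assumes "e > 0"
  shows "(\<integral>\<^sup>+x. ennreal (bump e (x::'a::euclidean_space)) \<partial>lborel) < \<infinity>"
    and "(\<integral>\<^sup>+x. ennreal (bump e (x::'a)) \<partial>lborel) > 0"
proof -
  have "(\<integral>\<^sup>+x. ennreal (bump e (x::'a)) \<partial>lborel) \<le> (\<integral>\<^sup>+x. indicator (ball 0 e) (x::'a) \<partial>lborel)"
    using bump_eq_0[OF assms, where 'a='a] by (intro nn_integral_mono) (auto simp: bump_le_1 not_less split: split_indicator)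
  also have "\<dots> < \<infinity>" using emeasure_lborel_ball_finite[of "0::'a" e] by simp
  finally show "(\<integral>\<^sup>+x. ennreal (bump e (x::'a)) \<partial>lborel) < \<infinity>" .
  have "(\<integral>\<^sup>+x. ennreal (bump e (x::'a)) \<partial>lborel) \<noteq> 0"
  proof
    assume "(\<integral>\<^sup>+x. ennreal (bump e (x::'a)) \<partial>lborel) = 0"
    then have "AE x in lborel. ennreal (bump e (x::'a)) = 0"
      by (subst (asm) nn_integral_0_iff_AE) auto
    then have "AE x in lborel. (x::'a) \<notin> ball 0 e"
      by eventually_elim (use bump_pos_iff[OF assms, where 'a='a] in \<open>auto simp: ennreal_eq_0_iff not_less[symmetric]\<close>)
    then have "emeasure lborel (ball (0::'a) e) = 0"
      by (subst (asm) AE_iff_measurable[where N="ball 0 e"]) auto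
    moreover have "unit_ball_vol (real DIM('a)) \<noteq> 0"
      by (metis less_irrefl of_nat_0_le_iff unit_ball_vol_pos)
    ultimately show False using assms by (simp add: emeasure_ball)
  qed
  then show "(\<integral>\<^sup>+x. ennreal (bump e (x::'a)) \<partial>lborel) > 0"
    by (simp add: zero_less_iff_neq_zero)
qed

definition mollifier :: "real \<Rightarrow> 'a::euclidean_space \<Rightarrow> real" where
  "mollifier e x = inverse (enn2real (\<integral>\<^sup>+y. ennreal (bump e (y::'a)) \<partial>lborel)) * bump e x"

lemma mollifier_nonneg: "mollifier e x \<ge> 0"
  by (simp add: mollifier_def bump_nonneg)

lemma mollifier_eq_0: "e > 0 \<Longrightarrow> norm x \<ge> e \<Longrightarrow> mollifier e x = 0"
  by (simp add: mollifier_def bump_eq_0)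

lemma continuous_on_mollifier: "continuous_on S (mollifier e)"
  unfolding mollifier_def[abs_def] by (intro continuous_intros continuous_on_bump)

lemma borel_measurable_mollifier [measurable]: "mollifier e \<in> borel_measurable borel"
  by (intro borel_measurable_continuous_onI continuous_on_mollifier)

lemma mollifier_bounded: "\<exists>B. \<forall>x::'a::euclidean_space. mollifier e x \<le> B"
  unfolding mollifier_def using bump_le_1 by (meson inverse_nonnegative_iff_nonnegative enn2real_nonneg mult_left_mono)

lemma nn_integral_mollifier:
  assumes "e > 0"
  shows "(\<integral>\<^sup>+x. ennreal (mollifier e (x::'a::euclidean_space)) \<partial>lborel) = 1"
proof -
  define I where "I = (\<integral>\<^sup>+y. ennreal (bump e (y::'a)) \<partial>lborel)"
  have I: "I < \<infinity>" "I > 0" using nn_integral_bump[OF assms, where 'a='a] by (auto simp: I_def)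
  define r where "r = enn2real I"
  have r: "I = ennreal r" "r > 0" using I by (auto simp: r_def enn2real_positive_iff less_top)
  have "(\<integral>\<^sup>+x. ennreal (mollifier e (x::'a)) \<partial>lborel) = (\<integral>\<^sup>+x. ennreal (inverse r) * ennreal (bump e (x::'a)) \<partial>lborel)"
    using r by (simp add: mollifier_def r_def I_def ennreal_mult' bump_nonneg)
  also have "\<dots> = ennreal (inverse r) * I"
    unfolding I_def by (rule nn_integral_cmult) measurable
  also have "\<dots> = 1" using r by (simp add: ennreal_mult'[symmetric])
  finally show ?thesis .
qed

text \<open>For an indicator, squeeze \<open>A\<close> between a compact \<open>C\<close> and an
  open \<open>U\<close> with small differences. A translation shorter than the distance from
  \<open>C\<close> to the complement of \<open>U\<close> keeps \<open>C\<close> inside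
  \<open>U\<close>, so \<open>A\<close> and its translate can differ only on the shells
  \<open>A - C\<close>, \<open>U - A\<close> and their translates. Sums and dominated limits then
  follow from the induction principle for integrable functions.\<close>

lemma integrable_translation_continuous:
  fixes h :: "'a::euclidean_space \<Rightarrow> 'b::euclidean_space"
  assumes "integrable lborel h"
  shows "\<forall>\<epsilon>>0. \<exists>\<delta>>0. \<forall>w. norm w < \<delta> \<longrightarrow> (\<integral>\<^sup>+x. ennreal (norm (h (w + x) - h x)) \<partial>lborel) \<le> ennreal \<epsilon>"
  using assms
proof induction
  case (base A c)
  then have A [measurable]: "A \<in> sets borel" "emeasure lborel A < \<infinity>" by auto
  show ?case
  proof (intro allI impI)
    fix \<epsilon> :: real assume \<epsilon>: "\<epsilon> > 0"
    \<comment> \<open>Four shells occur, each weighted by \<open>norm c\<close>; the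
      \<open>+ 1\<close> covers \<open>c = 0\<close>.\<close>
    define \<epsilon>' where "\<epsilon>' = \<epsilon> / (4 * (norm c + 1))"
    have nc: "norm c + 1 > 0" by (simp add: add_nonneg_pos)
    have \<epsilon>': "\<epsilon>' > 0" "norm c * (4 * \<epsilon>') \<le> \<epsilon>"
      using \<epsilon> nc by (auto simp: \<epsilon>'_def field_simps)
    obtain U where U: "open U" "A \<subseteq> U" "emeasure lborel (U - A) < ennreal \<epsilon>'"
      using outer_regular_lborel[of A \<epsilon>'] A \<epsilon>' by auto
    obtain T where T: "closed T" "T \<subseteq> A" "A - T \<in> lmeasurable" "emeasure lebesgue (A - T) < ennreal (\<epsilon>' / 2)"
      using sets_lebesgue_inner_closed[of A "\<epsilon>' / 2"] A \<epsilon>' by auto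
    have [measurable]: "T \<in> sets borel" using T by (simp add: borel_closed)
    have "(\<lambda>N. emeasure lborel (T - cball 0 (real N))) \<longlonglongrightarrow> emeasure lborel (\<Inter>N. T - cball 0 (real N))"
    proof (rule Lim_emeasure_decseq)
      show "decseq (\<lambda>N. T - cball 0 (real N))"
        by (auto simp: decseq_def)
      show "emeasure lborel (T - cball 0 (real N)) \<noteq> \<infinity>" for N
      proof -
        have "emeasure lborel (T - cball 0 (real N)) \<le> emeasure lborel A"
          using T by (intro emeasure_mono) auto
        then show ?thesis using A by auto
      qed
    qed auto
    also have "(\<Inter>N. T - cball 0 (real N)) = {}"
      by auto (meson real_arch_simple)
    finally have "\<forall>\<^sub>F N in sequentially. emeasure lborel (T - cball 0 (real N)) < ennreal (\<epsilon>' / 2)"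
      using \<epsilon>' by (intro order_tendstoD) auto
    then obtain N :: nat where N: "emeasure lborel (T - cball 0 (real N)) < ennreal (\<epsilon>' / 2)"
      by (auto simp: eventually_sequentially)
    define C where "C = T \<inter> cball 0 (real N)"
    have C: "compact C" "C \<subseteq> A" using T by (auto simp: C_def closed_Int_compact)
    have [measurable]: "C \<in> sets borel" "U \<in> sets borel" using C U by (auto simp: borel_closed compact_imp_closed)
    have AC: "emeasure lborel (A - C) \<le> ennreal \<epsilon>'"
    proof -
      have "emeasure lborel (A - C) \<le> emeasure lborel ((A - T) \<union> (T - cball 0 (real N)))"
        by (rule emeasure_mono) (auto simp: C_def)
      also have "\<dots> \<le> emeasure lborel (A - T) + emeasure lborel (T - cball 0 (real N))"
        by (rule emeasure_subadditive) auto
      also have "\<dots> \<le> ennreal (\<epsilon>' / 2) + ennreal (\<epsilon>' / 2)"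
        using T N by (intro add_mono) auto
      also have "\<dots> = ennreal \<epsilon>'" using \<epsilon>' by (simp add: ennreal_plus[symmetric] del: ennreal_plus)
      finally show ?thesis .
    qed
    obtain \<delta> where \<delta>: "\<delta> > 0" "\<And>x w. x \<in> C \<Longrightarrow> norm w < \<delta> \<Longrightarrow> w + x \<in> U"
    proof -
      obtain \<delta> where "\<delta> > 0" "(\<Union>x\<in>C. ball x \<delta>) \<subseteq> U"
        using compact_subset_open_imp_ball_epsilon_subset[OF C(1) U(1)] C(2) U(2) by auto
      moreover have "w + x \<in> ball x \<delta>" if "norm w < \<delta>" for w x
        using that by (simp add: dist_norm)
      ultimately show ?thesis by (intro that[of \<delta>]) blast+
    qed
    show "\<exists>\<delta>>0. \<forall>w. norm w < \<delta> \<longrightarrow>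
        (\<integral>\<^sup>+x. ennreal (norm (indicator A (w + x) *\<^sub>R c - indicator A x *\<^sub>R c)) \<partial>lborel) \<le> ennreal \<epsilon>"
    proof (intro exI[of _ \<delta>] conjI allI impI)
      fix w :: 'a assume w: "norm w < \<delta>"
      have "(\<integral>\<^sup>+x. ennreal (norm (indicator A (w + x) *\<^sub>R c - indicator A x *\<^sub>R c)) \<partial>lborel)
        \<le> (\<integral>\<^sup>+x. ennreal (norm c) * (indicator (A - C) x + indicator (U - A) (w + x) + indicator (A - C) (w + x) + indicator (U - A) x) \<partial>lborel)"
      proof (rule nn_integral_mono)
        fix x
        \<comment> \<open>The second inclusion is the first one for the translation by
          \<open>- w\<close>.\<close>
        have "x \<in> C \<Longrightarrow> w + x \<in> U" "w + x \<in> C \<Longrightarrow> x \<in> U"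
          using \<delta>(2)[of x w] \<delta>(2)[of "w + x" "- w"] w by auto
        then show "ennreal (norm (indicator A (w + x) *\<^sub>R c - indicator A x *\<^sub>R c))
          \<le> ennreal (norm c) * (indicator (A - C) x + indicator (U - A) (w + x) + indicator (A - C) (w + x) + indicator (U - A) x)"
          using C(2) U(2) by (cases "x \<in> A"; cases "w + x \<in> A"; cases "x \<in> C"; cases "w + x \<in> C") (auto simp: distrib_left)
      qed
      also have "\<dots> = ennreal (norm c) * (\<integral>\<^sup>+x. (indicator (A - C) x + indicator (U - A) (w + x) + indicator (A - C) (w + x) + indicator (U - A) x) \<partial>lborel)"
        by (rule nn_integral_cmult) measurable
      also have "(\<integral>\<^sup>+x. (indicator (A - C) x + indicator (U - A) (w + x) + indicator (A - C) (w + x) + indicator (U - A) x) \<partial>lborel)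
         = (\<integral>\<^sup>+x. indicator (A - C) x \<partial>lborel) + (\<integral>\<^sup>+x. indicator (U - A) (w + x) \<partial>lborel) + (\<integral>\<^sup>+x. indicator (A - C) (w + x) \<partial>lborel) + (\<integral>\<^sup>+x. indicator (U - A) x \<partial>lborel)"
      proof -
        have m: "(\<lambda>x. indicator (A - C) x :: ennreal) \<in> borel_measurable lborel" "(\<lambda>x. indicator (U - A) x :: ennreal) \<in> borel_measurable lborel"
          "(\<lambda>x. indicator (A - C) (w + x) :: ennreal) \<in> borel_measurable lborel" "(\<lambda>x. indicator (U - A) (w + x) :: ennreal) \<in> borel_measurable lborel"
          by measurable
        show ?thesis by (simp only: nn_integral_add m borel_measurable_add)
      qed
      also have "\<dots> = emeasure lborel (A - C) + emeasure lborel (U - A) + emeasure lborel (A - C) + emeasure lborel (U - A)"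
        by (simp add: nn_integral_lborel_translate)
      also have "\<dots> \<le> ennreal \<epsilon>' + ennreal \<epsilon>' + ennreal \<epsilon>' + ennreal \<epsilon>'"
        using AC U by (intro add_mono) auto
      also have "\<dots> = ennreal (4 * \<epsilon>')" using \<epsilon>' by (simp add: ennreal_plus[symmetric] del: ennreal_plus)
      also have "ennreal (norm c) * \<dots> = ennreal (norm c * (4 * \<epsilon>'))" by (simp add: ennreal_mult')
      also have "\<dots> \<le> ennreal \<epsilon>" using \<epsilon>' by (intro ennreal_leI)
      finally show "(\<integral>\<^sup>+x. ennreal (norm (indicator A (w + x) *\<^sub>R c - indicator A x *\<^sub>R c)) \<partial>lborel) \<le> ennreal \<epsilon>"
        by (simp add: mult_left_mono)
    qed (rule \<delta>(1))
  qed
next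
  case (add f g)
  have [measurable]: "f \<in> borel_measurable borel" "g \<in> borel_measurable borel"
  proof -
    have f: "integrable lborel f" and g: "integrable lborel g" by fact+
    show "f \<in> borel_measurable borel" "g \<in> borel_measurable borel"
      using borel_measurable_integrable[OF f] borel_measurable_integrable[OF g] by simp_all
  qed
  show ?case
  proof (intro allI impI)
    fix \<epsilon> :: real assume "\<epsilon> > 0"
    then have half: "\<epsilon> / 2 > 0" by simp
    obtain \<delta>1 where \<delta>1: "\<delta>1 > 0"
      "\<forall>w. norm w < \<delta>1 \<longrightarrow> (\<integral>\<^sup>+x. ennreal (norm (f (w + x) - f x)) \<partial>lborel) \<le> ennreal (\<epsilon> / 2)"
      using add.IH(1)[THEN spec, THEN mp, OF half] by (elim exE conjE)
    obtain \<delta>2 where \<delta>2: "\<delta>2 > 0"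
      "\<forall>w. norm w < \<delta>2 \<longrightarrow> (\<integral>\<^sup>+x. ennreal (norm (g (w + x) - g x)) \<partial>lborel) \<le> ennreal (\<epsilon> / 2)"
      using add.IH(2)[THEN spec, THEN mp, OF half] by (elim exE conjE)
    note \<delta> = \<delta>1 \<delta>2
    show "\<exists>\<delta>>0. \<forall>w. norm w < \<delta> \<longrightarrow> (\<integral>\<^sup>+x. ennreal (norm (f (w + x) + g (w + x) - (f x + g x))) \<partial>lborel) \<le> ennreal \<epsilon>"
    proof (intro exI[of _ "min \<delta>1 \<delta>2"] conjI allI impI)
      fix w :: 'a assume w: "norm w < min \<delta>1 \<delta>2"
      have "(\<integral>\<^sup>+x. ennreal (norm (f (w + x) + g (w + x) - (f x + g x))) \<partial>lborel)
        \<le> (\<integral>\<^sup>+x. ennreal (norm (f (w + x) - f x)) + ennreal (norm (g (w + x) - g x)) \<partial>lborel)"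
        by (intro nn_integral_mono) (auto simp: ennreal_plus[symmetric] simp del: ennreal_plus intro!: ennreal_leI norm_diff_triangle_ineq)
      also have "\<dots> = (\<integral>\<^sup>+x. ennreal (norm (f (w + x) - f x)) \<partial>lborel) + (\<integral>\<^sup>+x. ennreal (norm (g (w + x) - g x)) \<partial>lborel)"
        by (rule nn_integral_add) measurable
      also have "\<dots> \<le> ennreal (\<epsilon> / 2) + ennreal (\<epsilon> / 2)"
        using w \<delta> by (intro add_mono) auto
      also have "\<dots> = ennreal \<epsilon>" using \<open>\<epsilon> > 0\<close> by (simp add: ennreal_plus[symmetric] del: ennreal_plus)
      finally show "(\<integral>\<^sup>+x. ennreal (norm (f (w + x) + g (w + x) - (f x + g x))) \<partial>lborel) \<le> ennreal \<epsilon>" .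
    qed (use \<delta> in auto)
  qed
next
  case (lim f s)
  have [measurable]: "f \<in> borel_measurable borel" "s i \<in> borel_measurable borel" for i
  proof -
    have f: "integrable lborel f" and s: "integrable lborel (s i)" for i by fact+
    show "f \<in> borel_measurable borel" "s i \<in> borel_measurable borel" for i
      using borel_measurable_integrable[OF f] borel_measurable_integrable[OF s[of i]] by simp_all
  qed
  \<comment> \<open>The induction principle supplies
    \<open>norm (s i x) \<le> 2 * norm (f x)\<close>, hence the majorant
    \<open>3 * norm (f x)\<close>.\<close>
  have conv: "(\<lambda>i. \<integral>\<^sup>+x. ennreal (norm (f x - s i x)) \<partial>lborel) \<longlonglongrightarrow> (\<integral>\<^sup>+x. 0 \<partial>(lborel::'a measure))"
  proof (rule nn_integral_dominated_convergence[where w="\<lambda>x. ennreal (3 * norm (f x))"])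
    have "(\<integral>\<^sup>+x. ennreal (3 * norm (f x)) \<partial>lborel) = ennreal 3 * (\<integral>\<^sup>+x. ennreal (norm (f x)) \<partial>lborel)"
      by (simp add: ennreal_mult' nn_integral_cmult)
    then show "(\<integral>\<^sup>+x. ennreal (3 * norm (f x)) \<partial>lborel) < \<infinity>"
      using lim(4) by (simp add: integrable_iff_bounded ennreal_mult_less_top)
    show "AE x in lborel. ennreal (norm (f x - s i x)) \<le> ennreal (3 * norm (f x))" for i
    proof (rule AE_I2, rule ennreal_leI)
      fix x
      have "norm (f x - s i x) \<le> norm (f x) + norm (s i x)" by norm
      then show "norm (f x - s i x) \<le> 3 * norm (f x)" using lim(3)[of x i] by simp
    qed
    show "AE x in lborel. (\<lambda>i. ennreal (norm (f x - s i x))) \<longlonglongrightarrow> 0"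
    proof (rule AE_I2)
      fix x
      have "(\<lambda>i. norm (f x - s i x)) \<longlonglongrightarrow> norm (f x - f x)"
        using lim(2)[of x] by (intro tendsto_intros) auto
      then have "(\<lambda>i. ennreal (norm (f x - s i x))) \<longlonglongrightarrow> ennreal (norm (f x - f x))"
        by (rule tendsto_ennrealI)
      then show "(\<lambda>i. ennreal (norm (f x - s i x))) \<longlonglongrightarrow> 0" by simp
    qed
  qed auto
  show ?case
  proof (intro allI impI)
    fix \<epsilon> :: real assume \<epsilon>: "\<epsilon> > 0"
    have "\<forall>\<^sub>F i in sequentially. (\<integral>\<^sup>+x. ennreal (norm (f x - s i x)) \<partial>lborel) < ennreal (\<epsilon> / 3)"
      using conv \<epsilon> by (intro order_tendstoD) auto
    then obtain i where i: "(\<integral>\<^sup>+x. ennreal (norm (f x - s i x)) \<partial>lborel) < ennreal (\<epsilon> / 3)"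
      by (auto simp: eventually_sequentially)
    have third: "\<epsilon> / 3 > 0" using \<epsilon> by simp
    obtain \<delta> where \<delta>': "\<delta> > 0" "\<forall>w. norm w < \<delta> \<longrightarrow> (\<integral>\<^sup>+x. ennreal (norm (s i (w + x) - s i x)) \<partial>lborel) \<le> ennreal (\<epsilon> / 3)"
      using lim(5)[of i, THEN spec, THEN mp, OF third] by (elim exE conjE)
    note \<delta> = \<delta>'(1) \<delta>'(2)[rule_format]
    show "\<exists>\<delta>>0. \<forall>w. norm w < \<delta> \<longrightarrow> (\<integral>\<^sup>+x. ennreal (norm (f (w + x) - f x)) \<partial>lborel) \<le> ennreal \<epsilon>"
    proof (intro exI[of _ \<delta>] conjI allI impI)
      fix w :: 'a assume w: "norm w < \<delta>"
      have "(\<integral>\<^sup>+x. ennreal (norm (f (w + x) - f x)) \<partial>lborel)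
        \<le> (\<integral>\<^sup>+x. ennreal (norm (f (w + x) - s i (w + x))) + ennreal (norm (s i (w + x) - s i x)) + ennreal (norm (f x - s i x)) \<partial>lborel)"
      proof (rule nn_integral_mono)
        fix x
        have "norm (f (w + x) - f x) \<le> norm (f (w + x) - s i (w + x)) + norm (s i (w + x) - s i x) + norm (f x - s i x)" by norm
        then show "ennreal (norm (f (w + x) - f x)) \<le> ennreal (norm (f (w + x) - s i (w + x))) + ennreal (norm (s i (w + x) - s i x)) + ennreal (norm (f x - s i x))"
          by (simp add: ennreal_plus[symmetric] del: ennreal_plus)
      qed
      also have "\<dots> = (\<integral>\<^sup>+x. ennreal (norm (f (w + x) - s i (w + x))) \<partial>lborel) + (\<integral>\<^sup>+x. ennreal (norm (s i (w + x) - s i x)) \<partial>lborel) + (\<integral>\<^sup>+x. ennreal (norm (f x - s i x)) \<partial>lborel)"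
      proof -
        have m: "(\<lambda>x. ennreal (norm (f (w + x) - s i (w + x)))) \<in> borel_measurable lborel"
          "(\<lambda>x. ennreal (norm (s i (w + x) - s i x))) \<in> borel_measurable lborel"
          "(\<lambda>x. ennreal (norm (f x - s i x))) \<in> borel_measurable lborel"
          by measurable
        show ?thesis by (simp only: nn_integral_add m borel_measurable_add)
      qed
      also have "(\<integral>\<^sup>+x. ennreal (norm (f (w + x) - s i (w + x))) \<partial>lborel) = (\<integral>\<^sup>+x. ennreal (norm (f x - s i x)) \<partial>lborel)"
        by (rule nn_integral_lborel_translate) measurable
      also have "(\<integral>\<^sup>+x. ennreal (norm (f x - s i x)) \<partial>lborel) + (\<integral>\<^sup>+x. ennreal (norm (s i (w + x) - s i x)) \<partial>lborel) + (\<integral>\<^sup>+x. ennreal (norm (f x - s i x)) \<partial>lborel)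
          \<le> ennreal (\<epsilon> / 3) + ennreal (\<epsilon> / 3) + ennreal (\<epsilon> / 3)"
        using i \<delta>(2)[OF w] by (intro add_mono) auto
      also have "\<dots> = ennreal \<epsilon>" using \<epsilon> by (simp add: ennreal_plus[symmetric] del: ennreal_plus)
      finally show "(\<integral>\<^sup>+x. ennreal (norm (f (w + x) - f x)) \<partial>lborel) \<le> ennreal \<epsilon>" .
    qed (rule \<delta>(1))
  qed
qed

text \<open>Written with \<open>z - x\<close>, the kernel is, as a function of the integration
  variable, a test function centred at \<open>x\<close>, ready for insertion into the weak
  derivative identity.\<close>

definition mollify :: "real \<Rightarrow> ('a::euclidean_space \<Rightarrow> 'b::euclidean_space) \<Rightarrow> 'a \<Rightarrow> 'b" where
  "mollify e h x = (\<integral>z. mollifier e (z - x) *\<^sub>R h z \<partial>lborel)"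

lemma integrable_mollifier_scaleR:
  fixes h :: "'a::euclidean_space \<Rightarrow> 'b::euclidean_space"
  assumes h: "integrable lborel h"
  shows "integrable lborel (\<lambda>z. mollifier e (z - x) *\<^sub>R h z)"
proof -
  have [measurable]: "h \<in> borel_measurable borel" using borel_measurable_integrable[OF h] by simp
  obtain B where B: "\<And>x::'a. mollifier e x \<le> B" using mollifier_bounded by blast
  have "B \<ge> 0" using B[of 0] mollifier_nonneg[of e "0::'a"] by linarith
  show ?thesis
  proof (rule Bochner_Integration.integrable_bound)
    show "integrable lborel (\<lambda>z. B *\<^sub>R h z)" using h by simp
    show "AE z in lborel. norm (mollifier e (z - x) *\<^sub>R h z) \<le> norm (B *\<^sub>R h z)"
      using B \<open>B \<ge> 0\<close> by (intro AE_I2) (simp add: mollifier_nonneg mult_right_mono)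
  qed measurable
qed

lemma integral_mollifier:
  assumes "e > 0"
  shows "integrable lborel (\<lambda>z::'a::euclidean_space. mollifier e (z - x))"
    and "(\<integral>z. mollifier e (z - x) \<partial>lborel) = 1"
proof -
  have "(\<integral>\<^sup>+z. ennreal (mollifier e (z - x)) \<partial>lborel) = (\<integral>\<^sup>+z. ennreal (mollifier e (- x + z)) \<partial>lborel)"
    by (simp add: add.commute)
  also have "\<dots> = 1"
    using nn_integral_lborel_translate[of "\<lambda>z::'a. ennreal (mollifier e z)" "- x"] nn_integral_mollifier[OF assms, where 'a='a] by simp
  finally have n: "(\<integral>\<^sup>+z. ennreal (mollifier e (z - x)) \<partial>lborel) = 1" .
  show "integrable lborel (\<lambda>z::'a::euclidean_space. mollifier e (z - x))"
    using n by (intro integrableI_nonneg) (auto simp: mollifier_nonneg)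
  show "(\<integral>z. mollifier e (z - x) \<partial>lborel) = 1"
    using n by (simp add: integral_eq_nn_integral mollifier_nonneg)
qed

lemma norm_mollify_diff_le:
  fixes h :: "'a::euclidean_space \<Rightarrow> 'b::euclidean_space"
  assumes h: "integrable lborel h" and e: "e > 0"
  shows "ennreal (norm (mollify e h x - h x)) \<le> (\<integral>\<^sup>+w. ennreal (mollifier e w) * ennreal (norm (h (w + x) - h x)) \<partial>lborel)"
proof -
  have [measurable]: "h \<in> borel_measurable borel" using borel_measurable_integrable[OF h] by simp
  have i1: "integrable lborel (\<lambda>z. mollifier e (z - x) *\<^sub>R h z)" by (rule integrable_mollifier_scaleR[OF h])
  have i2: "integrable lborel (\<lambda>z. mollifier e (z - x) *\<^sub>R h x)" using integral_mollifier(1)[OF e, of x] by (rule integrable_scaleR_left)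
  have "h x = (\<integral>z. mollifier e (z - x) *\<^sub>R h x \<partial>lborel)"
    using integral_mollifier[OF e, of x] by simp
  then have "mollify e h x - h x = (\<integral>z. mollifier e (z - x) *\<^sub>R h z \<partial>lborel) - (\<integral>z. mollifier e (z - x) *\<^sub>R h x \<partial>lborel)"
    by (simp add: mollify_def)
  also have "\<dots> = (\<integral>z. mollifier e (z - x) *\<^sub>R h z - mollifier e (z - x) *\<^sub>R h x \<partial>lborel)"
    by (rule Bochner_Integration.integral_diff[OF i1 i2, symmetric])
  finally have "ennreal (norm (mollify e h x - h x)) = ennreal (norm (\<integral>z. mollifier e (z - x) *\<^sub>R h z - mollifier e (z - x) *\<^sub>R h x \<partial>lborel))" by simp
  also have "\<dots> \<le> (\<integral>\<^sup>+z. ennreal (norm (mollifier e (z - x) *\<^sub>R h z - mollifier e (z - x) *\<^sub>R h x)) \<partial>lborel)"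
    by (rule integral_norm_bound_ennreal) (intro Bochner_Integration.integrable_diff i1 i2)
  also have "\<dots> = (\<integral>\<^sup>+z. ennreal (mollifier e (z - x)) * ennreal (norm (h z - h x)) \<partial>lborel)"
    by (intro nn_integral_cong) (simp add: scaleR_diff_right[symmetric] mollifier_nonneg ennreal_mult')
  also have "\<dots> = (\<integral>\<^sup>+w. ennreal (mollifier e (x + w - x)) * ennreal (norm (h (x + w) - h x)) \<partial>lborel)"
    by (rule nn_integral_lborel_translate[symmetric]) measurable
  finally show ?thesis by (simp add: add.commute)
qed

lemma norm_mollify_diff_le_osc:
  fixes h :: "'a::euclidean_space \<Rightarrow> 'b::euclidean_space"
  assumes h: "integrable lborel h" and e: "e > 0"
    and osc: "\<And>z. z \<in> ball x e \<Longrightarrow> norm (h z - h x) \<le> \<epsilon>"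
  shows "norm (mollify e h x - h x) \<le> \<epsilon>"
proof -
  have \<epsilon>: "\<epsilon> \<ge> 0" using osc[of x] e by simp
  have "ennreal (norm (mollify e h x - h x)) \<le> (\<integral>\<^sup>+w. ennreal (mollifier e w) * ennreal (norm (h (w + x) - h x)) \<partial>lborel)"
    by (rule norm_mollify_diff_le[OF h e])
  also have "\<dots> \<le> (\<integral>\<^sup>+w. ennreal (mollifier e w) * ennreal \<epsilon> \<partial>(lborel :: 'a measure))"
  proof (rule nn_integral_mono)
    fix w
    show "ennreal (mollifier e w) * ennreal (norm (h (w + x) - h x)) \<le> ennreal (mollifier e w) * ennreal \<epsilon>"
    proof (cases "norm w < e")
      case True
      then show ?thesis by (intro mult_left_mono ennreal_leI osc) (auto simp: dist_norm)
    qed (simp add: mollifier_eq_0 e)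
  qed
  also have "\<dots> = ennreal \<epsilon>"
    by (subst nn_integral_multc) (auto simp: nn_integral_mollifier[OF e])
  finally show ?thesis using \<epsilon> by simp
qed

lemma mollify_tendsto_L1:
  fixes h :: "'a::euclidean_space \<Rightarrow> 'b::euclidean_space"
  assumes h: "integrable lborel h" and \<epsilon>: "\<epsilon> > 0"
  shows "\<exists>\<delta>>0. \<forall>e. 0 < e \<longrightarrow> e < \<delta> \<longrightarrow> (\<integral>\<^sup>+x. ennreal (norm (mollify e h x - h x)) \<partial>lborel) \<le> ennreal \<epsilon>"
proof -
  have [measurable]: "h \<in> borel_measurable borel" using borel_measurable_integrable[OF h] by simp
  obtain \<delta> where \<delta>: "\<delta> > 0" "\<And>w. norm w < \<delta> \<Longrightarrow> (\<integral>\<^sup>+x. ennreal (norm (h (w + x) - h x)) \<partial>lborel) \<le> ennreal \<epsilon>"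
    using integrable_translation_continuous[OF h] \<epsilon> by blast
  show ?thesis
  proof (intro exI[of _ \<delta>] conjI allI impI)
    fix e assume e: "0 < e" "e < \<delta>"
    have "(\<integral>\<^sup>+x. ennreal (norm (mollify e h x - h x)) \<partial>lborel)
      \<le> (\<integral>\<^sup>+x. (\<integral>\<^sup>+w. ennreal (mollifier e w) * ennreal (norm (h (w + x) - h x)) \<partial>lborel) \<partial>lborel)"
      by (intro nn_integral_mono norm_mollify_diff_le h e)
    also have "\<dots> = (\<integral>\<^sup>+w. (\<integral>\<^sup>+x. ennreal (mollifier e w) * ennreal (norm (h (w + x) - h x)) \<partial>lborel) \<partial>lborel)"
      by (rule lborel_pair.Fubini'[symmetric]) measurable
    also have "\<dots> \<le> (\<integral>\<^sup>+w. ennreal (mollifier e w) * ennreal \<epsilon> \<partial>(lborel :: 'a measure))"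
    proof (rule nn_integral_mono)
      fix w :: 'a
      have "(\<integral>\<^sup>+x. ennreal (mollifier e w) * ennreal (norm (h (w + x) - h x)) \<partial>lborel)
         = ennreal (mollifier e w) * (\<integral>\<^sup>+x. ennreal (norm (h (w + x) - h x)) \<partial>lborel)"
        by (rule nn_integral_cmult) measurable
      also have "\<dots> \<le> ennreal (mollifier e w) * ennreal \<epsilon>"
      proof (cases "norm w < e")
        case True
        then show ?thesis using e by (intro mult_left_mono \<delta>) auto
      qed (simp add: mollifier_eq_0 e)
      finally show "(\<integral>\<^sup>+x. ennreal (mollifier e w) * ennreal (norm (h (w + x) - h x)) \<partial>lborel) \<le> ennreal (mollifier e w) * ennreal \<epsilon>" .
    qed
    also have "\<dots> = ennreal \<epsilon>"
      by (subst nn_integral_multc) (auto simp: nn_integral_mollifier[OF e(1)])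
    finally show "(\<integral>\<^sup>+x. ennreal (norm (mollify e h x - h x)) \<partial>lborel) \<le> ennreal \<epsilon>" .
  qed (rule \<delta>(1))
qed

lemma continuous_on_mollify:
  fixes h :: "'a::euclidean_space \<Rightarrow> 'b::euclidean_space"
  assumes h: "integrable lborel h"
  shows "continuous_on S (mollify e h)"
  unfolding continuous_on_sequentially
proof (intro ballI allI impI)
  fix s x assume "x \<in> S" and s: "(\<forall>n. s n \<in> S) \<and> s \<longlonglongrightarrow> x"
  have [measurable]: "h \<in> borel_measurable borel" using borel_measurable_integrable[OF h] by simp
  obtain B where B: "\<And>x::'a. mollifier e x \<le> B" using mollifier_bounded by blast
  have "(\<lambda>n. \<integral>z. mollifier e (z - s n) *\<^sub>R h z \<partial>lborel) \<longlonglongrightarrow> (\<integral>z. mollifier e (z - x) *\<^sub>R h z \<partial>lborel)"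
  proof (rule integral_dominated_convergence[where w="\<lambda>z. B * norm (h z)"])
    show "AE z in lborel. (\<lambda>n. mollifier e (z - s n) *\<^sub>R h z) \<longlonglongrightarrow> mollifier e (z - x) *\<^sub>R h z"
    proof (rule AE_I2)
      fix z
      have "(\<lambda>n. z - s n) \<longlonglongrightarrow> z - x" using s by (intro tendsto_intros) auto
      moreover have "isCont (mollifier e) (z - x)"
        using continuous_on_mollifier[of "UNIV :: 'a set" e] by (simp add: continuous_on_eq_continuous_at)
      ultimately have "(\<lambda>n. mollifier e (z - s n)) \<longlonglongrightarrow> mollifier e (z - x)"
        by (rule isCont_tendsto_compose[rotated])
      then show "(\<lambda>n. mollifier e (z - s n) *\<^sub>R h z) \<longlonglongrightarrow> mollifier e (z - x) *\<^sub>R h z"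
        by (intro tendsto_intros)
    qed
    show "AE z in lborel. norm (mollifier e (z - s n) *\<^sub>R h z) \<le> B * norm (h z)" for n
      using B by (intro AE_I2) (simp add: mollifier_nonneg mult_right_mono)
    show "integrable lborel (\<lambda>z. B * norm (h z))" using h by simp
  qed measurable
  then show "(mollify e h \<circ> s) \<longlonglongrightarrow> mollify e h x"
    by (simp add: comp_def mollify_def[abs_def])
qed

text \<open>Differentiate under the integral sign and shift the derivative of the kernel from
  \<open>x\<close> to \<open>z\<close>, which changes the sign; the kernel is a test function
  because \<open>R + e < R'\<close>, and the weak derivative identity changes the sign back.\<close>

lemma mollify_has_derivative:
  fixes u :: "real^'n \<Rightarrow> real" and g :: "real^'n \<Rightarrow> real^'n"
  assumes e: "e > 0" "R + e < R'" and x0: "x0 \<in> ball 0 R"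
    and u: "continuous_on (cball 0 R') u" "integrable lborel (\<lambda>x. indicator (ball 0 R') x *\<^sub>R u x)"
    and g: "integrable lborel (\<lambda>x. indicator (ball 0 R') x *\<^sub>R g x)"
    and weak: "\<And>\<phi> j. test_function (ball 0 R') \<phi> \<Longrightarrow>
      (\<integral>x. indicator (ball 0 R') x *\<^sub>R (u x * frechet_derivative \<phi> (at x) (axis j 1)) \<partial>lborel)
        = - (\<integral>x. indicator (ball 0 R') x *\<^sub>R (g x $ j * \<phi> x) \<partial>lborel)"
  shows "(mollify e (\<lambda>x. indicator (ball 0 R') x *\<^sub>R u x) has_derivative
     (\<lambda>v. mollify e (\<lambda>x. indicator (ball 0 R') x *\<^sub>R g x) x0 \<bullet> v)) (at x0)"
proof -
  let ?u = "\<lambda>x. indicator (ball 0 R') x *\<^sub>R u x" and ?g = "\<lambda>x. indicator (ball 0 R') x *\<^sub>R g x"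
  have R': "R' > 0"
  proof -
    have "R > 0" using x0 by (metis ball_eq_empty empty_iff not_le)
    then show ?thesis using e by simp
  qed
  \<comment> \<open>The Leibniz rule is applied on a box \<open>cbox a b\<close>, where the
    integrand has to be jointly continuous. Composing \<open>u\<close> with the projection onto the
    closed ball extends it continuously and changes nothing where the kernel is nonzero.\<close>
  define P where "P = closest_point (cball (0::real^'n) R')"
  define F where "F z = u (P z)" for z
  have cP: "continuous_on UNIV P" "\<And>z. P z \<in> cball 0 R'"
  proof -
    have ne: "closed (cball (0::real^'n) R')" "convex (cball (0::real^'n) R')" "cball (0::real^'n) R' \<noteq> {}"
      using R' by auto
    then show "continuous_on UNIV P" "\<And>z. P z \<in> cball 0 R'"
      unfolding P_def by (metis continuous_on_closest_point, metis closest_point_in_set)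
  qed
  have cF: "continuous_on UNIV F"
    unfolding F_def using cP by (intro continuous_on_compose2[OF u(1)]) auto
  have F: "F z = u z" if "z \<in> ball 0 R'" for z
    unfolding F_def P_def using that by (simp add: closest_point_self)
  obtain a b :: "real^'n" where ab: "cball 0 R' \<subseteq> cbox a b"
    using bounded_subset_cbox_symmetric[OF bounded_cball] by metis
  define c where "c = inverse (enn2real (\<integral>\<^sup>+y. ennreal (bump e (y::real^'n)) \<partial>lborel))"
  have mol: "mollifier e z = c * bump_profile 0 (e\<^sup>2 - (norm z)\<^sup>2)" for z :: "real^'n"
    by (simp add: mollifier_def c_def bump_def)
  \<comment> \<open>\<open>Q x z *\<^sub>R (z - x)\<close> is the gradient of the kernel in
    \<open>x\<close>. The derivative of \<open>bump_profile 0\<close> is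
    \<open>bump_profile 2\<close> alone, since the other term has the factor \<open>k = 0\<close>;
    the final 2 comes from the squared norm.\<close>
  define Q where "Q x z = c * bump_profile 2 (e\<^sup>2 - (norm (z - x))\<^sup>2) * 2" for x z :: "real^'n"
  define fx where "fx x z = (F z * Q x z) *\<^sub>R blinfun_inner_right (z - x)" for x z
  have far: "norm (z - x) \<ge> e" if "x \<in> ball 0 R" "z \<notin> ball 0 R'" for x z :: "real^'n"
  proof -
    have "norm z \<le> norm x + norm (z - x)" by norm
    then show ?thesis using that e by auto
  qed
  have eqF: "mollifier e (z - x) *\<^sub>R ?u z = mollifier e (z - x) * F z" if "x \<in> ball 0 R" for x z
    using F[of z] far[OF that, of z] mollifier_eq_0[OF e(1), of "z - x"] by (cases "z \<in> ball 0 R'") auto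
  have zero: "mollifier e (z - x) * F z = 0" if "x \<in> ball 0 R" "z \<notin> cbox a b" for x z
    using far[OF that(1), of z] mollifier_eq_0[OF e(1), of "z - x"] that(2) ab ball_subset_cball by (metis mult_zero_left subsetD)
  have hasint: "((\<lambda>z. mollifier e (z - x) * F z) has_integral mollify e ?u x) (cbox a b)" if x: "x \<in> ball 0 R" for x
  proof -
    have "((\<lambda>z. mollifier e (z - x) *\<^sub>R ?u z) has_integral mollify e ?u x) UNIV"
      unfolding mollify_def by (rule has_integral_integral_lborel) (rule integrable_mollifier_scaleR[OF u(2)])
    also have "(\<lambda>z. mollifier e (z - x) *\<^sub>R ?u z) = (\<lambda>z. if z \<in> cbox a b then mollifier e (z - x) * F z else 0)"
    proof (rule ext)
      fix z
      show "mollifier e (z - x) *\<^sub>R ?u z = (if z \<in> cbox a b then mollifier e (z - x) * F z else 0)"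
        unfolding eqF[OF x] using zero[OF x, of z] by simp
    qed
    finally show ?thesis by (subst (asm) has_integral_restrict_UNIV)
  qed
  have der: "((\<lambda>x. mollifier e (z - x) * F z) has_derivative blinfun_apply (fx x z)) (at x)" for x z
  proof -
    have "((\<lambda>x. c * bump_profile 0 (e\<^sup>2 - (norm (x - z))\<^sup>2) * F z) has_derivative
      (\<lambda>v. c * ((bump_profile (0 + 2) (e\<^sup>2 - (norm (x - z))\<^sup>2) - real 0 * bump_profile (0 + 1) (e\<^sup>2 - (norm (x - z))\<^sup>2))
        * (- 2 * ((x - z) \<bullet> v))) * F z)) (at x)"
      by (intro has_derivative_mult_left has_derivative_mult_right has_derivative_bump)
    moreover have "(\<lambda>v. c * ((bump_profile (0 + 2) (e\<^sup>2 - (norm (x - z))\<^sup>2) - real 0 * bump_profile (0 + 1) (e\<^sup>2 - (norm (x - z))\<^sup>2))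
        * (- 2 * ((x - z) \<bullet> v))) * F z) = blinfun_apply (fx x z)"
      by (simp add: fun_eq_iff fx_def Q_def blinfun.scaleR_left norm_minus_commute[of x z] inner_diff_left algebra_simps numeral_2_eq_2)
    ultimately show ?thesis by (simp add: mol norm_minus_commute)
  qed
  have cfx: "continuous_on (ball 0 R \<times> cbox a b) (\<lambda>(x, z). fx x z)"
    unfolding fx_def Q_def split_beta
    by (intro continuous_intros bounded_linear.continuous_on[OF bounded_linear_blinfun_inner_right] continuous_on_compose2[OF cF]) auto
  have leib: "((\<lambda>x. integral (cbox a b) (\<lambda>z. mollifier e (z - x) * F z)) has_derivative integral (cbox a b) (fx x0)) (at x0 within ball 0 R)"
    by (rule leibniz_rule[OF has_derivative_at_withinI[OF der] _ cfx x0]) (use hasint in auto)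
  have "((\<lambda>x. integral (cbox a b) (\<lambda>z. mollifier e (z - x) * F z)) has_derivative integral (cbox a b) (fx x0)) (at x0)"
    using leib x0 by (simp add: at_within_open[OF x0 open_ball])
  then have 1: "(mollify e ?u has_derivative integral (cbox a b) (fx x0)) (at x0)"
    by (rule has_derivative_transform_within_open[OF _ open_ball x0]) (use hasint in \<open>auto simp: has_integral_iff\<close>)
  have "blinfun_apply (integral (cbox a b) (fx x0)) = (\<lambda>v. mollify e ?g x0 \<bullet> v)"
  proof (rule linear_eq_stdbasis)
    show "linear (blinfun_apply (integral (cbox a b) (fx x0)))"
      by (rule bounded_linear.linear[OF blinfun.bounded_linear_right])
    show "linear (\<lambda>v. mollify e ?g x0 \<bullet> v)"
      by (simp add: linear_iff inner_add_right)
    fix v :: "real^'n" assume "v \<in> Basis"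
    then obtain j where v: "v = axis j 1" by (auto simp: Basis_vec_def)
    define \<phi> where "\<phi> z = c * bump e (z - x0)" for z
    have \<phi>: "test_function (ball 0 R') \<phi>"
      unfolding \<phi>_def
    proof (rule test_function_bump[OF e(1)])
      show "cball x0 e \<subseteq> ball 0 R'"
      proof
        fix z assume "z \<in> cball x0 e"
        then have "norm (z - x0) \<le> e" by (simp add: dist_norm norm_minus_commute)
        moreover have "norm z \<le> norm x0 + norm (z - x0)" by norm
        ultimately show "z \<in> ball 0 R'" using x0 e by simp
      qed
    qed
    have \<phi>': "frechet_derivative \<phi> (at z) v = - (Q x0 z * ((z - x0) \<bullet> v))" for z
    proof -
      have "(\<phi> has_derivative (\<lambda>v. c * ((bump_profile (0 + 2) (e\<^sup>2 - (norm (z - x0))\<^sup>2) - real 0 * bump_profile (0 + 1) (e\<^sup>2 - (norm (z - x0))\<^sup>2))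
        * (- 2 * ((z - x0) \<bullet> v))))) (at z)"
        unfolding \<phi>_def bump_def by (intro has_derivative_mult_right has_derivative_bump)
      from frechet_derivative_at[OF this, symmetric] show ?thesis
        by (simp add: Q_def numeral_2_eq_2)
    qed
    have fxint: "fx x0 integrable_on cbox a b"
    proof (rule integrable_continuous)
      have "continuous_on (cbox a b) (\<lambda>z. (case (x0, z) of (x, z) \<Rightarrow> fx x z))"
        by (rule continuous_on_compose2[OF cfx]) (use x0 in \<open>auto intro!: continuous_on_Pair continuous_on_const continuous_on_id\<close>)
      then show "continuous_on (cbox a b) (fx x0)" by simp
    qed
    have "blinfun_apply (integral (cbox a b) (fx x0)) v = integral (cbox a b) (\<lambda>z. blinfun_apply (fx x0 z) v)"
      using integral_linear[OF fxint blinfun.bounded_linear_left[of v]] by (simp add: comp_def)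
    also have "\<dots> = integral (cbox a b) (\<lambda>z. - (?u z * frechet_derivative \<phi> (at z) v))"
    proof (rule integral_cong)
      fix z
      show "blinfun_apply (fx x0 z) v = - (?u z * frechet_derivative \<phi> (at z) v)"
      proof (cases "z \<in> ball 0 R'")
        case True
        then show ?thesis by (simp add: fx_def \<phi>' F blinfun.scaleR_left)
      next
        case False
        then have "e \<le> norm (z - x0)" using far[OF x0] by blast
        then have "e\<^sup>2 \<le> (norm (z - x0))\<^sup>2" using e by (intro power_mono) auto
        then have "Q x0 z = 0" by (simp add: Q_def bump_profile_def)
        then show ?thesis using False by (simp add: fx_def)
      qed
    qed
    also have "\<dots> = - (\<integral>z. ?u z * frechet_derivative \<phi> (at z) v \<partial>lborel)"
    proof -
      have qc: "continuous_on UNIV (\<lambda>z. frechet_derivative \<phi> (at z) v)"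
        unfolding \<phi>' Q_def by (intro continuous_intros)
      have "integrable lborel (\<lambda>z. ?u z * frechet_derivative \<phi> (at z) v)"
      proof -
        have "compact ((\<lambda>z. frechet_derivative \<phi> (at z) v) ` cball 0 R')"
          by (intro compact_continuous_image continuous_on_subset[OF qc]) auto
        from compact_imp_bounded[OF this] obtain B
          where "\<forall>y\<in>(\<lambda>z. frechet_derivative \<phi> (at z) v) ` cball 0 R'. norm y \<le> B"
          unfolding bounded_iff by (elim exE)
        then have B: "norm (frechet_derivative \<phi> (at z) v) \<le> B" if "z \<in> cball 0 R'" for z
          using that by (rule bspec[OF _ imageI])
        have [measurable]: "(\<lambda>z. frechet_derivative \<phi> (at z) v) \<in> borel_measurable borel"
          using qc by (rule borel_measurable_continuous_onI)
        have [measurable]: "?u \<in> borel_measurable borel" using borel_measurable_integrable[OF u(2)] by simp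
        show ?thesis
        proof (rule Bochner_Integration.integrable_bound)
          show "integrable lborel (\<lambda>z. ?u z * B)" using u(2) by (rule integrable_mult_left)
          show "AE z in lborel. norm (?u z * frechet_derivative \<phi> (at z) v) \<le> norm (?u z * B)"
          proof (rule AE_I2)
            fix z
            show "norm (?u z * frechet_derivative \<phi> (at z) v) \<le> norm (?u z * B)"
            proof (cases "z \<in> ball 0 R'")
              case True
              then have "norm (frechet_derivative \<phi> (at z) v) \<le> \<bar>B\<bar>"
                using B[of z] by auto
              then show ?thesis by (simp add: abs_mult mult_left_mono)
            qed simp
          qed
        qed measurable
      qed
      then have I: "((\<lambda>z. ?u z * frechet_derivative \<phi> (at z) v) has_integral (\<integral>z. ?u z * frechet_derivative \<phi> (at z) v \<partial>lborel)) UNIV"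
        by (rule has_integral_integral_lborel)
      have E: "(\<lambda>z. if z \<in> cbox a b then ?u z * frechet_derivative \<phi> (at z) v else 0) = (\<lambda>z. ?u z * frechet_derivative \<phi> (at z) v)"
      proof (rule ext)
        fix z
        have "z \<in> cbox a b" if "z \<in> ball 0 R'"
          using subsetD[OF ab, of z] that by simp
        then show "(if z \<in> cbox a b then ?u z * frechet_derivative \<phi> (at z) v else 0) = ?u z * frechet_derivative \<phi> (at z) v"
          by (auto simp: indicator_def)
      qed
      have "((\<lambda>z. ?u z * frechet_derivative \<phi> (at z) v) has_integral (\<integral>z. ?u z * frechet_derivative \<phi> (at z) v \<partial>lborel)) (cbox a b)"
        by (rule has_integral_restrict_UNIV[THEN iffD1], subst E) (rule I)
      from integral_unique[OF has_integral_neg[OF this]] show ?thesis .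
    qed
    also have "\<dots> = (\<integral>x. indicator (ball 0 R') x *\<^sub>R (g x $ j * \<phi> x) \<partial>lborel)"
      using weak[OF \<phi>, of j] by (simp add: v mult.assoc)
    also have "\<dots> = (\<integral>z. (mollifier e (z - x0) *\<^sub>R ?g z) \<bullet> v \<partial>lborel)"
      by (intro Bochner_Integration.integral_cong) (auto simp: \<phi>_def mol bump_def v inner_axis)
    also have "\<dots> = mollify e ?g x0 \<bullet> v"
      unfolding mollify_def by (rule integral_inner_left) (rule integrable_mollifier_scaleR[OF g])
    finally show "blinfun_apply (integral (cbox a b) (fx x0)) v = mollify e ?g x0 \<bullet> v" .
  qed
  with 1 show ?thesis by simp
qed

text \<open>A parameter \<open>e k\<close> is chosen small enough for both modes of convergence at
  once. The rate \<open>(1/4) ^ k\<close> leaves exceptional sets of summable measure after a weak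
  type estimate at height \<open>(1/2) ^ k\<close>.\<close>

lemma mollification_sequence:
  fixes f :: "real^'n \<Rightarrow> real^'m" and G :: "real^'n \<Rightarrow> real^'n^'m"
  assumes R: "0 < R" "R < R'"
    and f: "continuous_on (cball 0 R') f"
    and G: "integrable lborel (\<lambda>x. indicator (ball 0 R') x *\<^sub>R G x)"
    and weak: "\<And>\<phi> i j. test_function (ball 0 R') \<phi> \<Longrightarrow>
      (\<integral>x. indicator (ball 0 R') x *\<^sub>R (f x $ i * frechet_derivative \<phi> (at x) (axis j 1)) \<partial>lborel)
        = - (\<integral>x. indicator (ball 0 R') x *\<^sub>R (G x $ i $ j * \<phi> x) \<partial>lborel)"
  obtains F H where
    "\<And>k x. x \<in> ball 0 R \<Longrightarrow> (F k has_derivative (*v) (H k x)) (at x)"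
    "\<And>k::nat. continuous_on (ball 0 R) (H k)"
    "uniform_limit (ball 0 R) F f sequentially"
    "\<And>k. (\<integral>\<^sup>+x. indicator (ball 0 R) x * ennreal (norm (H k x - G x)) \<partial>lborel) \<le> ennreal ((1/4) ^ k)"
proof -
  let ?f = "\<lambda>x. indicator (ball 0 R') x *\<^sub>R f x" and ?G = "\<lambda>x. indicator (ball 0 R') x *\<^sub>R G x"
  have fint: "integrable lborel ?f"
  proof -
    have "integrable lborel (\<lambda>x. indicator (cball 0 R') x *\<^sub>R f x)"
      by (rule borel_integrable_compact) (use f in auto)
    then have "integrable lborel (\<lambda>x. indicator (ball 0 R') x *\<^sub>R (indicator (cball 0 R') x *\<^sub>R f x))"
      by (rule integrable_mult_indicator[rotated]) simp
    moreover have "(\<lambda>x. indicator (ball 0 R') x *\<^sub>R (indicator (cball 0 R') x *\<^sub>R f x)) = ?f"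
      by (auto simp: fun_eq_iff split: split_indicator)
    ultimately show ?thesis by (simp only:)
  qed
  have "\<exists>e. 0 < e \<and> R + e < R' \<and> (\<forall>x\<in>ball 0 R. norm (mollify e ?f x - f x) \<le> (1/2) ^ k)
      \<and> (\<integral>\<^sup>+x. ennreal (norm (mollify e ?G x - ?G x)) \<partial>lborel) \<le> ennreal ((1/4) ^ k)" for k :: nat
  proof -
    have "uniformly_continuous_on (cball 0 R') f"
      using f by (rule compact_uniformly_continuous) auto
    then obtain d where d: "d > 0" "\<And>x z. x \<in> cball 0 R' \<Longrightarrow> z \<in> cball 0 R' \<Longrightarrow> dist z x < d \<Longrightarrow> dist (f z) (f x) < (1/2) ^ k"
      unfolding uniformly_continuous_on_def by (metis half_gt_zero_iff zero_less_one zero_less_power)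
    obtain \<delta> where \<delta>: "\<delta> > 0" "\<And>e. 0 < e \<Longrightarrow> e < \<delta> \<Longrightarrow> (\<integral>\<^sup>+x. ennreal (norm (mollify e ?G x - ?G x)) \<partial>lborel) \<le> ennreal ((1/4) ^ k)"
      using mollify_tendsto_L1[OF G, of "(1/4) ^ k"] by auto
    define m where "m = min (min d \<delta>) (R' - R)"
    have "m > 0" "m \<le> d" "m \<le> \<delta>" "m \<le> R' - R" using R d(1) \<delta>(1) by (auto simp: m_def)
    moreover define e where "e = m / 2"
    ultimately have e: "0 < e" "e < d" "e < \<delta>" "R + e < R'" using R by auto
    have "norm (mollify e ?f x - f x) \<le> (1/2) ^ k" if x: "x \<in> ball 0 R" for x
    proof -
      have "norm (mollify e ?f x - ?f x) \<le> (1/2) ^ k"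
      proof (rule norm_mollify_diff_le_osc[OF fint e(1)])
        fix z assume z: "z \<in> ball x e"
        have "norm (z - x) < e" using z by (simp add: dist_norm norm_minus_commute)
        moreover have "norm z \<le> norm x + norm (z - x)" by norm
        ultimately have "norm z < R'" "dist z x < d" using x e by (auto simp: dist_norm)
        then have "dist (f z) (f x) < (1/2) ^ k" using x R by (intro d) auto
        then show "norm (?f z - ?f x) \<le> (1/2) ^ k" using \<open>norm z < R'\<close> x R by (simp add: dist_norm)
      qed
      then show ?thesis using x R by simp
    qed
    then show ?thesis using e \<delta>(2)[OF e(1) e(3)] by blast
  qed
  then have "\<exists>e. \<forall>k::nat. 0 < e k \<and> R + e k < R' \<and> (\<forall>x\<in>ball 0 R. norm (mollify (e k) ?f x - f x) \<le> (1/2) ^ k)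
      \<and> (\<integral>\<^sup>+x. ennreal (norm (mollify (e k) ?G x - ?G x)) \<partial>lborel) \<le> ennreal ((1/4) ^ k)"
    by (intro choice allI)
  then obtain e where e: "\<And>k::nat. 0 < e k" "\<And>k. R + e k < R'"
    and ef: "\<And>k x. x \<in> ball 0 R \<Longrightarrow> norm (mollify (e k) ?f x - f x) \<le> (1/2) ^ k"
    and eG: "\<And>k. (\<integral>\<^sup>+x. ennreal (norm (mollify (e k) ?G x - ?G x)) \<partial>lborel) \<le> ennreal ((1/4) ^ k)"
    by (elim exE) blast
  have der: "(mollify (e k) ?f has_derivative (*v) (mollify (e k) ?G x)) (at x)" if x: "x \<in> ball 0 R" for k x
  proof -
    have comp: "mollify (e k) ?f y $ i = mollify (e k) (\<lambda>x. indicator (ball 0 R') x *\<^sub>R (f x $ i)) y" for y i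
    proof -
      have "mollify (e k) ?f y $ i = (\<integral>z. (mollifier (e k) (z - y) *\<^sub>R ?f z) $ i \<partial>lborel)"
        unfolding mollify_def
        by (rule integral_bounded_linear[OF bounded_linear_vec_nth, symmetric]) (rule integrable_mollifier_scaleR[OF fint])
      then show ?thesis by (simp add: mollify_def mult.assoc)
    qed
    have compG: "mollify (e k) ?G y $ i = mollify (e k) (\<lambda>x. indicator (ball 0 R') x *\<^sub>R (G x $ i)) y" for y i
    proof -
      have "mollify (e k) ?G y $ i = (\<integral>z. (mollifier (e k) (z - y) *\<^sub>R ?G z) $ i \<partial>lborel)"
        unfolding mollify_def
        by (rule integral_bounded_linear[OF bounded_linear_vec_nth, symmetric]) (rule integrable_mollifier_scaleR[OF G])
      then show ?thesis by (simp add: mollify_def mult.assoc)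
    qed
    have ci: "((\<lambda>y. mollify (e k) ?f y $ i) has_derivative (\<lambda>v. (mollify (e k) ?G x *v v) $ i)) (at x)" for i
      unfolding comp matrix_vector_mul_component compG
    proof (rule mollify_has_derivative[OF e(1) e(2) x])
      show "continuous_on (cball 0 R') (\<lambda>x. f x $ i)" by (intro continuous_intros f)
      show "integrable lborel (\<lambda>x. indicator (ball 0 R') x *\<^sub>R f x $ i)"
        using integrable_bounded_linear[OF bounded_linear_vec_nth[of i] fint] by simp
      show "integrable lborel (\<lambda>x. indicator (ball 0 R') x *\<^sub>R G x $ i)"
        using integrable_bounded_linear[OF bounded_linear_vec_nth[of i] G] by simp
    qed (rule weak)
    show ?thesis
      unfolding has_derivative_componentwise_within[of "mollify (e k) ?f"]
      using ci by (auto simp: Basis_vec_def inner_axis)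
  qed
  show ?thesis
  proof (rule that[of "\<lambda>k. mollify (e k) ?f" "\<lambda>k. mollify (e k) ?G"])
    show "(mollify (e k) ?f has_derivative (*v) (mollify (e k) ?G x)) (at x)" if "x \<in> ball 0 R" for k x
      using that by (rule der)
    show "continuous_on (ball 0 R) (mollify (e k) ?G)" for k
      by (rule continuous_on_mollify[OF G])
    show "uniform_limit (ball 0 R) (\<lambda>k. mollify (e k) ?f) f sequentially"
      unfolding uniform_limit_iff
    proof (intro allI impI)
      fix \<epsilon> :: real assume "\<epsilon> > 0"
      then have "\<forall>\<^sub>F k in sequentially. (1/2) ^ k < \<epsilon>"
        by (intro order_tendstoD(2)[OF LIMSEQ_power_zero]) auto
      then show "\<forall>\<^sub>F k in sequentially. \<forall>x\<in>ball 0 R. dist (mollify (e k) ?f x) (f x) < \<epsilon>"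
        by eventually_elim (auto simp: dist_norm intro: le_less_trans[OF ef])
    qed
    show "(\<integral>\<^sup>+x. indicator (ball 0 R) x * ennreal (norm (mollify (e k) ?G x - G x)) \<partial>lborel) \<le> ennreal ((1/4) ^ k)" for k
    proof -
      have "(\<integral>\<^sup>+x. indicator (ball 0 R) x * ennreal (norm (mollify (e k) ?G x - G x)) \<partial>lborel) \<le> (\<integral>\<^sup>+x. ennreal (norm (mollify (e k) ?G x - ?G x)) \<partial>lborel)"
        using R by (intro nn_integral_mono) (auto split: split_indicator)
      then show ?thesis using eG[of k] by (rule order_trans)
    qed
  qed
qed

subsection \<open>The area inequality\<close>

text \<open>The change of variables theorems of \<open>HOL-Analysis\<close> require a wellordered index type; \<open>wo\<close> equips
  a copy of an arbitrary finite type with a wellorder.\<close>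

typedef 'a wo = "UNIV :: 'a set" by auto

instance wo :: (finite) finite
proof
  have "finite (range (Abs_wo :: 'a \<Rightarrow> 'a wo))"
    by simp
  then show "finite (UNIV :: 'a wo set)"
    by (simp add: type_definition.Abs_image[OF type_definition_wo])
qed

instantiation wo :: (finite) wellorder
begin

definition less_eq_wo :: "'a wo \<Rightarrow> 'a wo \<Rightarrow> bool" where
  "x \<le> y \<longleftrightarrow> to_nat_on UNIV (Rep_wo x) \<le> to_nat_on UNIV (Rep_wo y)"

definition less_wo :: "'a wo \<Rightarrow> 'a wo \<Rightarrow> bool" where
  "x < y \<longleftrightarrow> to_nat_on UNIV (Rep_wo x) < to_nat_on UNIV (Rep_wo y)"

instance
proof
  fix x y z :: "'a wo" and P :: "'a wo \<Rightarrow> bool"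
  have inj: "inj (to_nat_on (UNIV :: 'a set))"
    by (simp add: countable_finite inj_on_to_nat_on)
  show "x < y \<longleftrightarrow> x \<le> y \<and> \<not> y \<le> x" "x \<le> x" "x \<le> y \<Longrightarrow> y \<le> z \<Longrightarrow> x \<le> z" "x \<le> y \<or> y \<le> x"
    by (auto simp: less_eq_wo_def less_wo_def)
  show "x \<le> y \<Longrightarrow> y \<le> x \<Longrightarrow> x = y"
    using inj by (auto simp: less_eq_wo_def Rep_wo_inject dest: injD)
  show "P z" if "\<And>x. (\<And>y. y < x \<Longrightarrow> P y) \<Longrightarrow> P x"
  proof -
    have "wfP (\<lambda>x y :: 'a wo. to_nat_on UNIV (Rep_wo x) < to_nat_on UNIV (Rep_wo y))"
      unfolding wfp_def
      by (rule wf_subset[OF wf_measure[of "\<lambda>x :: 'a wo. to_nat_on UNIV (Rep_wo x)"]]) auto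
    then show ?thesis
      by (rule wfp_induct_rule) (use that in \<open>simp add: less_wo_def\<close>)
  qed
qed

end

section \<open>Invariance of determinants and Lebesgue measure under relabelling of
  coordinates\<close>

lemma bij_Rep_wo: "bij Rep_wo"
  by (metis Abs_wo_inverse Rep_wo_inverse UNIV_I bij_iff)

text \<open>Transporting permutations along \<open>b\<close> is a bijection that preserves signs and
  matches the Leibniz expansions term by term.\<close>

lemma det_reindex:
  fixes A :: "real^'b^'b" and b :: "'a::finite \<Rightarrow> 'b::finite"
  assumes "bij b"
  shows "det (\<chi> i j. A $ b i $ b j :: real^'a^'a) = det A"
proof -
  let ?m = "map_permutation UNIV b"
  have inv: "inv_into UNIV b (b x) = x" for x
    using assms by (simp add: bij_is_inj)
  have bb: "bij_betw ?m {p. p permutes UNIV} {p. p permutes UNIV}"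
  proof -
    have "bij_betw ?m {p. p permutes (UNIV::'a set)} {p. p permutes b ` UNIV}"
      using bij_betw_permutations[of b UNIV "b ` UNIV"] assms
      unfolding map_permutation_def[abs_def] by (simp add: bij_betw_def restrict_id_def comp_def)
    then show ?thesis using assms by (simp add: bij_is_surj)
  qed
  have "det A = (\<Sum>p | p permutes UNIV. of_int (sign p) * (\<Prod>i\<in>UNIV. A $ i $ p i))"
    by (simp add: det_def)
  also have "\<dots> = (\<Sum>p | p permutes UNIV. of_int (sign (?m p)) * (\<Prod>i\<in>UNIV. A $ i $ ?m p i))"
    by (rule sum.reindex_bij_betw[OF bb, symmetric])
  also have "\<dots> = (\<Sum>p | p permutes UNIV. of_int (sign p) * (\<Prod>i\<in>UNIV. A $ b i $ b (p i)))"
  proof (rule sum.cong[OF refl])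
    fix p :: "'a \<Rightarrow> 'a" assume p: "p \<in> {p. p permutes UNIV}"
    have "(\<Prod>i\<in>UNIV. A $ i $ ?m p i) = (\<Prod>i\<in>UNIV. A $ b i $ ?m p (b i))"
      using prod.reindex_bij_betw[OF assms, of "\<lambda>i. A $ i $ ?m p i"] by simp
    moreover have "?m p (b i) = b (p i)" for i
      using inv assms by (simp add: map_permutation_def bij_is_surj)
    moreover have "sign (?m p) = sign p"
      using p assms by (intro sign_map_permutation) (auto simp: bij_is_inj)
    ultimately show "of_int (sign (?m p)) * (\<Prod>i\<in>UNIV. A $ i $ ?m p i) =
        of_int (sign p) * (\<Prod>i\<in>UNIV. A $ b i $ b (p i))" by simp
  qed
  also have "\<dots> = det (\<chi> i j. A $ b i $ b j :: real^'a^'a)"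
    by (simp add: det_def)
  finally show ?thesis by simp
qed

lemma distr_lborel_reindex:
  fixes b :: "'a::finite \<Rightarrow> 'b::finite"
  assumes "bij b"
  shows "distr lborel lborel (\<lambda>x::real^'b. (\<chi> i. x $ b i) :: real^'a) = lborel"
proof (rule lborel_eqI[symmetric])
  let ?h = "\<lambda>x::real^'b. (\<chi> i. x $ b i) :: real^'a"
  let ?g = "\<lambda>x::real^'a. (\<chi> i. x $ inv b i) :: real^'b"
  have bi: "b (inv b i) = i" "inv b (b j) = j" for i j
    using assms by (simp_all add: bij_is_surj bij_is_inj surj_f_inv_f)
  have ch: "continuous_on UNIV ?h"
    by (intro continuous_intros)
  then have [measurable]: "?h \<in> borel_measurable borel"
    by (rule borel_measurable_continuous_onI)
  fix l u :: "real^'a" assume le: "\<And>c. c \<in> Basis \<Longrightarrow> l \<bullet> c \<le> u \<bullet> c"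
  have vim: "?h -` box l u = box (?g l) (?g u)"
  proof (intro set_eqI)
    fix x :: "real^'b"
    have "x \<in> ?h -` box l u \<longleftrightarrow> (\<forall>i. l $ i < x $ b i \<and> x $ b i < u $ i)"
      by (simp add: box_def Basis_vec_def inner_axis all_conj_distrib)
    also have "\<dots> \<longleftrightarrow> (\<forall>j. l $ inv b j < x $ j \<and> x $ j < u $ inv b j)"
      by (metis bi)
    also have "\<dots> \<longleftrightarrow> x \<in> box (?g l) (?g u)"
      by (simp add: box_def Basis_vec_def inner_axis all_conj_distrib)
    finally show "x \<in> ?h -` box l u \<longleftrightarrow> x \<in> box (?g l) (?g u)" .
  qed
  have le': "l $ i \<le> u $ i" for i
    using le[of "axis i 1"] by (simp add: inner_axis)
  have prodB: "(\<Prod>c\<in>Basis. F \<bullet> c) = (\<Prod>i\<in>UNIV. F $ i)" for F :: "real^'c"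
    by (simp add: Basis_vec_def UNION_singleton_eq_range prod.reindex inj_on_def axis_eq_axis inner_axis)
  have "emeasure (distr lborel lborel ?h) (box l u) = emeasure lborel (box (?g l) (?g u))"
    by (simp add: emeasure_distr vim)
  also have "\<dots> = (\<Prod>c\<in>Basis. (?g u - ?g l) \<bullet> c)"
    by (rule emeasure_lborel_box) (auto simp: Basis_vec_def inner_axis le')
  also have "(\<Prod>c\<in>Basis. (?g u - ?g l) \<bullet> c) = (\<Prod>i\<in>UNIV. u $ inv b i - l $ inv b i)"
    by (subst prodB) simp
  also have "\<dots> = (\<Prod>i\<in>UNIV. u $ i - l $ i)"
    using prod.reindex_bij_betw[OF bij_imp_bij_inv[OF assms], of "\<lambda>i. u $ i - l $ i"] by simp
  also have "\<dots> = (\<Prod>c\<in>Basis. (u - l) \<bullet> c)"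
    by (subst prodB) simp
  finally show "emeasure (distr lborel lborel ?h) (box l u) = (\<Prod>c\<in>Basis. (u - l) \<bullet> c)" .
qed simp

text \<open>Boundedness of the image gives it finite measure, as the change of variables for
  injective maps requires.\<close>

lemma emeasure_inj_differentiable_image:
  fixes f :: "(real, 'n::{finite,wellorder}) vec \<Rightarrow> (real, 'n) vec" and G :: "(real, 'n) vec \<Rightarrow> ((real, 'n) vec, 'n) vec"
  assumes S: "S \<in> sets lebesgue" and der: "\<And>x. x \<in> S \<Longrightarrow> (f has_derivative (*v) (G x)) (at x within S)"
    and inj: "inj_on f S" and bdd: "bounded (f ` S)"
  shows "f ` S \<in> sets lebesgue"
    and "(\<integral>\<^sup>+x. indicator S x * ennreal \<bar>det (G x)\<bar> \<partial>lborel) = emeasure lebesgue (f ` S)"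
proof -
  show meas: "f ` S \<in> sets lebesgue"
    by (rule differentiable_image_in_sets_lebesgue[OF S])
       (use der in \<open>auto simp: differentiable_on_def differentiable_def\<close>)
  then have "f ` S \<in> lmeasurable"
    using bdd by (simp add: bounded_set_imp_lmeasurable)
  then have "((\<lambda>x. \<bar>det (matrix ((*v) (G x)))\<bar>) has_integral measure lebesgue (f ` S)) S"
    using has_measure_differentiable_image[OF S der inj] by blast
  then have "((\<lambda>x. \<bar>det (G x)\<bar>) has_integral measure lebesgue (f ` S)) S"
    by (simp add: matrix_of_matrix_vector_mul)
  then have "(\<integral>\<^sup>+x. ennreal (indicator S x * \<bar>det (G x)\<bar>) \<partial>lborel) = ennreal (measure lebesgue (f ` S))"
    by (rule nn_integral_has_integral_lebesgue[rotated]) simp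
  also have "\<dots> = emeasure lebesgue (f ` S)"
    using \<open>f ` S \<in> lmeasurable\<close> by (simp add: emeasure_eq_measure2)
  finally show "(\<integral>\<^sup>+x. indicator S x * ennreal \<bar>det (G x)\<bar> \<partial>lborel) = emeasure lebesgue (f ` S)"
    by (simp add: ennreal_mult' ennreal_indicator)
qed

text \<open>The set is relatively closed in \<open>A\<close>: for fixed \<open>y\<close> the
  condition \<open>dist y x < d\<close> is open in \<open>x\<close>, so it holds along the tail of a
  sequence converging to such a point, and the expansion inequality passes to the limit by
  continuity.\<close>

lemma borel_set_of_local_expansion:
  fixes f :: "'a::metric_space \<Rightarrow> 'b::metric_space"
  assumes A: "A \<in> sets borel" and f: "continuous_on A f" and d: "d > 0"
  shows "{x \<in> A. \<forall>y\<in>A. dist y x < d \<longrightarrow> dist (f y) (f x) \<ge> c * dist y x} \<in> sets borel" (is "?P \<in> _")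
proof -
  have "l \<in> ?P" if l: "l \<in> A" "l \<in> closure ?P" for l
  proof -
    obtain s where s: "\<And>n. s n \<in> ?P" "s \<longlonglongrightarrow> l"
      using l(2) unfolding closure_sequential by blast
    note l = l(1) s(2)
    have fs: "(\<lambda>n. f (s n)) \<longlonglongrightarrow> f l"
      using f l s(1) by (auto simp: continuous_on_sequentially comp_def)
    have "c * dist y l \<le> dist (f y) (f l)" if y: "y \<in> A" "dist y l < d" for y
    proof (rule tendsto_le)
      have t: "(\<lambda>n. dist y (s n)) \<longlonglongrightarrow> dist y l"
        by (intro tendsto_intros l)
      show "(\<lambda>n. c * dist y (s n)) \<longlonglongrightarrow> c * dist y l"
        by (intro tendsto_intros l)
      show "(\<lambda>n. dist (f y) (f (s n))) \<longlonglongrightarrow> dist (f y) (f l)"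
        by (intro tendsto_intros fs)
      show "\<forall>\<^sub>F n in sequentially. c * dist y (s n) \<le> dist (f y) (f (s n))"
        using order_tendstoD(2)[OF t y(2)] by eventually_elim (use s y in auto)
    qed auto
    then show "l \<in> ?P" using l by auto
  qed
  then have "?P = A \<inter> closure ?P"
    using closure_subset[of ?P] by blast
  moreover have "A \<inter> closure ?P \<in> sets borel"
    using A by (intro sets.Int) auto
  ultimately show ?thesis
    by metis
qed

text \<open>The linear part expands by at least \<open>1 / B\<close>; a remainder of at most
  \<open>1 / (2 * B)\<close> times the distance leaves half of it. One index \<open>k\<close> serves
  both as radius and as expansion factor, so that countably many conditions exhaust all points with
  invertible derivative.\<close>

lemma has_derivative_invertible_expands:
  fixes f :: "real^'n \<Rightarrow> real^'n"
  assumes der: "(f has_derivative (*v) M) (at x within A)" and "det M \<noteq> 0"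
  obtains k :: nat where "\<And>y. y \<in> A \<Longrightarrow> dist y x < 1 / real (Suc k) \<Longrightarrow> dist (f y) (f x) \<ge> 1 / real (Suc k) * dist y x"
proof -
  obtain M' where M': "M' ** M = mat 1"
    using assms(2) invertible_det_nz[of M] by (auto simp: invertible_def)
  define B where "B = onorm ((*v) M') + 1"
  have bl: "bounded_linear ((*v) M')"
    by (simp add: matrix_vector_mul_bounded_linear)
  have "B > 0" using onorm_pos_le[OF bl] by (simp add: B_def)
  have M: "norm v \<le> B * norm (M *v v)" for v
  proof -
    have "norm v = norm (M' *v (M *v v))"
      by (simp add: matrix_vector_mul_assoc M')
    also have "\<dots> \<le> onorm ((*v) M') * norm (M *v v)"
      by (rule onorm[OF bl])
    also have "\<dots> \<le> B * norm (M *v v)"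
      by (simp add: B_def distrib_right)
    finally show ?thesis .
  qed
  obtain d where d: "d > 0" "\<And>y. y \<in> A \<Longrightarrow> norm (y - x) < d \<Longrightarrow>
      norm (f y - f x - M *v (y - x)) \<le> 1 / (2 * B) * norm (y - x)"
    using der \<open>B > 0\<close> unfolding has_derivative_within_alt by (metis divide_pos_pos mult_pos_pos zero_less_numeral zero_less_one)
  obtain k where k: "1 / real (Suc k) < min d (1 / (2 * B))"
    using d(1) \<open>B > 0\<close> by (metis divide_pos_pos inverse_eq_divide min_less_iff_conj mult_pos_pos reals_Archimedean zero_less_numeral zero_less_one)
  show ?thesis
  proof (rule that)
    fix y assume y: "y \<in> A" "dist y x < 1 / real (Suc k)"
    have "norm (y - x) / B \<le> norm (M *v (y - x))"
      using M[of "y - x"] \<open>B > 0\<close> by (simp add: field_simps)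
    also have "\<dots> \<le> norm (f y - f x) + norm (f y - f x - M *v (y - x))"
      by norm
    also have "norm (f y - f x - M *v (y - x)) \<le> 1 / (2 * B) * norm (y - x)"
      using d(2) y k by (auto simp: dist_norm)
    finally have "1 / (2 * B) * norm (y - x) \<le> norm (f y - f x)"
      by (simp add: field_simps)
    moreover have "1 / real (Suc k) * norm (y - x) \<le> 1 / (2 * B) * norm (y - x)"
      using k by (intro mult_right_mono) auto
    ultimately show "dist (f y) (f x) \<ge> 1 / real (Suc k) * dist y x"
      by (simp add: dist_norm)
  qed
qed

lemma area_inequality_wo:
  fixes f :: "(real, 'n::{finite,wellorder}) vec \<Rightarrow> (real, 'n) vec" and G :: "(real, 'n) vec \<Rightarrow> ((real, 'n) vec, 'n) vec"
  assumes E: "E \<in> sets borel" and A: "\<And>j::nat. A j \<in> sets borel" "E \<subseteq> (\<Union>j. A j)"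
    and der: "\<And>j x. x \<in> A j \<Longrightarrow> (f has_derivative (*v) (G x)) (at x within A j)"
    and G [measurable]: "(\<lambda>x. det (G x)) \<in> borel_measurable borel"
    and im: "f ` E \<subseteq> ball 0 \<rho>"
    and mult: "\<And>y. emeasure (count_space UNIV) {x \<in> E. f x = y} \<le> N"
  shows "(\<integral>\<^sup>+x. indicator E x * ennreal \<bar>det (G x)\<bar> \<partial>lborel) \<le> N * emeasure lborel (ball (0::(real, 'n) vec) \<rho>)"
proof -
  obtain Q :: "((real, 'n) vec) set" where Q: "countable Q" "\<And>X. open X \<Longrightarrow> X \<noteq> {} \<Longrightarrow> \<exists>d\<in>Q. d \<in> X"
    using countable_dense_setE by blast
  then have "Q \<noteq> {}" by (metis UNIV_not_empty empty_iff open_UNIV)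
  \<comment> \<open>Two points of the small ball about \<open>q\<close> are closer than
    \<open>1 / real (Suc k)\<close>, the range in which the expansion inequality holds, so
    \<open>f\<close> cannot identify them.\<close>
  define P where "P = (\<lambda>(j, k, q). E \<inter> {x \<in> A j. \<forall>y\<in>A j. dist y x < 1 / real (Suc k) \<longrightarrow>
      dist (f y) (f x) \<ge> 1 / real (Suc k) * dist y x} \<inter> ball q (1 / (2 * real (Suc k))))"
  define I where "I = (UNIV :: nat set) \<times> (UNIV :: nat set) \<times> Q"
  have I: "countable I" "I \<noteq> {}"
    using Q \<open>Q \<noteq> {}\<close> by (auto simp: I_def)
  define D where "D = disjointed (\<lambda>m. P (from_nat_into I m))"
  have contA: "continuous_on (A j) f" for j
    using der has_derivative_continuous continuous_on_eq_continuous_within by blast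
  have P: "P i \<in> sets borel" for i
  proof -
    obtain j k q where i: "i = (j, k, q)" by (cases i)
    show ?thesis
      unfolding P_def i prod.case by (intro sets.Int E borel_set_of_local_expansion A contA) auto
  qed
  have D: "D m \<in> sets borel" for m
  proof -
    have "range (\<lambda>m. P (from_nat_into I m)) \<subseteq> sets borel"
      using P by (rule image_subsetI)
    from sets.range_disjointed_sets[OF this] show ?thesis
      unfolding D_def by (rule subsetD) (rule rangeI)
  qed
  have DP: "D m \<subseteq> P (from_nat_into I m)" for m
    unfolding D_def by (rule disjointed_subset)
  have injP: "inj_on f (P i)" for i
  proof (rule inj_onI)
    fix x y assume xy: "x \<in> P i" "y \<in> P i" "f x = f y"
    obtain j k q where i: "i = (j, k, q)" by (cases i)
    have "dist y x < 1 / real (Suc k)"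
    proof -
      have "dist y x \<le> dist q y + dist q x" by (metis dist_commute dist_triangle2)
      also have "\<dots> < 1 / (2 * real (Suc k)) + 1 / (2 * real (Suc k))"
        using xy by (intro add_strict_mono) (auto simp: P_def i)
      finally show ?thesis by (simp add: field_simps)
    qed
    then have "1 / real (Suc k) * dist y x \<le> 0"
      using xy by (auto simp: P_def i)
    then show "x = y" by (simp add: field_simps mult_le_0_iff)
  qed
  have injD: "inj_on f (D m)" for m
    using injP DP inj_on_subset by blast
  have derD: "(f has_derivative (*v) (G x)) (at x within D m)" if "x \<in> D m" for x m
  proof -
    obtain j k q where i: "from_nat_into I m = (j, k, q)" by (cases "from_nat_into I m")
    have "D m \<subseteq> A j" using DP[of m] by (auto simp: i P_def)
    then show ?thesis using der that has_derivative_subset by blast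
  qed
  have DE: "D m \<subseteq> E" for m
    using DP[of m] by (auto simp: P_def split: prod.splits)
  have bdd: "bounded (f ` D m)" for m
    using im DE[of m] by (meson bounded_ball bounded_subset image_mono subset_trans)
  have cover: "x \<in> (\<Union>m. D m)" if x: "x \<in> E" "det (G x) \<noteq> 0" for x
  proof -
    obtain j where j: "x \<in> A j" using x A by blast
    obtain k where k: "\<And>y. y \<in> A j \<Longrightarrow> dist y x < 1 / real (Suc k) \<Longrightarrow> dist (f y) (f x) \<ge> 1 / real (Suc k) * dist y x"
      using has_derivative_invertible_expands[OF der[OF j] x(2)] by blast
    obtain q where q: "q \<in> Q" "q \<in> ball x (1 / (2 * real (Suc k)))"
      using Q(2)[of "ball x (1 / (2 * real (Suc k)))"] by auto
    have "x \<in> P (j, k, q)"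
      using x j k q by (auto simp: P_def dist_commute)
    moreover have "(j, k, q) \<in> I" using q by (simp add: I_def)
    ultimately have "x \<in> (\<Union>m. P (from_nat_into I m))"
      using I by (metis UN_I UNIV_I from_nat_into_surj)
    then show ?thesis by (simp add: D_def UN_disjointed_eq)
  qed
  have "(\<integral>\<^sup>+x. indicator E x * ennreal \<bar>det (G x)\<bar> \<partial>lborel)
      = (\<integral>\<^sup>+x. (\<Sum>m. indicator (D m) x * ennreal \<bar>det (G x)\<bar>) \<partial>lborel)"
  proof (rule nn_integral_cong)
    fix x
    have "(\<Sum>m. indicator (D m) x * ennreal \<bar>det (G x)\<bar>) = (\<Sum>m. indicator (D m) x) * ennreal \<bar>det (G x)\<bar>"
      by simp
    also have "(\<Sum>m. indicator (D m) x :: ennreal) = indicator (\<Union>m. D m) x"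
      by (rule suminf_indicator) (simp add: D_def disjoint_family_disjointed)
    also have "\<dots> * ennreal \<bar>det (G x)\<bar> = indicator E x * ennreal \<bar>det (G x)\<bar>"
      using cover[of x] DE by (cases "det (G x) = 0") (auto split: split_indicator)
    finally show "indicator E x * ennreal \<bar>det (G x)\<bar> = (\<Sum>m. indicator (D m) x * ennreal \<bar>det (G x)\<bar>)" by simp
  qed
  also have "\<dots> = (\<Sum>m. \<integral>\<^sup>+x. indicator (D m) x * ennreal \<bar>det (G x)\<bar> \<partial>lborel)"
    using D by (intro nn_integral_suminf) auto
  also have "\<dots> = (\<Sum>m. \<integral>\<^sup>+y. indicator (f ` D m) y \<partial>lebesgue)"
  proof (rule suminf_cong)
    fix m
    have "D m \<in> sets lebesgue" using D[of m] by simp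
    from emeasure_inj_differentiable_image[OF this derD injD bdd]
    show "(\<integral>\<^sup>+x. indicator (D m) x * ennreal \<bar>det (G x)\<bar> \<partial>lborel) = (\<integral>\<^sup>+y. indicator (f ` D m) y \<partial>lebesgue)"
      by simp
  qed
  also have "\<dots> = (\<integral>\<^sup>+y. (\<Sum>m. indicator (f ` D m) y) \<partial>lebesgue)"
  proof (rule nn_integral_suminf[symmetric])
    fix m
    have "D m \<in> sets lebesgue" using D[of m] by simp
    from emeasure_inj_differentiable_image(1)[OF this derD injD bdd]
    show "indicator (f ` D m) \<in> borel_measurable lebesgue" by simp
  qed
  also have "\<dots> \<le> (\<integral>\<^sup>+y. N * indicator (ball (0::(real, 'n) vec) \<rho>) y \<partial>lebesgue)"
  proof (rule nn_integral_mono)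
    fix y
    let ?M = "{m. y \<in> f ` D m}"
    have "(\<Sum>m. indicator (f ` D m) y :: ennreal) = (\<integral>\<^sup>+m. indicator ?M m \<partial>count_space UNIV)"
      by (subst nn_integral_count_space_nat) (rule suminf_cong, simp add: indicator_def)
    also have "\<dots> = emeasure (count_space UNIV) ?M" by simp
    also have "\<dots> \<le> N * indicator (ball 0 \<rho>) y"
    proof (cases "?M = {}")
      case False
      then obtain m x where "x \<in> D m" "y = f x" by auto
      then have y: "y \<in> ball 0 \<rho>" using im DE[of m] by (meson image_subset_iff subsetD)
      \<comment> \<open>One preimage of \<open>y\<close> is picked from each piece that has one;
        since the pieces are disjoint, the choices are distinct.\<close>
      define g where "g m = (SOME x. x \<in> D m \<and> f x = y)" for m
      have g: "g m \<in> D m \<and> f (g m) = y" if "m \<in> ?M" for m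
        unfolding g_def by (rule someI_ex) (use that in auto)
      have "disjoint_family D" by (simp add: D_def disjoint_family_disjointed)
      then have "inj_on g ?M"
        using g by (intro inj_onI) (metis disjoint_family_onD disjoint_iff UNIV_I)
      then have "emeasure (count_space UNIV) ?M = emeasure (count_space UNIV) (g ` ?M)"
        by (auto simp: emeasure_count_space finite_image_iff card_image)
      also have "\<dots> \<le> emeasure (count_space UNIV) {x \<in> E. f x = y}"
        using g DE by (intro emeasure_mono) auto
      also have "\<dots> \<le> N" by (rule mult)
      finally show ?thesis using y by simp
    qed simp
    finally show "(\<Sum>m. indicator (f ` D m) y) \<le> N * indicator (ball 0 \<rho>) y" .
  qed
  also have "\<dots> = N * emeasure lborel (ball (0::(real, 'n) vec) \<rho>)"
    by (subst nn_integral_cmult_indicator) auto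
  finally show ?thesis .
qed

text \<open>Relabelling the coordinates by \<open>Rep_wo\<close> is a linear isometry that preserves
  Lebesgue measure, determinants and the size of fibres, so the wellordered case carries
  over.\<close>

lemma area_inequality:
  fixes f :: "real^'n \<Rightarrow> real^'n" and G :: "real^'n \<Rightarrow> real^'n^'n"
  assumes E: "E \<in> sets borel" and A: "\<And>j::nat. A j \<in> sets borel" "E \<subseteq> (\<Union>j. A j)"
    and der: "\<And>j x. x \<in> A j \<Longrightarrow> (f has_derivative (*v) (G x)) (at x within A j)"
    and G [measurable]: "(\<lambda>x. det (G x)) \<in> borel_measurable borel"
    and im: "f ` E \<subseteq> ball 0 \<rho>"
    and mult: "\<And>y. emeasure (count_space UNIV) {x \<in> E. f x = y} \<le> N"
  shows "(\<integral>\<^sup>+x. indicator E x * ennreal \<bar>det (G x)\<bar> \<partial>lborel) \<le> N * emeasure lborel (ball (0::real^'n) \<rho>)"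
proof -
  define b where "b = (Rep_wo :: 'n wo \<Rightarrow> 'n)"
  have b: "bij b" by (simp add: b_def bij_Rep_wo)
  have bi [simp]: "b (inv b i) = i" "inv b (b j) = j" for i j
    using b by (simp_all add: bij_is_surj bij_is_inj surj_f_inv_f)
  define h where "h = (\<lambda>x::real^'n. (\<chi> i. x $ b i) :: real^'n wo)"
  define g where "g = (\<lambda>x::real^'n wo. (\<chi> i. x $ inv b i) :: real^'n)"
  have gh [simp]: "g (h x) = x" and hg [simp]: "h (g z) = z" for x z
    by (simp_all add: h_def g_def vec_eq_iff)
  have lin: "linear h" "linear g"
    by (auto simp: h_def g_def linear_iff vec_eq_iff)
  then have bl: "bounded_linear h" "bounded_linear g"
    by (auto intro: linear_conv_bounded_linear[THEN iffD1])
  have [measurable]: "h \<in> borel_measurable borel" "g \<in> borel_measurable borel"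
    using bl by (auto intro!: borel_measurable_continuous_onI linear_continuous_on)
  have nh: "norm (h x) = norm x" for x
    unfolding norm_vec_def L2_set_def h_def
    using sum.reindex_bij_betw[OF b, of "\<lambda>i. (norm (x $ i))\<^sup>2"] by simp
  have dh: "distr lborel lborel h = lborel" and dg: "distr lborel lborel g = lborel"
    unfolding h_def g_def by (intro distr_lborel_reindex b bij_imp_bij_inv)+
  define G' where "G' = (\<lambda>z. \<chi> i j. G (g z) $ b i $ b j)"
  have det: "det (G' z) = det (G (g z))" for z
    unfolding G'_def by (rule det_reindex[OF b])
  have G'v: "h (G (g z) *v g v) = G' z *v v" for z v
  proof -
    have "(\<Sum>j\<in>UNIV. G (g z) $ b i $ j * v $ inv b j) = (\<Sum>j\<in>UNIV. G (g z) $ b i $ b j * v $ j)" for i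
      using sum.reindex_bij_betw[OF b, of "\<lambda>j. G (g z) $ b i $ j * v $ inv b j"] by simp
    then show ?thesis
      by (simp add: vec_eq_iff h_def g_def G'_def matrix_vector_mult_def)
  qed
  have img: "h ` X = g -` X" for X
    by (auto simp: image_iff) (metis hg)
  have vimg: "g -` X \<in> sets borel" if "X \<in> sets borel" for X
    using measurable_sets[of g borel borel X] that by simp
  have "(\<integral>\<^sup>+x. indicator E x * ennreal \<bar>det (G x)\<bar> \<partial>lborel)
      = (\<integral>\<^sup>+x. indicator E x * ennreal \<bar>det (G x)\<bar> \<partial>distr lborel lborel g)"
    by (simp add: dg)
  also have "\<dots> = (\<integral>\<^sup>+z. indicator E (g z) * ennreal \<bar>det (G (g z))\<bar> \<partial>lborel)"
    by (subst nn_integral_distr) (use E in auto)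
  also have "\<dots> = (\<integral>\<^sup>+z. indicator (g -` E) z * ennreal \<bar>det (G' z)\<bar> \<partial>lborel)"
    by (simp add: det indicator_def)
  also have "\<dots> \<le> N * emeasure lborel (ball (0::real^'n wo) \<rho>)"
  proof (rule area_inequality_wo)
    show "g -` E \<in> sets borel" "g -` A j \<in> sets borel" for j
      using E A by (auto intro: vimg)
    show "g -` E \<subseteq> (\<Union>j. g -` A j)" using A(2) by fastforce
    show "((\<lambda>z. h (f (g z))) has_derivative (*v) (G' z)) (at z within g -` A j)" if z: "z \<in> g -` A j" for z j
    proof -
      have gA: "g ` (g -` A j) = A j" by (auto simp: image_iff) (metis gh)
      have 1: "(g has_derivative g) (at z within g -` A j)"
        using bl(2) by (rule bounded_linear_imp_has_derivative)
      have 2: "(f has_derivative (*v) (G (g z))) (at (g z) within g ` (g -` A j))"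
        unfolding gA using z by (intro der) auto
      have "((h \<circ> (f \<circ> g)) has_derivative (h \<circ> ((*v) (G (g z)) \<circ> g))) (at z within g -` A j)"
        using diff_chain_within[OF 1 2] bounded_linear_imp_has_derivative[OF bl(1)]
        by (rule diff_chain_within)
      then show ?thesis
        by (simp add: comp_def G'v)
    qed
    show "(\<lambda>z. det (G' z)) \<in> borel_measurable borel"
      unfolding det by measurable
    show "(\<lambda>z. h (f (g z))) ` (g -` E) \<subseteq> ball 0 \<rho>"
      using im nh by auto
    show "emeasure (count_space UNIV) {z \<in> g -` E. h (f (g z)) = y} \<le> N" for y
    proof -
      have "{z \<in> g -` E. h (f (g z)) = y} = h ` {x \<in> E. f x = g y}"
        by (auto simp: image_iff) (metis gh hg)+
      moreover have "inj h" by (metis gh injI)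
      then have "inj_on h {x \<in> E. f x = g y}" by (rule inj_on_subset) simp
      ultimately show ?thesis
        using mult[of "g y"] by (simp add: emeasure_count_space finite_image_iff card_image split: if_splits)
    qed
  qed
  also have "emeasure lborel (ball (0::real^'n wo) \<rho>) = emeasure lborel (ball (0::real^'n) \<rho>)"
  proof -
    have "emeasure lborel (ball (0::real^'n wo) \<rho>) = emeasure (distr lborel lborel h) (ball (0::real^'n wo) \<rho>)"
      by (simp add: dh)
    also have "\<dots> = emeasure lborel (h -` ball 0 \<rho>)"
      by (subst emeasure_distr) auto
    also have "h -` ball 0 \<rho> = ball 0 \<rho>"
      using nh by auto
    finally show ?thesis .
  qed
  finally show ?thesis .
qed

subsection \<open>Automorphisms of the ball\<close>

text \<open>Multiplying out removes the inversion of \<open>x\<close> and leaves a polynomial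
  bounded below by the square of \<open>1 - norm x * norm y\<close>.\<close>

lemma ball_aut_denominator:
  assumes "x \<noteq> 0"
  shows "(norm x)\<^sup>2 * (norm (y - x /\<^sub>R (norm x)\<^sup>2))\<^sup>2 = 1 - 2 * (x \<bullet> y) + (norm x)\<^sup>2 * (norm y)\<^sup>2"
proof -
  define k where "k = inverse ((norm x)\<^sup>2)"
  have k: "(norm x)\<^sup>2 * k = 1" using assms by (simp add: k_def)
  have "(norm (y - k *\<^sub>R x))\<^sup>2 = (norm y)\<^sup>2 - 2 * k * (x \<bullet> y) + k * (k * (norm x)\<^sup>2)"
    by (simp add: power2_norm_eq_inner inner_diff_left inner_diff_right inner_commute)
  then have "(norm x)\<^sup>2 * (norm (y - k *\<^sub>R x))\<^sup>2
      = (norm x)\<^sup>2 * (norm y)\<^sup>2 - 2 * ((norm x)\<^sup>2 * k) * (x \<bullet> y) + ((norm x)\<^sup>2 * k) * ((norm x)\<^sup>2 * k)"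
    by algebra
  then show ?thesis
    unfolding k by (simp add: k_def)
qed

lemma ball_aut_denominator_pos:
  assumes "x \<noteq> 0" "norm x < 1" "norm y < 1"
  shows "1 - 2 * (x \<bullet> y) + (norm x)\<^sup>2 * (norm y)\<^sup>2 > 0"
proof -
  have "x \<bullet> y \<le> norm x * norm y" by (rule norm_cauchy_schwarz)
  moreover have "norm x * norm y < 1"
    using assms by (metis less_eq_real_def mult_less_cancel_left2 mult_strict_mono' norm_ge_zero mult_1 order_less_le_trans not_less zero_less_norm_iff)
  then have "(1 - norm x * norm y)\<^sup>2 > 0" by simp
  then have "1 - 2 * (norm x * norm y) + (norm x)\<^sup>2 * (norm y)\<^sup>2 > 0"
    by (simp add: power2_eq_square algebra_simps)
  ultimately show ?thesis by linarith
qed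

text \<open>The second identity, the usual conformal one, converts Euclidean distances to the sphere
  into the hyperbolic radius; it rests on \<open>D - (norm (y - x))\<^sup>2 = (1 - (norm x)\<^sup>2)
  * (1 - (norm y)\<^sup>2)\<close>. The third recovers the direction of \<open>y - x\<close> from
  the image and serves for injectivity.\<close>

lemma ball_aut_facts:
  fixes x y :: "real^'n"
  assumes x: "x \<noteq> 0" "norm x < 1" and y: "norm y < 1"
  defines "D \<equiv> 1 - 2 * (x \<bullet> y) + (norm x)\<^sup>2 * (norm y)\<^sup>2"
  shows "(norm (ball_aut x y))\<^sup>2 = (norm (y - x))\<^sup>2 / D"
    and "1 - (norm (ball_aut x y))\<^sup>2 = (1 - (norm x)\<^sup>2) * (1 - (norm y)\<^sup>2) / D"
    and "ball_aut x y + (norm (ball_aut x y))\<^sup>2 *\<^sub>R x = ((1 - (norm x)\<^sup>2) / D) *\<^sub>R (y - x)"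
proof -
  have D: "D > 0" unfolding D_def by (rule ball_aut_denominator_pos[OF x y])
  define X Y p q where "X = (norm x)\<^sup>2" and "Y = (norm y)\<^sup>2" and "p = x \<bullet> y" and "q = (norm (y - x))\<^sup>2"
  have q: "q = Y - 2 * p + X"
    by (simp add: q_def X_def Y_def p_def power2_norm_eq_inner inner_diff_left inner_diff_right inner_commute)
  have wx: "(y - x) \<bullet> x = p - X"
    by (simp add: X_def p_def power2_norm_eq_inner inner_diff_left inner_diff_right inner_commute)
  have T: "ball_aut x y = (1 / D) *\<^sub>R ((1 - X) *\<^sub>R (y - x) - q *\<^sub>R x)"
    using x(1) by (simp add: ball_aut_def ball_aut_denominator D_def X_def q_def divide_inverse)
  have "(norm ((1 - X) *\<^sub>R (y - x) - q *\<^sub>R x))\<^sup>2 = (1 - X)\<^sup>2 * q - 2 * (1 - X) * q * ((y - x) \<bullet> x) + q\<^sup>2 * X"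
    unfolding power2_norm_eq_inner q_def X_def
    by (simp only: inner_diff_left inner_diff_right inner_scaleR_left inner_scaleR_right inner_commute)
       (simp add: power2_eq_square algebra_simps inner_commute)
  also have "\<dots> = q * D"
    unfolding wx q D_def X_def[symmetric] Y_def[symmetric] p_def[symmetric]
    by (simp add: power2_eq_square algebra_simps)
  finally have N: "(norm (ball_aut x y))\<^sup>2 = q * D / D\<^sup>2"
    unfolding T by (simp add: power_mult_distrib power_divide)
  also have "\<dots> = q / D" using D by (simp add: power2_eq_square)
  finally have N: "(norm (ball_aut x y))\<^sup>2 = q / D" .
  then show "(norm (ball_aut x y))\<^sup>2 = (norm (y - x))\<^sup>2 / D" by (simp add: q_def)
  show "1 - (norm (ball_aut x y))\<^sup>2 = (1 - (norm x)\<^sup>2) * (1 - (norm y)\<^sup>2) / D"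
  proof -
    have "D - q = (1 - X) * (1 - Y)"
      unfolding q D_def X_def[symmetric] Y_def[symmetric] p_def[symmetric] by (simp add: algebra_simps)
    then show ?thesis
      unfolding N X_def[symmetric] Y_def[symmetric] using D by (simp add: field_simps)
  qed
  show "ball_aut x y + (norm (ball_aut x y))\<^sup>2 *\<^sub>R x = ((1 - (norm x)\<^sup>2) / D) *\<^sub>R (y - x)"
    unfolding N unfolding T X_def[symmetric] by (simp add: scaleR_diff_right)
qed

lemma norm_ball_aut_less_1:
  assumes "x \<noteq> 0" "norm x < 1" "norm y < 1"
  shows "norm (ball_aut x y) < 1"
proof -
  have "(1 - (norm x)\<^sup>2) * (1 - (norm y)\<^sup>2) / (1 - 2 * (x \<bullet> y) + (norm x)\<^sup>2 * (norm y)\<^sup>2) > 0"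
    using ball_aut_denominator_pos[OF assms] assms by (intro divide_pos_pos mult_pos_pos) (auto simp: power_less_one_iff)
  then have "(norm (ball_aut x y))\<^sup>2 < 1"
    using ball_aut_facts(2)[OF assms] by linarith
  then show ?thesis by (simp add: power_less_one_iff)
qed

lemma ball_aut_self: "x \<noteq> 0 \<Longrightarrow> ball_aut x x = 0"
  by (simp add: ball_aut_def)

text \<open>Equal images give, by the third identity of \<open>ball_aut_facts\<close>, equality of
  \<open>y - x\<close> and \<open>z - x\<close> up to the factors \<open>1 / D\<close>. Taking
  squared norms and inserting the first identity forces \<open>D y = D z\<close> unless the image is
  0, and then \<open>y = z\<close>. Injectivity is what makes \<open>ball_aut_inv\<close>, an
  \<open>inv_into\<close>, a left inverse.\<close>

lemma inj_on_ball_aut: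
  assumes x: "x \<noteq> 0" "norm x < 1"
  shows "inj_on (ball_aut x) (ball 0 1)"
proof (rule inj_onI)
  fix y z assume yz: "y \<in> ball 0 1" "z \<in> ball 0 1" and eq: "ball_aut x y = ball_aut x z"
  define D where "D = (\<lambda>y. 1 - 2 * (x \<bullet> y) + (norm x)\<^sup>2 * (norm y)\<^sup>2)"
  have D: "D y > 0" "D z > 0"
    unfolding D_def using yz by (auto intro: ball_aut_denominator_pos[OF x])
  have a: "1 - (norm x)\<^sup>2 > 0" using x by (simp add: power_less_one_iff)
  have n: "(norm (ball_aut x y))\<^sup>2 = (norm (y - x))\<^sup>2 / D y" "(norm (ball_aut x z))\<^sup>2 = (norm (z - x))\<^sup>2 / D z"
    unfolding D_def using yz by (auto intro: ball_aut_facts(1)[OF x])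
  have v: "((1 - (norm x)\<^sup>2) / D y) *\<^sub>R (y - x) = ((1 - (norm x)\<^sup>2) / D z) *\<^sub>R (z - x)"
    unfolding D_def using yz ball_aut_facts(3)[OF x, of y] ball_aut_facts(3)[OF x, of z] eq by simp
  show "y = z"
  proof (cases "y = x")
    case True
    then have "(norm (z - x))\<^sup>2 / D z = 0" using n eq by simp
    then show ?thesis using True D by simp
  next
    case False
    have "((1 - (norm x)\<^sup>2) / D y)\<^sup>2 * (norm (y - x))\<^sup>2 = ((1 - (norm x)\<^sup>2) / D z)\<^sup>2 * (norm (z - x))\<^sup>2"
    proof -
      have "(norm (((1 - (norm x)\<^sup>2) / D y) *\<^sub>R (y - x)))\<^sup>2 = (norm (((1 - (norm x)\<^sup>2) / D z) *\<^sub>R (z - x)))\<^sup>2"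
        unfolding v ..
      then show ?thesis
        unfolding norm_scaleR power_mult_distrib power2_abs .
    qed
    moreover have "(norm (y - x))\<^sup>2 = D y * (norm (ball_aut x y))\<^sup>2" "(norm (z - x))\<^sup>2 = D z * (norm (ball_aut x y))\<^sup>2"
    proof -
      have "D y * (norm (ball_aut x y))\<^sup>2 = (norm (y - x))\<^sup>2"
        unfolding n(1) using D by simp
      moreover have "D z * (norm (ball_aut x y))\<^sup>2 = (norm (z - x))\<^sup>2"
        unfolding eq n(2) using D by simp
      ultimately show "(norm (y - x))\<^sup>2 = D y * (norm (ball_aut x y))\<^sup>2"
        "(norm (z - x))\<^sup>2 = D z * (norm (ball_aut x y))\<^sup>2" by simp_all
    qed
    moreover have "(norm (ball_aut x y))\<^sup>2 \<noteq> 0" using n False D by simp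
    ultimately have "((1 - (norm x)\<^sup>2))\<^sup>2 / D y = ((1 - (norm x)\<^sup>2))\<^sup>2 / D z"
      using D by (simp add: power_divide power2_eq_square[of "D _"])
    then have "D y = D z" using D a by (simp add: field_simps)
    then show ?thesis using v a D by simp
  qed
qed

text \<open>The point \<open>t = ball_aut x y\<close> satisfies \<open>ball_aut_inv x t = y\<close>
  and \<open>ball_aut_inv x 0 = x\<close>, so (Min) at \<open>t\<close> compares \<open>f y\<close>
  with \<open>f x\<close>. Taking logarithms makes both inequalities one bound on the absolute
  difference.\<close>

lemma miniowitz_bounds:
  fixes f :: "real^'n \<Rightarrow> real^'n"
  assumes f: "miniowitz_class C m K f" and x: "x \<noteq> 0" "norm x < 1" and y: "norm y < 1"
  defines "q \<equiv> (1 - norm (ball_aut x y)) / (1 + norm (ball_aut x y))"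
  shows "f x \<noteq> 0" "f y \<noteq> 0" "C CARD('n) K > 0" "m CARD('n) K > 0"
    "\<bar>ln (norm (f y)) - ln (norm (f x))\<bar> \<le> ln (C CARD('n) K) - m CARD('n) K * ln q"
proof -
  define c where "c = C CARD('n) K"
  define \<mu> where "\<mu> = m CARD('n) K"
  define t where "t = ball_aut x y"
  have t: "norm t < 1" unfolding t_def by (rule norm_ball_aut_less_1[OF x y])
  have inv: "ball_aut_inv x t = y" "ball_aut_inv x 0 = x"
    unfolding ball_aut_inv_def t_def using inv_into_f_f[OF inj_on_ball_aut[OF x], of y]
      inv_into_f_f[OF inj_on_ball_aut[OF x], of x] x y by (auto simp: ball_aut_self)
  show *: "f x \<noteq> 0" "f y \<noteq> 0" "C CARD('n) K > 0" "m CARD('n) K > 0"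
    using f x y by (auto simp: miniowitz_class_def Let_def)
  have **: "1 / c * ((1 - norm t) / (1 + norm t)) powr \<mu> \<le> norm (f y) / norm (f x)"
    "norm (f y) / norm (f x) \<le> c * ((1 + norm t) / (1 - norm t)) powr \<mu>"
  proof -
    have "x \<in> ball 0 1" "t \<in> ball 0 1" using x t by auto
    then have "1 / c * ((1 - norm t) / (1 + norm t)) powr \<mu> \<le> norm ((f \<circ> ball_aut_inv x) t) / norm ((f \<circ> ball_aut_inv x) 0) \<and>
      norm ((f \<circ> ball_aut_inv x) t) / norm ((f \<circ> ball_aut_inv x) 0) \<le> c * ((1 + norm t) / (1 - norm t)) powr \<mu>"
      using f unfolding miniowitz_class_def Let_def c_def \<mu>_def by blast
    then show "1 / c * ((1 - norm t) / (1 + norm t)) powr \<mu> \<le> norm (f y) / norm (f x)"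
      "norm (f y) / norm (f x) \<le> c * ((1 + norm t) / (1 - norm t)) powr \<mu>"
      by (simp_all add: inv)
  qed
  have q: "q > 0" "(1 + norm t) / (1 - norm t) = 1 / q"
    using t by (auto simp: q_def t_def intro!: divide_pos_pos add_pos_nonneg)
  have pos: "norm (f y) / norm (f x) > 0" using * by simp
  have c: "c > 0" using * by (simp add: c_def)
  have qt: "(1 - norm t) / (1 + norm t) = q" by (simp add: q_def t_def)
  have "ln (1 / c * q powr \<mu>) \<le> ln (norm (f y) / norm (f x))"
    using **(1) unfolding qt by (intro ln_mono mult_pos_pos) (use c q pos in auto)
  moreover have "ln (norm (f y) / norm (f x)) \<le> ln (c * (1 / q) powr \<mu>)"
    using **(2) unfolding q(2) by (intro ln_mono pos)
  ultimately show "\<bar>ln (norm (f y)) - ln (norm (f x))\<bar> \<le> ln (C CARD('n) K) - m CARD('n) K * ln q"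
    using * c q by (simp add: ln_mult ln_div ln_powr c_def \<mu>_def)
qed

text \<open>Here \<open>x\<close> is the top of the box and \<open>y\<close> a point below the cap.
  The distance from \<open>y\<close> to the inverse point of \<open>x\<close> is at most
  \<open>r + 4 * r + 2 * r\<close>, so the denominator \<open>D\<close> is at most
  \<open>49 * r\<^sup>2\<close>, while the numerator in the second identity of
  \<open>ball_aut_facts\<close> is at least \<open>r * (1 - s)\<close>. Passing from
  \<open>1 - T\<^sup>2\<close> to \<open>1 - T\<close> for \<open>T\<close> the norm of the image
  doubles 49 to 98.\<close>

lemma one_minus_norm_ball_aut_ge:
  fixes w0 w :: "real^'n"
  assumes w: "norm w0 = 1" "norm w = 1" and r: "0 < r" "r \<le> 1/2" and s: "1 - r \<le> s" "s < 1"
    and ww: "norm (w - w0) \<le> 4 * r"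
  shows "1 - norm (ball_aut ((1 - r) *\<^sub>R w0) (s *\<^sub>R w)) \<ge> (1 - s) / (98 * r)"
proof -
  define x y where "x = (1 - r) *\<^sub>R w0" and "y = s *\<^sub>R w"
  have nx: "norm x = 1 - r" "norm y = s" using w r s by (auto simp: x_def y_def)
  then have x: "x \<noteq> 0" "norm x < 1" "norm y < 1" using r s by auto
  define D where "D = 1 - 2 * (x \<bullet> y) + (norm x)\<^sup>2 * (norm y)\<^sup>2"
  have D: "D > 0" unfolding D_def by (rule ball_aut_denominator_pos[OF x])
  have "x /\<^sub>R (norm x)\<^sup>2 = (1 / (1 - r)) *\<^sub>R w0"
  proof -
    have "inverse (k\<^sup>2) * k = 1 / k" for k :: real
      by (cases "k = 0") (simp_all add: power2_eq_square field_simps)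
    then have "inverse ((1 - r)\<^sup>2) * (1 - r) = 1 / (1 - r)" .
    then show ?thesis unfolding nx(1) unfolding x_def by simp
  qed
  then have "y - x /\<^sub>R (norm x)\<^sup>2 = (s - 1) *\<^sub>R w + (w - w0) + (1 - 1 / (1 - r)) *\<^sub>R w0"
    by (simp add: y_def algebra_simps)
  also have "norm \<dots> \<le> \<bar>s - 1\<bar> + norm (w - w0) + \<bar>1 - 1 / (1 - r)\<bar>"
    by (rule norm_triangle_le, rule add_mono, rule norm_triangle_le) (use w in auto)
  also have "\<bar>1 - 1 / (1 - r)\<bar> \<le> 2 * r"
  proof -
    have "1 / (1 - r) \<le> 1 + 2 * r"
    proof -
      have "0 \<le> r * (1 - 2 * r)" using r by simp
      then show ?thesis using r by (simp add: field_simps)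
    qed
    moreover have "1 / (1 - r) \<ge> 1" using r by simp
    ultimately show ?thesis by simp
  qed
  finally have n7: "norm (y - x /\<^sub>R (norm x)\<^sup>2) \<le> 7 * r" using s ww by linarith
  have "D = (norm x)\<^sup>2 * (norm (y - x /\<^sub>R (norm x)\<^sup>2))\<^sup>2"
    unfolding D_def ball_aut_denominator[OF x(1)] by simp
  also have "\<dots> \<le> 1 * (7 * r)\<^sup>2"
    using n7 x by (intro mult_mono power_mono) (auto simp: power_le_one)
  finally have D49: "D \<le> 49 * r\<^sup>2" by (simp add: power_mult_distrib)
  have "(1 - s) / (49 * r) = r * (1 - s) / (49 * r\<^sup>2)"
    using r by (simp add: power2_eq_square)
  also have "\<dots> \<le> (1 - (norm x)\<^sup>2) * (1 - (norm y)\<^sup>2) / D"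
  proof (rule frac_le)
    have "r \<le> 1 - (norm x)\<^sup>2"
      using mult_left_mono[of r 1 r] r unfolding nx by (simp add: power2_eq_square algebra_simps)
    moreover have "1 - s \<le> 1 - (norm y)\<^sup>2"
      using mult_left_mono[of s 1 s] s r unfolding nx by (simp add: power2_eq_square)
    ultimately show "r * (1 - s) \<le> (1 - (norm x)\<^sup>2) * (1 - (norm y)\<^sup>2)"
      using r s by (intro mult_mono) auto
    then show "0 \<le> (1 - (norm x)\<^sup>2) * (1 - (norm y)\<^sup>2)"
      using r s by (smt (verit) mult_nonneg_nonneg)
  qed (use D D49 in auto)
  also have "\<dots> = 1 - (norm (ball_aut x y))\<^sup>2"
    unfolding D_def by (rule ball_aut_facts(2)[OF x, symmetric])
  also have "\<dots> = (1 - norm (ball_aut x y)) * (1 + norm (ball_aut x y))"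
    by (simp add: power2_eq_square algebra_simps)
  also have "\<dots> \<le> (1 - norm (ball_aut x y)) * 2"
    using norm_ball_aut_less_1[OF x] by (intro mult_left_mono) auto
  finally show ?thesis unfolding x_def y_def by (simp add: field_simps)
qed

subsection \<open>The logarithmic energy\<close>

lemma borel_measurable_vec_nth' [measurable]:
  fixes f :: "'a \<Rightarrow> 'b::real_normed_vector ^ 'n"
  assumes "f \<in> borel_measurable M"
  shows "(\<lambda>x. f x $ i) \<in> borel_measurable M"
proof -
  have "(\<lambda>y::'b^'n. y $ i) \<in> borel_measurable borel"
    by (intro borel_measurable_continuous_onI continuous_intros)
  from measurable_compose[OF assms this] show ?thesis .
qed

lemma borel_measurable_det [measurable]:
  fixes G :: "'a \<Rightarrow> real^'n^'n"
  assumes [measurable]: "G \<in> borel_measurable M"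
  shows "(\<lambda>x. det (G x)) \<in> borel_measurable M"
  unfolding det_def by measurable

lemma norm_matrix_le_onorm:
  fixes A :: "real^'n^'n"
  shows "norm A \<le> real (CARD('n) ^ 2) * onorm ((*v) A)"
proof -
  have "norm A \<le> (\<Sum>i\<in>UNIV. norm (A $ i))"
    unfolding norm_vec_def[of A] by (rule L2_set_le_sum) simp
  also have "\<dots> \<le> (\<Sum>i\<in>(UNIV::'n set). \<Sum>j\<in>(UNIV::'n set). \<bar>A $ i $ j\<bar>)"
    by (intro sum_mono norm_le_l1_cart)
  also have "\<dots> \<le> (\<Sum>i\<in>(UNIV::'n set). \<Sum>j\<in>(UNIV::'n set). onorm ((*v) A))"
    by (intro sum_mono matrix_component_le_onorm)
  finally show ?thesis by (simp add: power2_eq_square)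
qed

section \<open>A Borel representative of the weak derivative\<close>

lemma frechet_derivative_eq_0_outside_support:
  assumes "x \<notin> closure {z. \<phi> z \<noteq> (0::real)}"
  shows "frechet_derivative \<phi> (at x) = (\<lambda>v. 0)"
proof -
  have "((\<lambda>z. 0::real) has_derivative (\<lambda>v. 0)) (at x)" by simp
  then have "(\<phi> has_derivative (\<lambda>v. 0)) (at x)"
    by (rule has_derivative_transform_within_open[where s="- closure {z. \<phi> z \<noteq> 0}"])
       (use assms closure_subset[of "{z. \<phi> z \<noteq> 0}"] in auto)
  from frechet_derivative_at[OF this, symmetric] show ?thesis .
qed

text \<open>The analytic content of quasiregularity on the unit ball in a convenient form: the
  representative \<open>G\<close> is Borel, the distortion inequality holds at every point, and
  integrability and the weak derivative identity are stated for \<open>lborel\<close> on smaller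
  balls.\<close>

locale distortion_map =
  fixes f :: "real^'n \<Rightarrow> real^'n" and G :: "real^'n \<Rightarrow> real^'n^'n" and K :: real
  assumes K: "K \<ge> 1"
    and cont: "continuous_on (ball 0 1) f"
    and G [measurable]: "G \<in> borel_measurable borel"
    and distortion: "onorm ((*v) (G x)) ^ CARD('n) \<le> K * det (G x)"
    and integrable_G: "R < 1 \<Longrightarrow> integrable lborel (\<lambda>x. indicator (ball 0 R) x *\<^sub>R G x)"
    and weak: "R < 1 \<Longrightarrow> test_function (ball 0 R) \<phi> \<Longrightarrow>
      (\<integral>x. indicator (ball 0 R) x *\<^sub>R (f x $ i * frechet_derivative \<phi> (at x) (axis j 1)) \<partial>lborel)
        = - (\<integral>x. indicator (ball 0 R) x *\<^sub>R (G x $ i $ j * \<phi> x) \<partial>lborel)"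

text \<open>The given \<open>Df\<close> is Lebesgue measurable and satisfies the distortion
  inequality almost everywhere. Each entry is replaced by a Borel version, and the matrix is set to
  zero on a Borel null set that contains all failures; the zero matrix satisfies the inequality
  trivially. Local integrability comes from that of the \<open>n\<close>-th power, since
  \<open>t \<le> t^n + 1\<close> for \<open>t \<ge> 0\<close>.\<close>

lemma quasiregular_on_distortion_map:
  fixes f :: "real^'n \<Rightarrow> real^'n"
  assumes n: "CARD('n) \<ge> 2" and f: "quasiregular_on K (ball 0 1) f"
  obtains G where "distortion_map f G K"
proof -
  let ?n = "CARD('n)" and ?B = "ball (0::real^'n) 1"
  have K: "K \<ge> 1" and cont: "continuous_on ?B f" using f by (auto simp: quasiregular_on_def)
  obtain Df where Df: "weak_Jacobian_W1p_loc (real ?n) ?B f Df"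
    and dist: "AE x in lebesgue_on ?B. onorm ((*v) (Df x)) ^ ?n \<le> K * det (Df x)"
    using f by (auto simp: quasiregular_on_def)
  have Bl: "?B \<in> sets lebesgue" by simp
  have "Df \<in> borel_measurable (lebesgue_on ?B)" using Df by (simp add: weak_Jacobian_W1p_loc_def Lp_loc_def)
  then have Dfm: "(\<lambda>x. if x \<in> ?B then Df x else 0) \<in> borel_measurable lebesgue"
    by (rule borel_measurable_if_I[OF _ Bl])
  have "\<exists>g\<in>borel_measurable lborel. AE x in lborel. (if x \<in> ?B then Df x else 0) $ i $ j = g x" for i j
    by (rule completion_ex_borel_measurable_real) (intro borel_measurable_vec_nth' Dfm)
  then have "\<forall>i j. \<exists>g. g \<in> borel_measurable lborel \<and> (AE x in lborel. (if x \<in> ?B then Df x else 0) $ i $ j = g x)"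
    by blast
  then have "\<exists>g. \<forall>i j. g i j \<in> borel_measurable lborel \<and> (AE x in lborel. (if x \<in> ?B then Df x else 0) $ i $ j = g i j x)"
    by (simp add: choice_iff)
  then obtain g where g: "\<And>i j. g i j \<in> borel_measurable lborel"
      "\<And>i j. AE x in lborel. (if x \<in> ?B then Df x else 0) $ i $ j = g i j x"
    by blast
  have "AE x in lebesgue. x \<in> ?B \<longrightarrow> onorm ((*v) (Df x)) ^ ?n \<le> K * det (Df x)"
    using dist by (simp add: AE_restrict_space_iff)
  then have "AE x in lborel. x \<in> ?B \<longrightarrow> onorm ((*v) (Df x)) ^ ?n \<le> K * det (Df x)"
    by (simp add: AE_completion_iff)
  moreover have "AE x in lborel. \<forall>i j. (if x \<in> ?B then Df x else 0) $ i $ j = g i j x"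
    using g(2) by (simp add: AE_all_countable)
  ultimately have "AE x in lborel. (x \<in> ?B \<longrightarrow> onorm ((*v) (Df x)) ^ ?n \<le> K * det (Df x))
      \<and> (\<forall>i j. (if x \<in> ?B then Df x else 0) $ i $ j = g i j x)"
    by eventually_elim blast
  then obtain N where N: "N \<in> null_sets lborel"
    "{x \<in> space lborel. \<not> ((x \<in> ?B \<longrightarrow> onorm ((*v) (Df x)) ^ ?n \<le> K * det (Df x))
      \<and> (\<forall>i j. (if x \<in> ?B then Df x else 0) $ i $ j = g i j x))} \<subseteq> N"
    unfolding eventually_ae_filter by blast
  define G where "G x = (if x \<in> ?B - N then (\<chi> i j. g i j x) else 0)" for x
  have GDf: "G x = Df x" "onorm ((*v) (Df x)) ^ ?n \<le> K * det (Df x)" if "x \<in> ?B - N" for x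
    using that N(2) by (auto simp: G_def vec_eq_iff)
  have Nb [measurable]: "N \<in> sets borel" using N by auto
  have [measurable]: "?B \<in> sets borel" by simp
  have gm [measurable]: "g i j \<in> borel_measurable borel" for i j using g(1)[of i j] by simp
  have Gm: "G \<in> borel_measurable borel"
  proof -
    have "(\<lambda>x. \<chi> i j. g i j x) \<in> borel_measurable borel"
      by (rule borel_measurable_euclidean_space[THEN iffD2])
         (auto simp: Basis_vec_def inner_axis)
    then show ?thesis unfolding G_def by measurable
  qed
  have aeN: "AE x in lborel. x \<notin> N" using N(1) by (rule AE_not_in)
  show ?thesis
  proof (rule that, unfold_locales)
    show "K \<ge> 1" "continuous_on ?B f" "G \<in> borel_measurable borel" by fact+
    show "onorm ((*v) (G x)) ^ ?n \<le> K * det (G x)" for x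
    proof (cases "x \<in> ?B - N")
      case True
      then show ?thesis using GDf by simp
    next
      case False
      then have "G x = 0" unfolding G_def by (rule if_not_P)
      moreover have "onorm ((*v) (0 :: real^'n^'n)) = 0"
      proof -
        have "((*v) (0 :: real^'n^'n)) = (\<lambda>v. 0)" by (simp add: fun_eq_iff)
        then show ?thesis by (simp only: onorm_zero)
      qed
      moreover have "det (0 :: real^'n^'n) = 0" using det_0 by simp
      ultimately show ?thesis using n by (simp add: power_0_left)
    qed
    note Gm [measurable]
    fix R :: real assume R: "R < 1"
    have [measurable]: "ball (0::real^'n) R \<in> sets borel" by simp
    show "integrable lborel (\<lambda>x. indicator (ball 0 R) x *\<^sub>R G x)"
    proof -
      have "compact (cball (0::real^'n) R)" "cball 0 R \<subseteq> ?B" using R by auto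
      then have "set_integrable lebesgue (cball 0 R) (\<lambda>x. norm (Df x) powr real ?n)"
        using Df unfolding weak_Jacobian_W1p_loc_def Lp_loc_def by blast
      then have i1: "integrable lebesgue (\<lambda>x. indicator (cball 0 R) x *\<^sub>R (norm (Df x) powr real ?n))"
        by (simp add: set_integrable_def)
      have i2: "integrable lebesgue (\<lambda>x. indicator (cball (0::real^'n) R) x :: real)"
        using emeasure_lborel_cball_finite[of "0::real^'n" R] by (intro integrable_real_indicator) auto
      have "integrable lebesgue (\<lambda>x. indicator (ball 0 R) x *\<^sub>R G x)"
      proof (rule Bochner_Integration.integrable_bound[OF Bochner_Integration.integrable_add[OF i1 i2]])
        show "(\<lambda>x. indicator (ball 0 R) x *\<^sub>R G x) \<in> borel_measurable lebesgue"
          by (intro measurable_completion) measurable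
        have "AE x in lebesgue. x \<notin> N" using aeN by (rule AE_completion)
        then show "AE x in lebesgue. norm (indicator (ball 0 R) x *\<^sub>R G x)
          \<le> norm (indicator (cball 0 R) x *\<^sub>R (norm (Df x) powr real ?n) + indicator (cball 0 R) x)"
        proof eventually_elim
          case (elim x)
          show ?case
          proof (cases "x \<in> ball 0 R")
            case True
            then have "G x = Df x" using elim R by (intro GDf) auto
            moreover have "norm (Df x) \<le> norm (Df x) ^ ?n + 1"
            proof (cases "norm (Df x) \<le> 1")
              case True
              moreover have "0 \<le> norm (Df x) ^ ?n" by simp
              ultimately show ?thesis by linarith
            next
              case False
              then have "norm (Df x) ^ 1 \<le> norm (Df x) ^ ?n" using n by (intro power_increasing) auto
              then show ?thesis by simp
            qed
            moreover have "norm (Df x) powr real ?n = norm (Df x) ^ ?n"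
              by (rule powr_realpow') (use n in auto)
            ultimately show ?thesis using True by simp
          qed simp
        qed
      qed
      then show ?thesis
        by (subst (asm) integrable_completion) measurable
    qed
    fix \<phi> :: "real^'n \<Rightarrow> real" and i j :: 'n assume \<phi>: "test_function (ball 0 R) \<phi>"
    have sub: "closure {x. \<phi> x \<noteq> 0} \<subseteq> ball 0 R" using \<phi> by (simp add: test_function_def)
    have "ball (0::real^'n) R \<subseteq> ?B" using R by auto
    have \<phi>1: "test_function ?B \<phi>" using \<phi> \<open>ball 0 R \<subseteq> ?B\<close> by (auto simp: test_function_def)
    have \<phi>0: "\<phi> x = 0" "frechet_derivative \<phi> (at x) = (\<lambda>v. 0)" if "x \<notin> ball 0 R" for x
      using that sub closure_subset[of "{x. \<phi> x \<noteq> 0}"] by (auto intro!: frechet_derivative_eq_0_outside_support)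
    have c\<phi>: "continuous_on UNIV \<phi>" "continuous_on UNIV (\<lambda>x. frechet_derivative \<phi> (at x) (axis j 1))"
    proof -
      have "continuously_differentiable 0 \<phi>" "continuously_differentiable (Suc 0) \<phi>"
        using \<phi> by (auto simp: test_function_def)
      then show "continuous_on UNIV \<phi>" "continuous_on UNIV (\<lambda>x. frechet_derivative \<phi> (at x) (axis j 1))" by auto
    qed
    have wj: "(LINT x:?B|lebesgue. f x $ i * frechet_derivative \<phi> (at x) (axis j 1)) = - (LINT x:?B|lebesgue. Df x $ i $ j * \<phi> x)"
      using Df \<phi>1 by (simp add: weak_Jacobian_W1p_loc_def weak_Jacobian_def)
    have [measurable]: "\<phi> \<in> borel_measurable borel" using c\<phi>(1) by (rule borel_measurable_continuous_onI)
    have "(LINT x:?B|lebesgue. f x $ i * frechet_derivative \<phi> (at x) (axis j 1))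
      = (\<integral>x. indicator (ball 0 R) x *\<^sub>R (f x $ i * frechet_derivative \<phi> (at x) (axis j 1)) \<partial>lebesgue)"
      unfolding set_lebesgue_integral_def using \<phi>0 \<open>ball 0 R \<subseteq> ?B\<close>
      by (intro Bochner_Integration.integral_cong) (auto split: split_indicator)
    also have "\<dots> = (\<integral>x. indicator (ball 0 R) x *\<^sub>R (f x $ i * frechet_derivative \<phi> (at x) (axis j 1)) \<partial>lborel)"
    proof (rule integral_completion)
      have "continuous_on (ball 0 R) (\<lambda>x. f x $ i * frechet_derivative \<phi> (at x) (axis j 1))"
        using cont \<open>ball 0 R \<subseteq> ?B\<close> c\<phi>(2) by (intro continuous_intros) (auto intro: continuous_on_subset)
      then have "(\<lambda>x. indicator (ball 0 R) x *\<^sub>R (f x $ i * frechet_derivative \<phi> (at x) (axis j 1))) \<in> borel_measurable borel"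
        by (intro borel_measurable_continuous_on_indicator) auto
      then show "(\<lambda>x. indicator (ball 0 R) x *\<^sub>R (f x $ i * frechet_derivative \<phi> (at x) (axis j 1))) \<in> borel_measurable lborel"
        by simp
    qed
    finally have L: "(LINT x:?B|lebesgue. f x $ i * frechet_derivative \<phi> (at x) (axis j 1))
      = (\<integral>x. indicator (ball 0 R) x *\<^sub>R (f x $ i * frechet_derivative \<phi> (at x) (axis j 1)) \<partial>lborel)" .
    have "(LINT x:?B|lebesgue. Df x $ i $ j * \<phi> x) = (\<integral>x. indicator (ball 0 R) x *\<^sub>R (G x $ i $ j * \<phi> x) \<partial>lebesgue)"
      unfolding set_lebesgue_integral_def
    proof (rule integral_cong_AE)
      have eq: "indicator ?B x *\<^sub>R (Df x $ i $ j * \<phi> x) = (if x \<in> ?B then Df x else 0) $ i $ j * \<phi> x" for x by simp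
      have "\<phi> \<in> borel_measurable lebesgue" by (intro measurable_completion) simp
      then show "(\<lambda>x. indicator ?B x *\<^sub>R (Df x $ i $ j * \<phi> x)) \<in> borel_measurable lebesgue"
        unfolding eq by (intro borel_measurable_times borel_measurable_vec_nth' Dfm)
      show "(\<lambda>x. indicator (ball 0 R) x *\<^sub>R (G x $ i $ j * \<phi> x)) \<in> borel_measurable lebesgue"
        by (intro measurable_completion) measurable
      have "AE x in lebesgue. x \<notin> N" using aeN by (rule AE_completion)
      then show "AE x in lebesgue. indicator ?B x *\<^sub>R (Df x $ i $ j * \<phi> x) = indicator (ball 0 R) x *\<^sub>R (G x $ i $ j * \<phi> x)"
      proof eventually_elim
        case (elim x)
        then show ?case using GDf(1)[of x] \<phi>0(1)[of x] \<open>ball 0 R \<subseteq> ?B\<close> by (auto split: split_indicator)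
      qed
    qed
    also have "\<dots> = (\<integral>x. indicator (ball 0 R) x *\<^sub>R (G x $ i $ j * \<phi> x) \<partial>lborel)"
      by (intro integral_completion) measurable
    finally show "(\<integral>x. indicator (ball 0 R) x *\<^sub>R (f x $ i * frechet_derivative \<phi> (at x) (axis j 1)) \<partial>lborel)
        = - (\<integral>x. indicator (ball 0 R) x *\<^sub>R (G x $ i $ j * \<phi> x) \<partial>lborel)"
      using wj L by simp
  qed
qed

context distortion_map
begin

lemma approximation:
  assumes "0 < R" "R < 1"
  obtains F H where
    "\<And>k x. x \<in> ball 0 R \<Longrightarrow> (F k has_derivative (*v) (H k x)) (at x)"
    "\<And>k::nat. continuous_on (ball 0 R) (H k)"
    "uniform_limit (ball 0 R) F f sequentially"
    "\<And>k. (\<integral>\<^sup>+x. indicator (ball 0 R) x * ennreal (norm (H k x - G x)) \<partial>lborel) \<le> ennreal ((1/4) ^ k)"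
proof -
  define R' where "R' = (1 + R) / 2"
  have R': "R < R'" "R' < 1" using assms by (auto simp: R'_def)
  have "continuous_on (cball 0 R') f"
    by (rule continuous_on_subset[OF cont]) (use R' in auto)
  from mollification_sequence[OF assms(1) R'(1) this integrable_G[OF R'(2)] weak[OF R'(2)]]
  show ?thesis using that by blast
qed

lemma norm_G_power_le: "norm (G x) ^ CARD('n) \<le> real (CARD('n) ^ 2) ^ CARD('n) * K * det (G x)"
proof -
  have "norm (G x) ^ CARD('n) \<le> (real (CARD('n) ^ 2) * onorm ((*v) (G x))) ^ CARD('n)"
    by (intro power_mono norm_matrix_le_onorm) simp
  also have "\<dots> = real (CARD('n) ^ 2) ^ CARD('n) * onorm ((*v) (G x)) ^ CARD('n)"
    by (rule power_mult_distrib)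
  also have "\<dots> \<le> real (CARD('n) ^ 2) ^ CARD('n) * (K * det (G x))"
    by (intro mult_left_mono distortion) simp
  finally show ?thesis by (simp add: mult.assoc)
qed

definition distortion_const :: real where
  "distortion_const = real (CARD('n) ^ 2) ^ CARD('n) * K"

lemma distortion_const_nonneg: "distortion_const \<ge> 0"
  unfolding distortion_const_def using K by simp

text \<open>The points outside the sets of \<open>lusin_differentiability\<close> are null in the
  domain and drop out of the left side before any image is taken; on the rest the distortion
  inequality bounds the energy by the Jacobian and \<open>area_inequality\<close> applies.\<close>

lemma energy_ball:
  assumes E: "E \<in> sets borel" "E \<subseteq> ball 0 R" "R < 1" and im: "f ` E \<subseteq> ball 0 \<rho>"
    and mult: "\<And>y. emeasure (count_space UNIV) {x \<in> E. f x = y} \<le> N"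
  shows "(\<integral>\<^sup>+x. indicator E x * ennreal (norm (G x) ^ CARD('n)) \<partial>lborel)
    \<le> ennreal distortion_const * (N * emeasure lborel (ball (0::real^'n) \<rho>))"
proof -
  \<comment> \<open>\<open>approximation\<close> asks for a positive radius, whereas
    \<open>R\<close> is restricted from above alone.\<close>
  define R1 where "R1 = max R (1/2)"
  define R2 where "R2 = (1 + R1) / 2"
  have R12: "0 < R2" "R1 < R2" "R2 < 1" "R \<le> R1" using E(3) by (auto simp: R1_def R2_def)
  obtain F H where FH: "\<And>k x. x \<in> ball 0 R2 \<Longrightarrow> (F k has_derivative (*v) (H k x)) (at x)"
    "\<And>k::nat. continuous_on (ball 0 R2) (H k)"
    "uniform_limit (ball 0 R2) F f sequentially"
    "\<And>k. (\<integral>\<^sup>+x. indicator (ball 0 R2) x * ennreal (norm (H k x - G x)) \<partial>lborel) \<le> ennreal ((1/4) ^ k)"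
    using approximation[OF R12(1) R12(3)] by blast
  have lim: "(\<lambda>k. F k x) \<longlonglongrightarrow> f x" if "x \<in> ball 0 R2" for x
    using tendsto_uniform_limitI[OF FH(3) that] .
  obtain A where A: "\<And>j::nat. A j \<in> sets borel" "\<And>j. A j \<subseteq> ball 0 R1"
    "\<And>j x. x \<in> A j \<Longrightarrow> (f has_derivative (*v) (G x)) (at x within A j)"
    "AE x in lborel. x \<in> ball 0 R1 \<longrightarrow> x \<in> (\<Union>j. A j)"
    using lusin_differentiability[OF R12(2) G FH(1) FH(2) lim FH(4)] by blast
  define E' where "E' = E \<inter> (\<Union>j. A j)"
  have E' [measurable]: "E' \<in> sets borel" unfolding E'_def using E A by auto
  have "(\<integral>\<^sup>+x. indicator E x * ennreal (norm (G x) ^ CARD('n)) \<partial>lborel)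
      \<le> (\<integral>\<^sup>+x. ennreal distortion_const * (indicator E' x * ennreal \<bar>det (G x)\<bar>) \<partial>lborel)"
  proof (rule nn_integral_mono_AE)
    show "AE x in lborel. indicator E x * ennreal (norm (G x) ^ CARD('n)) \<le> ennreal distortion_const * (indicator E' x * ennreal \<bar>det (G x)\<bar>)"
      using A(4)
    proof eventually_elim
      case (elim x)
      show ?case
      proof (cases "x \<in> E")
        case True
        then have "x \<in> E'" using elim E R12 by (auto simp: E'_def)
        have "norm (G x) ^ CARD('n) \<le> distortion_const * \<bar>det (G x)\<bar>"
          using norm_G_power_le[of x] mult_left_mono[OF abs_ge_self distortion_const_nonneg, of "det (G x)"]
          unfolding distortion_const_def by linarith
        then have "ennreal (norm (G x) ^ CARD('n)) \<le> ennreal distortion_const * ennreal \<bar>det (G x)\<bar>"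
          using distortion_const_nonneg by (simp add: ennreal_mult'[symmetric] ennreal_leI)
        then show ?thesis using True \<open>x \<in> E'\<close> by simp
      qed simp
    qed
  qed
  also have "\<dots> = ennreal distortion_const * (\<integral>\<^sup>+x. indicator E' x * ennreal \<bar>det (G x)\<bar> \<partial>lborel)"
    by (rule nn_integral_cmult) measurable
  also have "(\<integral>\<^sup>+x. indicator E' x * ennreal \<bar>det (G x)\<bar> \<partial>lborel) \<le> N * emeasure lborel (ball (0::real^'n) \<rho>)"
  proof (rule area_inequality[OF E' A(1) _ A(3)])
    show "E' \<subseteq> (\<Union>j. A j)" "f ` E' \<subseteq> ball 0 \<rho>" using im by (auto simp: E'_def)
    show "(\<lambda>x. det (G x)) \<in> borel_measurable borel" by measurable
    fix y
    have "emeasure (count_space UNIV) {x \<in> E'. f x = y} \<le> emeasure (count_space UNIV) {x \<in> E. f x = y}"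
      by (rule emeasure_mono) (auto simp: E'_def)
    then show "emeasure (count_space UNIV) {x \<in> E'. f x = y} \<le> N" using mult by (rule order_trans)
  qed
  finally show ?thesis by (simp add: mult_left_mono)
qed

lemma borel_measurable_f: "(\<lambda>x. indicator (ball 0 1) x *\<^sub>R f x) \<in> borel_measurable borel"
  using cont by (intro borel_measurable_continuous_on_indicator) auto

text \<open>The energy bound per unit of multiplicity for one shell on which the ratio of the radii
  is \<open>exp 1\<close>; the factor \<open>exp (real CARD('n))\<close> is the \<open>n\<close>-th
  power of that ratio.\<close>

definition energy_const :: ennreal where
  "energy_const = ennreal (distortion_const * exp (real CARD('n))) * emeasure lborel (ball (0::real^'n) 1)"

lemma energy_const_finite: "energy_const < \<infinity>"
  unfolding energy_const_def using emeasure_lborel_ball_finite[of "0::real^'n" 1]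
  by (simp add: ennreal_mult_less_top)

text \<open>Cut \<open>E\<close> according to the integer part of
  \<open>ln (norm (f x)) - L\<close>. On one piece \<open>norm (f x)\<close> lies between
  \<open>c\<close> and \<open>exp 1 * c\<close>, and \<open>c^n\<close> cancels between the weight
  \<open>1 / norm (f x)^n\<close> and the volume of the image ball, so every piece has the same
  bound. The pieces are indexed by \<open>-M..M\<close> with \<open>M \<le> B + 1\<close>, hence
  there are at most \<open>2 * B + 3\<close>.\<close>

lemma energy_log:
  assumes E: "E \<in> sets borel" "E \<subseteq> ball 0 R" "R < 1" and B: "B \<ge> 0"
    and osc: "\<And>x. x \<in> E \<Longrightarrow> f x \<noteq> 0 \<and> \<bar>ln (norm (f x)) - L\<bar> \<le> B"
    and mult: "\<And>y. emeasure (count_space UNIV) {x \<in> E. f x = y} \<le> N"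
  shows "(\<integral>\<^sup>+x. indicator E x * ennreal ((norm (G x) / norm (f x)) ^ CARD('n)) \<partial>lborel)
    \<le> ennreal (2 * B + 3) * (energy_const * N)"
proof -
  let ?n = "CARD('n)"
  define M where "M = \<lceil>B\<rceil>"
  \<comment> \<open>Extension by zero yields a Borel function on the whole space, from which the
    pieces \<open>El l\<close> inherit measurability.\<close>
  define fB where "fB x = indicator (ball 0 1) x *\<^sub>R f x" for x
  have [measurable]: "fB \<in> borel_measurable borel" using borel_measurable_f by (simp add: fB_def[abs_def])
  have fB: "fB x = f x" if "x \<in> E" for x using that E by (auto simp: fB_def)
  define El where "El l = E \<inter> {x. of_int l \<le> ln (norm (fB x)) - L \<and> ln (norm (fB x)) - L < of_int l + 1}" for l :: int
  have El [measurable]: "El l \<in> sets borel" for l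
  proof -
    note E(1) [measurable]
    show ?thesis unfolding El_def by measurable
  qed
  have ElE: "El l \<subseteq> E" for l by (auto simp: El_def)
  have piece: "(\<integral>\<^sup>+x. indicator (El l) x * ennreal ((norm (G x) / norm (f x)) ^ ?n) \<partial>lborel) \<le> energy_const * N" for l
  proof -
    define c where "c = exp (L + of_int l)"
    have c: "c > 0" by (simp add: c_def)
    have bnd: "c \<le> norm (f x)" "norm (f x) < exp 1 * c" if x: "x \<in> El l" for x
    proof -
      have xE: "x \<in> E" using x ElE by blast
      then have nz: "norm (f x) > 0" using osc by auto
      have "L + of_int l \<le> ln (norm (f x))" "ln (norm (f x)) < L + of_int l + 1"
        using x fB[OF xE] by (auto simp: El_def)
      then show "c \<le> norm (f x)" "norm (f x) < exp 1 * c"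
      proof -
        have e: "exp (ln (norm (f x))) = norm (f x)" using nz by simp
        have "exp (L + of_int l) \<le> exp (ln (norm (f x)))" using \<open>L + of_int l \<le> ln (norm (f x))\<close> by simp
        then show "c \<le> norm (f x)" unfolding e c_def .
        have "exp (ln (norm (f x))) < exp (1 + (L + of_int l))" using \<open>ln (norm (f x)) < L + of_int l + 1\<close> by simp
        then show "norm (f x) < exp 1 * c" unfolding e c_def exp_add[of 1] .
      qed
    qed
    have "(\<integral>\<^sup>+x. indicator (El l) x * ennreal ((norm (G x) / norm (f x)) ^ ?n) \<partial>lborel)
      \<le> (\<integral>\<^sup>+x. ennreal (1 / c ^ ?n) * (indicator (El l) x * ennreal (norm (G x) ^ ?n)) \<partial>lborel)"
    proof (rule nn_integral_mono)
      fix x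
      show "indicator (El l) x * ennreal ((norm (G x) / norm (f x)) ^ ?n) \<le> ennreal (1 / c ^ ?n) * (indicator (El l) x * ennreal (norm (G x) ^ ?n))"
      proof (cases "x \<in> El l")
        case True
        have "(norm (G x) / norm (f x)) ^ ?n \<le> (norm (G x) / c) ^ ?n"
          using bnd[OF True] c by (intro power_mono divide_left_mono mult_pos_pos) auto
        also have "\<dots> = 1 / c ^ ?n * norm (G x) ^ ?n" by (simp add: power_divide)
        finally have "ennreal ((norm (G x) / norm (f x)) ^ ?n) \<le> ennreal (1 / c ^ ?n) * ennreal (norm (G x) ^ ?n)"
          using c by (simp add: ennreal_mult'[symmetric] ennreal_leI)
        then show ?thesis using True by simp
      qed simp
    qed
    also have "\<dots> = ennreal (1 / c ^ ?n) * (\<integral>\<^sup>+x. indicator (El l) x * ennreal (norm (G x) ^ ?n) \<partial>lborel)"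
      using El[of l] by (intro nn_integral_cmult) measurable
    also have "\<dots> \<le> ennreal (1 / c ^ ?n) * (ennreal distortion_const * (N * emeasure lborel (ball (0::real^'n) (exp 1 * c))))"
    proof (intro mult_left_mono energy_ball[OF El _ E(3)])
      show "El l \<subseteq> ball 0 R" using ElE E by blast
      show "f ` El l \<subseteq> ball 0 (exp 1 * c)" using bnd by auto
      fix y
      have "emeasure (count_space UNIV) {x \<in> El l. f x = y} \<le> emeasure (count_space UNIV) {x \<in> E. f x = y}"
        using ElE by (intro emeasure_mono) auto
      then show "emeasure (count_space UNIV) {x \<in> El l. f x = y} \<le> N" using mult by (rule order_trans)
    qed simp
    also have "emeasure lborel (ball (0::real^'n) (exp 1 * c)) = ennreal ((exp 1 * c) ^ ?n) * emeasure lborel (ball (0::real^'n) 1)"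
      using emeasure_lborel_ball_scale[of "exp 1 * c" "0::real^'n"] c by simp
    also have "(exp 1 * c) ^ ?n = exp (real ?n) * c ^ ?n"
      by (simp add: power_mult_distrib exp_of_nat_mult[symmetric])
    also have "ennreal (1 / c ^ ?n) * (ennreal distortion_const * (N * (ennreal (exp (real ?n) * c ^ ?n) * emeasure lborel (ball (0::real^'n) 1))))
      = (ennreal (1 / c ^ ?n) * ennreal (exp (real ?n) * c ^ ?n) * ennreal distortion_const) * emeasure lborel (ball (0::real^'n) 1) * N"
      by (simp only: mult_ac)
    also have "ennreal (1 / c ^ ?n) * ennreal (exp (real ?n) * c ^ ?n) * ennreal distortion_const = ennreal (distortion_const * exp (real ?n))"
      using c distortion_const_nonneg by (simp add: ennreal_mult'[symmetric] mult.commute)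
    finally show ?thesis by (simp add: energy_const_def)
  qed
  have cover: "indicator E x = (\<Sum>l\<in>{-M..M}. indicator (El l) x :: ennreal)" for x
  proof (cases "x \<in> E")
    case True
    define l where "l = \<lfloor>ln (norm (f x)) - L\<rfloor>"
    have "\<bar>ln (norm (f x)) - L\<bar> \<le> B" using osc True by blast
    then have l: "l \<in> {-M..M}" unfolding l_def M_def by (auto simp: le_floor_iff abs_le_iff) linarith+
    have "indicator (El k) x = (if k = l then 1 else 0 :: ennreal)" for k
      using True fB[OF True] unfolding El_def l_def indicator_def by (auto simp: floor_eq_iff) linarith+
    then show ?thesis using True l by simp
  next
    case False
    then have "indicator (El k) x = (0 :: ennreal)" for k using ElE by (auto simp: indicator_def)
    then show ?thesis using False by simp
  qed
  have "(\<integral>\<^sup>+x. indicator E x * ennreal ((norm (G x) / norm (f x)) ^ ?n) \<partial>lborel)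
    = (\<integral>\<^sup>+x. (\<Sum>l\<in>{-M..M}. indicator (El l) x * ennreal ((norm (G x) / norm (fB x)) ^ ?n)) \<partial>lborel)"
  proof (rule nn_integral_cong)
    fix x
    show "indicator E x * ennreal ((norm (G x) / norm (f x)) ^ ?n) = (\<Sum>l\<in>{-M..M}. indicator (El l) x * ennreal ((norm (G x) / norm (fB x)) ^ ?n))"
      using fB[of x] cover[of x] by (cases "x \<in> E") (auto simp: sum_distrib_right[symmetric])
  qed
  also have "\<dots> = (\<Sum>l\<in>{-M..M}. \<integral>\<^sup>+x. indicator (El l) x * ennreal ((norm (G x) / norm (fB x)) ^ ?n) \<partial>lborel)"
    by (rule nn_integral_sum) simp
  also have "\<dots> \<le> (\<Sum>l\<in>{-M..M}. energy_const * N)"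
  proof (rule sum_mono)
    fix l
    have "(\<integral>\<^sup>+x. indicator (El l) x * ennreal ((norm (G x) / norm (fB x)) ^ ?n) \<partial>lborel) = (\<integral>\<^sup>+x. indicator (El l) x * ennreal ((norm (G x) / norm (f x)) ^ ?n) \<partial>lborel)"
    proof (rule nn_integral_cong)
      fix x
      have "fB x = f x" if "x \<in> El l" using fB[OF subsetD[OF ElE that]] .
      then show "indicator (El l) x * ennreal ((norm (G x) / norm (fB x)) ^ ?n) = indicator (El l) x * ennreal ((norm (G x) / norm (f x)) ^ ?n)"
        by (cases "x \<in> El l") simp_all
    qed
    then show "(\<integral>\<^sup>+x. indicator (El l) x * ennreal ((norm (G x) / norm (fB x)) ^ ?n) \<partial>lborel) \<le> energy_const * N"
      using piece by simp
  qed
  also have "\<dots> = ennreal (real (card {-M..M})) * (energy_const * N)"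
    by (simp add: ennreal_of_nat_eq_real_of_nat)
  also have "\<dots> \<le> ennreal (2 * B + 3) * (energy_const * N)"
  proof (intro mult_right_mono ennreal_leI)
    have "M \<ge> 0" "of_int M \<le> B + 1" using B by (auto simp: M_def)
    then show "real (card {-M..M}) \<le> 2 * B + 3" by simp
  qed simp
  finally show ?thesis .
qed

end

subsection \<open>Absolute continuity on radii\<close>

lemma sets_sphere_measure: "sets (sphere_measure :: (real^'n) measure) = sets (restrict_space borel (sphere 0 1))"
  by (simp add: sphere_measure_def)

lemma space_sphere_measure: "space (sphere_measure :: (real^'n) measure) = sphere 0 1"
  by (simp add: sphere_measure_def space_restrict_space)

lemma borel_measurable_sphere_measure:
  assumes "F \<in> borel_measurable borel"
  shows "F \<in> borel_measurable (sphere_measure :: (real^'n) measure)"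
  using assms by (simp add: measurable_cong_sets[OF sets_sphere_measure refl] measurable_restrict_space1)

lemma sphere_measure_Int_sets:
  assumes "D \<in> sets borel"
  shows "D \<inter> sphere 0 1 \<in> sets (sphere_measure :: (real^'n) measure)"
  using assms by (auto simp: sets_sphere_measure sets_restrict_space)

lemma finite_sphere_measure: "finite_measure (sphere_measure :: (real^'n) measure)"
proof
  have "emeasure sphere_measure (space (sphere_measure :: (real^'n) measure)) = (\<integral>\<^sup>+w. 1 \<partial>(sphere_measure :: (real^'n) measure))"
    by simp
  also have "\<dots> = of_nat CARD('n) * (\<integral>\<^sup>+x. 1 * indicator (ball 0 1 - {0}) x \<partial>(lborel :: (real^'n) measure))"
    by (rule nn_integral_sphere_measure) simp
  also have "\<dots> \<le> of_nat CARD('n) * (\<integral>\<^sup>+x. indicator (ball 0 1) x \<partial>(lborel :: (real^'n) measure))"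
    by (intro mult_left_mono nn_integral_mono) (auto split: split_indicator)
  also have "\<dots> < \<infinity>"
    using emeasure_lborel_ball_finite[of "0::real^'n" 1] by (simp add: ennreal_mult_less_top of_nat_less_top)
  finally show "emeasure sphere_measure (space (sphere_measure :: (real^'n) measure)) \<noteq> \<infinity>" by simp
qed

lemma nn_integral_polar_sector:
  fixes h :: "real^'n \<Rightarrow> ennreal"
  assumes [measurable]: "h \<in> borel_measurable borel" "D \<in> sets borel" "I \<in> sets borel" and I: "I \<subseteq> {0<..<1}"
  shows "(\<integral>\<^sup>+w. indicator D w * (\<integral>\<^sup>+s. indicator I s * h (s *\<^sub>R w) \<partial>lborel) \<partial>sphere_measure)
    = (\<integral>\<^sup>+z. indicator {z. norm z \<in> I \<and> z /\<^sub>R norm z \<in> D} z * (h z * ennreal (1 / norm z ^ (CARD('n) - 1))) \<partial>lborel)"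
proof -
  let ?Q = "{z :: real^'n. norm z \<in> I \<and> z /\<^sub>R norm z \<in> D}"
  have [measurable]: "?Q \<in> sets borel" by measurable
  have Q: "?Q \<subseteq> ball 0 1 - {0}" using I by auto
  have "(\<integral>\<^sup>+w. indicator D w * (\<integral>\<^sup>+s. indicator I s * h (s *\<^sub>R w) \<partial>lborel) \<partial>sphere_measure)
    = (\<integral>\<^sup>+w. (\<integral>\<^sup>+s. indicator {0<..<1} s * (indicator ?Q (s *\<^sub>R w) * h (s *\<^sub>R w)) \<partial>lborel) \<partial>sphere_measure)"
  proof (rule nn_integral_cong)
    fix w :: "real^'n" assume "w \<in> space sphere_measure"
    then have w: "norm w = 1" by (simp add: space_sphere_measure)
    have e: "indicator {0<..<1} s * (indicator ?Q (s *\<^sub>R w) * h (s *\<^sub>R w)) = indicator D w * (indicator I s * h (s *\<^sub>R w))" for s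
      using w I by (auto split: split_indicator)
    show "indicator D w * (\<integral>\<^sup>+s. indicator I s * h (s *\<^sub>R w) \<partial>lborel) = (\<integral>\<^sup>+s. indicator {0<..<1} s * (indicator ?Q (s *\<^sub>R w) * h (s *\<^sub>R w)) \<partial>lborel)"
      unfolding e by (rule nn_integral_cmult[symmetric]) measurable
  qed
  also have "\<dots> = (\<integral>\<^sup>+z. indicator (ball 0 1 - {0}) z * ((indicator ?Q z * h z) * ennreal (1 / norm z ^ (CARD('n) - 1))) \<partial>lborel)"
    by (rule nn_integral_sphere_radial) measurable
  also have "\<dots> = (\<integral>\<^sup>+z. indicator ?Q z * (h z * ennreal (1 / norm z ^ (CARD('n) - 1))) \<partial>lborel)"
    using Q by (intro nn_integral_cong) (auto simp: mult.assoc split: split_indicator)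
  finally show ?thesis .
qed

lemma nn_integral_polar_sector_const:
  fixes D :: "(real^'n) set"
  assumes D [measurable]: "D \<in> sets borel" and I [measurable]: "I \<in> sets borel" "I \<subseteq> {0<..<1}"
  shows "(\<integral>\<^sup>+z. indicator {z. norm z \<in> I \<and> z /\<^sub>R norm z \<in> D} z * ennreal (1 / norm z ^ (CARD('n) - 1)) \<partial>lborel)
    = emeasure lborel I * emeasure sphere_measure (D \<inter> sphere 0 1)"
proof -
  have "(\<integral>\<^sup>+z. indicator {z. norm z \<in> I \<and> z /\<^sub>R norm z \<in> D} z * (1 * ennreal (1 / norm z ^ (CARD('n) - 1))) \<partial>lborel)
     = (\<integral>\<^sup>+w. indicator D w * (\<integral>\<^sup>+s. indicator I s * 1 \<partial>lborel) \<partial>(sphere_measure :: (real^'n) measure))"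
    by (rule nn_integral_polar_sector[symmetric]) (use I in auto)
  also have "\<dots> = (\<integral>\<^sup>+w. emeasure lborel I * indicator (D \<inter> sphere 0 1) w \<partial>(sphere_measure :: (real^'n) measure))"
    by (intro nn_integral_cong) (auto simp: space_sphere_measure mult.commute split: split_indicator)
  also have "\<dots> = emeasure lborel I * emeasure sphere_measure (D \<inter> sphere 0 1)"
    by (rule nn_integral_cmult_indicator) (rule sphere_measure_Int_sets[OF D])
  finally show ?thesis by simp
qed

lemma sets_sphere_cap: "sphere_cap w r \<in> sets (sphere_measure :: (real^'n) measure)"
  unfolding sphere_cap_def by (rule sphere_measure_Int_sets) simp

text \<open>The ball of radius \<open>r / 16\<close> about \<open>(1 - r / 8) *\<^sub>R w0\<close>
  fits into the sector over the cap: its points have norm between \<open>1 - 3 * r / 16\<close> and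
  \<open>1 - r / 16\<close>, and their projections to the sphere lie within \<open>3 * r / 8\<close>
  of \<open>w0\<close>. Polar coordinates bound its volume by \<open>r\<close> times the measure of
  the cap. Capping \<open>r\<close> at 1/2 makes the estimate meaningful for caps of any
  radius.\<close>

lemma emeasure_sphere_cap_ge:
  fixes w0 :: "real^'n"
  assumes w0: "norm w0 = 1" and R: "R > 0"
  defines "r \<equiv> min R (1/2)"
  shows "ennreal (r ^ (CARD('n) - 1)) \<le> ennreal (16 ^ CARD('n) / unit_ball_vol (real CARD('n))) * emeasure sphere_measure (sphere_cap w0 R)"
proof -
  let ?n = "CARD('n)"
  have r: "0 < r" "r \<le> 1/2" "r \<le> R" using R by (auto simp: r_def)
  define V where "V = unit_ball_vol (real ?n)"
  have V: "V > 0" by (simp add: V_def)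
  define I where "I = {1 - r..<1}"
  have I: "I \<in> sets borel" "I \<subseteq> {0<..<1}" using r by (auto simp: I_def)
  let ?Q = "{z :: real^'n. norm z \<in> I \<and> z /\<^sub>R norm z \<in> ball w0 R}"
  have sub: "ball ((1 - r / 8) *\<^sub>R w0) (r / 16) \<subseteq> ?Q"
  proof
    fix z assume "z \<in> ball ((1 - r / 8) *\<^sub>R w0) (r / 16)"
    then have z: "norm (z - (1 - r / 8) *\<^sub>R w0) < r / 16" by (simp add: dist_norm norm_minus_commute)
    define p where "p = (1 - r / 8) *\<^sub>R w0"
    have nw: "norm p = 1 - r / 8" using w0 r by (simp add: p_def)
    note z = z[folded p_def]
    have nz: "norm z > 1 - 3 * r / 16" "norm z < 1 - r / 16"
    proof -
      have "norm (p) \<le> norm z + norm (z - p)" by norm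
      moreover have "norm z \<le> norm (p) + norm (z - p)" by norm
      ultimately show "norm z > 1 - 3 * r / 16" "norm z < 1 - r / 16" using z nw by linarith+
    qed
    have "norm (a - w0) \<le> norm (a - z) + norm (z - p) + norm (p - w0)" for a by norm
    then have "norm (z /\<^sub>R norm z - w0) \<le> norm (z /\<^sub>R norm z - z) + norm (z - p) + norm (p - w0)" .
    also have "norm (z /\<^sub>R norm z - z) = 1 - norm z"
    proof -
      have "z /\<^sub>R norm z - z = (inverse (norm z) - 1) *\<^sub>R z" by (simp add: scaleR_diff_left)
      then have "norm (z /\<^sub>R norm z - z) = \<bar>inverse (norm z) - 1\<bar> * norm z" by simp
      also have "\<dots> = (inverse (norm z) - 1) * norm z"
      proof -
        have "inverse (norm z) \<ge> 1" using nz r by (intro one_le_inverse) linarith+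
        then show ?thesis by simp
      qed
      also have "\<dots> = 1 - norm z"
      proof -
        have "norm z > 0" using nz r by linarith
        then show ?thesis by (simp add: left_diff_distrib)
      qed
      finally show ?thesis .
    qed
    also have "norm (p - w0) = r / 8"
    proof -
      have "p - w0 = (- (r / 8)) *\<^sub>R w0" by (simp add: p_def scaleR_diff_left)
      then show ?thesis using w0 r by simp
    qed
    finally have "norm (z /\<^sub>R norm z - w0) < R" using z nz r by linarith
    then show "z \<in> ?Q" using nz r by (simp add: I_def dist_norm norm_minus_commute)
  qed
  have "ennreal (V * (r / 16) ^ ?n) = emeasure lborel (ball ((1 - r / 8) *\<^sub>R w0) (r / 16))"
    using r by (simp add: emeasure_ball V_def)
  also have "\<dots> = (\<integral>\<^sup>+z. indicator (ball ((1 - r / 8) *\<^sub>R w0) (r / 16)) z \<partial>lborel)" by simp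
  also have "\<dots> \<le> (\<integral>\<^sup>+z. indicator ?Q z * ennreal (1 / norm z ^ (?n - 1)) \<partial>lborel)"
  proof (rule nn_integral_mono)
    fix z :: "real^'n"
    show "indicator (ball ((1 - r / 8) *\<^sub>R w0) (r / 16)) z \<le> indicator ?Q z * ennreal (1 / norm z ^ (?n - 1))"
    proof (cases "z \<in> ball ((1 - r / 8) *\<^sub>R w0) (r / 16)")
      case True
      then have zQ: "z \<in> ?Q" using sub by blast
      then have "0 < norm z" "norm z \<le> 1" using r by (auto simp: I_def)
      then have "1 \<le> 1 / norm z ^ (?n - 1)" by (simp add: power_le_one)
      then have "1 \<le> ennreal (1 / norm z ^ (?n - 1))" by (metis ennreal_1 ennreal_leI)
      then show ?thesis using True zQ by simp
    qed simp
  qed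
  also have "\<dots> = emeasure lborel I * emeasure sphere_measure (ball w0 R \<inter> sphere 0 1)"
    by (rule nn_integral_polar_sector_const) (use I in auto)
  also have "emeasure lborel I = ennreal r" using r by (simp add: I_def)
  finally have le: "ennreal (V * (r / 16) ^ ?n) \<le> ennreal r * emeasure sphere_measure (sphere_cap w0 R)"
    by (simp add: sphere_cap_def)
  have "ennreal (r ^ (?n - 1)) = ennreal (16 ^ ?n / (V * r)) * ennreal (V * (r / 16) ^ ?n)"
  proof -
    have "r ^ ?n = r * r ^ (?n - 1)" by (cases ?n) auto
    then have "16 ^ ?n / (V * r) * (V * (r / 16) ^ ?n) = r ^ (?n - 1)"
      using r V by (simp add: power_divide)
    then show ?thesis using r V by (simp add: ennreal_mult'[symmetric])
  qed
  also have "\<dots> \<le> ennreal (16 ^ ?n / (V * r)) * (ennreal r * emeasure sphere_measure (sphere_cap w0 R))"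
    using le by (rule mult_left_mono) simp
  also have "\<dots> = ennreal (16 ^ ?n / V) * emeasure sphere_measure (sphere_cap w0 R)"
    using r V by (simp add: mult.assoc[symmetric] ennreal_mult'[symmetric])
  finally show ?thesis by (simp add: V_def)
qed

section \<open>Estimates along a single radius\<close>

lemma nn_integral_segment_param:
  fixes \<phi> :: "real \<Rightarrow> ennreal"
  assumes [measurable]: "\<phi> \<in> borel_measurable borel" and ts: "t < s"
  shows "ennreal (s - t) * (\<integral>\<^sup>+u. indicator {0..1} u * \<phi> (t + u * (s - t)) \<partial>lborel) = (\<integral>\<^sup>+\<tau>. indicator {t..s} \<tau> * \<phi> \<tau> \<partial>lborel)"
proof -
  have "(\<integral>\<^sup>+\<tau>. indicator {t..s} \<tau> * \<phi> \<tau> \<partial>lborel)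
     = ennreal \<bar>s - t\<bar> * (\<integral>\<^sup>+u. indicator {t..s} (t + (s - t) * u) * \<phi> (t + (s - t) * u) \<partial>lborel)"
    using ts by (intro nn_integral_real_affine) auto
  also have "(\<integral>\<^sup>+u. indicator {t..s} (t + (s - t) * u) * \<phi> (t + (s - t) * u) \<partial>lborel) = (\<integral>\<^sup>+u. indicator {0..1} u * \<phi> (t + u * (s - t)) \<partial>lborel)"
  proof (rule nn_integral_cong)
    fix u
    have "indicator {t..s} (t + (s - t) * u) = (indicator {0..1} u :: ennreal)"
    proof -
      have "t + (s - t) * u \<le> s \<longleftrightarrow> (s - t) * u \<le> (s - t) * 1" by auto
      also have "\<dots> \<longleftrightarrow> u \<le> 1" using ts by (subst mult_le_cancel_left_pos) auto
      finally have "t + (s - t) * u \<le> s \<longleftrightarrow> u \<le> 1" .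
      moreover have "t \<le> t + (s - t) * u \<longleftrightarrow> 0 \<le> u" using ts by (simp add: zero_le_mult_iff)
      ultimately show ?thesis by (simp add: indicator_def)
    qed
    then show "indicator {t..s} (t + (s - t) * u) * \<phi> (t + (s - t) * u) = indicator {0..1} u * \<phi> (t + u * (s - t))"
      by (simp add: mult.commute)
  qed
  finally show ?thesis using ts by simp
qed

lemma norm_diff_le_nn_integral_radial:
  fixes u :: "'a::euclidean_space \<Rightarrow> 'b::euclidean_space"
  assumes w: "norm w = 1" and ts: "0 \<le> t" "t < s" "s < R"
    and der: "\<And>y. y \<in> ball 0 R \<Longrightarrow> (u has_derivative D y) (at y)"
    and g: "continuous_on (ball 0 R) g" "\<And>y v. y \<in> ball 0 R \<Longrightarrow> norm (D y v) \<le> g y * norm v"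
  shows "ennreal (norm (u (s *\<^sub>R w) - u (t *\<^sub>R w))) \<le> (\<integral>\<^sup>+\<tau>. indicator {t..s} \<tau> * ennreal (g (\<tau> *\<^sub>R w)) \<partial>lborel)"
proof -
  define gB where "gB z = indicator (ball 0 R) z *\<^sub>R g z" for z
  have [measurable]: "gB \<in> borel_measurable borel"
    unfolding gB_def using g(1) by (intro borel_measurable_continuous_on_indicator) auto
  have inB: "\<tau> *\<^sub>R w \<in> ball 0 R" if "\<tau> \<in> {t..s}" for \<tau> using that ts w by simp
  have gB: "gB (\<tau> *\<^sub>R w) = g (\<tau> *\<^sub>R w)" if "\<tau> \<in> {t..s}" for \<tau> using inB[OF that] by (simp add: gB_def)
  have sw: "t *\<^sub>R w + a *\<^sub>R (s *\<^sub>R w - t *\<^sub>R w) = (t + a * (s - t)) *\<^sub>R w" for a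
    by (simp add: algebra_simps)
  have "norm (s *\<^sub>R w - t *\<^sub>R w) = s - t"
    using w ts by (simp add: scaleR_diff_left[symmetric])
  then have "ennreal (norm (u (s *\<^sub>R w) - u (t *\<^sub>R w))) \<le> ennreal (s - t) * (\<integral>\<^sup>+a. indicator {0..1} a * ennreal (g (t *\<^sub>R w + a *\<^sub>R (s *\<^sub>R w - t *\<^sub>R w))) \<partial>lborel)"
    using norm_diff_le_nn_integral_segment[OF convex_ball inB[of t] inB[of s] der g] ts by simp
  also have "(\<integral>\<^sup>+a. indicator {0..1} a * ennreal (g (t *\<^sub>R w + a *\<^sub>R (s *\<^sub>R w - t *\<^sub>R w))) \<partial>lborel)
      = (\<integral>\<^sup>+a. indicator {0..1} a * ennreal (gB ((t + a * (s - t)) *\<^sub>R w)) \<partial>lborel)"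
  proof (rule nn_integral_cong)
    fix a :: real
    have "t + a * (s - t) \<in> {t..s}" if "a \<in> {0..1}"
    proof -
      have "a * (s - t) \<le> 1 * (s - t)" using that ts by (intro mult_right_mono) auto
      then have "a * (s - t) + t \<le> s" by (simp only: mult_1 le_diff_eq)
      moreover have "0 \<le> a * (s - t)" using that ts by simp
      ultimately show ?thesis by (simp add: add.commute)
    qed
    then show "indicator {0..1} a * ennreal (g (t *\<^sub>R w + a *\<^sub>R (s *\<^sub>R w - t *\<^sub>R w))) = indicator {0..1} a * ennreal (gB ((t + a * (s - t)) *\<^sub>R w))"
      unfolding sw using gB by (cases "a \<in> {0..1}") simp_all
  qed
  also have "ennreal (s - t) * \<dots> = (\<integral>\<^sup>+\<tau>. indicator {t..s} \<tau> * ennreal (gB (\<tau> *\<^sub>R w)) \<partial>lborel)"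
    by (rule nn_integral_segment_param) (use ts in measurable)
  also have "\<dots> = (\<integral>\<^sup>+\<tau>. indicator {t..s} \<tau> * ennreal (g (\<tau> *\<^sub>R w)) \<partial>lborel)"
    by (intro nn_integral_cong) (auto simp: gB split: split_indicator)
  finally show ?thesis .
qed

lemma has_derivative_ln_norm:
  fixes F :: "'a::real_normed_vector \<Rightarrow> 'b::real_inner"
  assumes "(F has_derivative D) (at x)" "F x \<noteq> 0"
  shows "((\<lambda>x. ln (norm (F x))) has_derivative (\<lambda>v. inverse (norm (F x)) * (D v \<bullet> sgn (F x)))) (at x)"
proof -
  have 1: "((\<lambda>x. norm (F x)) has_derivative (\<lambda>v. D v \<bullet> sgn (F x))) (at x)"
    by (rule has_derivative_compose[OF assms(1) has_derivative_norm[OF assms(2)]])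
  have "(ln has_real_derivative inverse (norm (F x))) (at (norm (F x)))"
    using assms(2) by (intro DERIV_ln) simp
  from has_derivative_compose[OF 1 this[unfolded has_field_derivative_def]] show ?thesis
    by simp
qed

text \<open>The sum of the functions has a finite integral, so the series converges almost
  everywhere and its terms tend to 0.\<close>

lemma AE_tendsto_0_of_summable_nn_integral:
  fixes I :: "nat \<Rightarrow> 'a \<Rightarrow> ennreal"
  assumes [measurable]: "\<And>k. I k \<in> borel_measurable M"
    and le: "\<And>k. (\<integral>\<^sup>+x. I k x \<partial>M) \<le> ennreal (c k)" and c: "\<And>k. c k \<ge> 0" "summable c"
  shows "AE x in M. (\<lambda>k. I k x) \<longlonglongrightarrow> 0"
proof -
  have "(\<integral>\<^sup>+x. (\<Sum>k. I k x) \<partial>M) = (\<Sum>k. \<integral>\<^sup>+x. I k x \<partial>M)"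
    by (rule nn_integral_suminf) simp
  also have "\<dots> \<le> (\<Sum>k. ennreal (c k))"
    by (intro suminf_le le) auto
  also have "\<dots> = ennreal (suminf c)"
    using c by (intro suminf_ennreal_eq summable_sums)
  also have "\<dots> < \<infinity>" by simp
  finally have "AE x in M. (\<Sum>k. I k x) \<noteq> \<infinity>"
    by (intro nn_integral_PInf_AE) auto
  then show ?thesis
  proof eventually_elim
    case (elim x)
    define r where "r k = enn2real (I k x)" for k
    have "I k x \<noteq> \<infinity>" for k
    proof -
      have "I k x \<le> (\<Sum>k. I k x)" using sum_le_suminf[of "\<lambda>k. I k x" "{k}"] by simp
      then show ?thesis using elim by (auto simp: top_unique)
    qed
    then have r: "I k x = ennreal (r k)" for k by (simp add: r_def less_top[symmetric])
    have "summable r"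
      by (rule summable_suminf_not_top) (use elim in \<open>simp_all add: r[symmetric], simp add: r_def\<close>)
    then have "(\<lambda>k. ennreal (r k)) \<longlonglongrightarrow> ennreal 0"
      by (intro tendsto_ennrealI summable_LIMSEQ_zero)
    then show ?case by (simp add: r)
  qed
qed

context distortion_map
begin

definition log_density :: "real^'n \<Rightarrow> ennreal" where
  "log_density x = indicator (ball 0 1) x * ennreal (norm (G x) / norm (f x))"

lemma borel_measurable_log_density [measurable]: "log_density \<in> borel_measurable borel"
proof -
  have "log_density = (\<lambda>x. indicator (ball 0 1) x * ennreal (norm (G x) / norm (indicator (ball 0 1) x *\<^sub>R f x)))"
    by (auto simp: log_density_def fun_eq_iff split: split_indicator)
  moreover note borel_measurable_f [measurable]
  have [measurable]: "ball (0::real^'n) 1 \<in> sets borel" by simp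
  have "(\<lambda>x. indicator (ball 0 1) x * ennreal (norm (G x) / norm (indicator (ball 0 1) x *\<^sub>R f x))) \<in> borel_measurable borel"
    by measurable
  ultimately show ?thesis by (simp only:)
qed

text \<open>In polar coordinates the summable \<open>L1\<close> errors of the derivatives become
  errors \<open>I k w\<close> that tend to 0 on almost every ray; the restriction to radii at least
  1/2 bounds the polar weight by \<open>2^(n - 1)\<close>. Each \<open>I k w\<close> covers the
  whole segment, so one exceptional set of directions serves all \<open>t\<close> and
  \<open>s\<close>. On the ray the smooth estimate for \<open>F k\<close> passes to the
  limit.\<close>

lemma AE_radial_aux:
  assumes nz: "\<And>x. x \<in> ball 0 1 \<Longrightarrow> f x \<noteq> 0" and R: "1/2 < R" "R < 1"
  shows "AE w in sphere_measure. \<forall>t s. 1/2 \<le> t \<and> t < s \<and> s < R \<longrightarrow>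
    ennreal (norm (f (s *\<^sub>R w) - f (t *\<^sub>R w))) \<le> (\<integral>\<^sup>+\<tau>. indicator {t..s} \<tau> * ennreal (norm (G (\<tau> *\<^sub>R w))) \<partial>lborel) \<and>
    ennreal \<bar>ln (norm (f (s *\<^sub>R w))) - ln (norm (f (t *\<^sub>R w)))\<bar> \<le> 2 * (\<integral>\<^sup>+\<tau>. indicator {t..s} \<tau> * log_density (\<tau> *\<^sub>R w) \<partial>lborel)"
proof -
  let ?B = "ball (0::real^'n) R"
  obtain F H where der: "\<And>k x. x \<in> ?B \<Longrightarrow> (F k has_derivative (*v) (H k x)) (at x)"
    and cH: "\<And>k::nat. continuous_on ?B (H k)"
    and unif: "uniform_limit ?B F f sequentially"
    and L1: "\<And>k. (\<integral>\<^sup>+x. indicator ?B x * ennreal (norm (H k x - G x)) \<partial>lborel) \<le> ennreal ((1/4) ^ k)"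
    using approximation[of R] R by auto
  have [measurable]: "?B \<in> sets borel" by simp
  define h where "h k x = indicator ?B x * ennreal (norm (H k x - G x))" for k x
  have hm [measurable]: "h k \<in> borel_measurable borel" for k
  proof -
    have [measurable]: "(\<lambda>x. indicator ?B x *\<^sub>R H k x) \<in> borel_measurable borel"
      using cH by (intro borel_measurable_continuous_on_indicator) auto
    have "h k = (\<lambda>x. indicator ?B x * ennreal (norm (indicator ?B x *\<^sub>R H k x - G x)))"
      by (auto simp: h_def fun_eq_iff split: split_indicator)
    then show ?thesis by (rule ssubst) measurable
  qed
  define I where "I k w = (\<integral>\<^sup>+s. indicator {1/2..<R} s * h k (s *\<^sub>R w) \<partial>lborel)" for k w
  have Im: "I k \<in> borel_measurable borel" for k
    unfolding I_def by measurable
  have "AE w in sphere_measure. (\<lambda>k. I k w) \<longlonglongrightarrow> 0"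
  proof (rule AE_tendsto_0_of_summable_nn_integral)
    show "I k \<in> borel_measurable sphere_measure" for k by (rule borel_measurable_sphere_measure[OF Im])
    show "(\<integral>\<^sup>+w. I k w \<partial>sphere_measure) \<le> ennreal (2 ^ (CARD('n) - 1) * (1/4) ^ k)" for k
    proof -
      have "(\<integral>\<^sup>+w. I k w \<partial>sphere_measure) = (\<integral>\<^sup>+w. indicator UNIV w * (\<integral>\<^sup>+s. indicator {1/2..<R} s * h k (s *\<^sub>R w) \<partial>lborel) \<partial>sphere_measure)"
        by (simp add: I_def)
      also have "\<dots> = (\<integral>\<^sup>+z. indicator {z. norm z \<in> {1/2..<R} \<and> z /\<^sub>R norm z \<in> UNIV} z * (h k z * ennreal (1 / norm z ^ (CARD('n) - 1))) \<partial>lborel)"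
        by (rule nn_integral_polar_sector) (use R in auto)
      also have "\<dots> \<le> (\<integral>\<^sup>+z. ennreal (2 ^ (CARD('n) - 1)) * h k z \<partial>lborel)"
      proof (rule nn_integral_mono)
        fix z :: "real^'n"
        have "1 / norm z ^ (CARD('n) - 1) \<le> 2 ^ (CARD('n) - 1)" if "1/2 \<le> norm z"
        proof -
          have "1 \<le> (2 * norm z) ^ (CARD('n) - 1)" using that by (intro one_le_power) simp
          moreover have "norm z ^ (CARD('n) - 1) > 0" using that by (intro zero_less_power) linarith
          ultimately show ?thesis by (simp add: field_simps power_mult_distrib)
        qed
        then show "indicator {z. norm z \<in> {1/2..<R} \<and> z /\<^sub>R norm z \<in> UNIV} z * (h k z * ennreal (1 / norm z ^ (CARD('n) - 1))) \<le> ennreal (2 ^ (CARD('n) - 1)) * h k z"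
          by (auto simp: mult.commute[of "h k z"] intro!: mult_right_mono ennreal_leI split: split_indicator)
      qed
      also have "\<dots> = ennreal (2 ^ (CARD('n) - 1)) * (\<integral>\<^sup>+z. h k z \<partial>lborel)"
        by (rule nn_integral_cmult) simp
      also have "\<dots> \<le> ennreal (2 ^ (CARD('n) - 1)) * ennreal ((1/4) ^ k)"
        using L1[of k] by (intro mult_left_mono) (simp_all add: h_def)
      finally show ?thesis by (simp add: ennreal_mult'[symmetric])
    qed
    show "summable (\<lambda>k. 2 ^ (CARD('n) - 1) * (1/4::real) ^ k)"
      by (intro summable_mult summable_geometric) simp
  qed simp
  moreover have "AE w in sphere_measure. w \<in> space (sphere_measure :: (real^'n) measure)" by (rule AE_space)
  ultimately show ?thesis
  proof eventually_elim
    case (elim w)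
    then have w: "norm w = 1" and I0: "(\<lambda>k. I k w) \<longlonglongrightarrow> 0" by (auto simp: space_sphere_measure)
    show ?case
    proof (intro allI impI, elim conjE)
      fix t s assume ts: "1/2 \<le> t" "t < s" "s < R"
      have inB: "\<tau> *\<^sub>R w \<in> ?B" if "\<tau> \<in> {t..s}" for \<tau> using that ts w by simp
      have subI: "(\<integral>\<^sup>+\<tau>. indicator {t..s} \<tau> * h k (\<tau> *\<^sub>R w) \<partial>lborel) \<le> I k w" for k
        unfolding I_def using ts by (intro nn_integral_mono) (auto split: split_indicator)
      have limF: "(\<lambda>k. F k (\<tau> *\<^sub>R w)) \<longlonglongrightarrow> f (\<tau> *\<^sub>R w)" if "\<tau> \<in> {t..s}" for \<tau>
        using tendsto_uniform_limitI[OF unif inB[OF that]] .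
      define A where "A = (\<integral>\<^sup>+\<tau>. indicator {t..s} \<tau> * ennreal (norm (G (\<tau> *\<^sub>R w))) \<partial>lborel)"
      define A' where "A' = (\<integral>\<^sup>+\<tau>. indicator {t..s} \<tau> * log_density (\<tau> *\<^sub>R w) \<partial>lborel)"
      have "ennreal (norm (F k (s *\<^sub>R w) - F k (t *\<^sub>R w))) \<le> A + I k w" for k
      proof -
        have "ennreal (norm (F k (s *\<^sub>R w) - F k (t *\<^sub>R w))) \<le> (\<integral>\<^sup>+\<tau>. indicator {t..s} \<tau> * ennreal (norm (H k (\<tau> *\<^sub>R w))) \<partial>lborel)"
          using w ts der cH by (intro norm_diff_le_nn_integral_radial[where R=R and D="\<lambda>x. (*v) (H k x)" and g="\<lambda>x. norm (H k x)"])
             (auto intro!: continuous_intros norm_matrix_vector_mult_le)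
        also have "\<dots> \<le> (\<integral>\<^sup>+\<tau>. indicator {t..s} \<tau> * ennreal (norm (G (\<tau> *\<^sub>R w))) + indicator {t..s} \<tau> * h k (\<tau> *\<^sub>R w) \<partial>lborel)"
        proof (rule nn_integral_mono)
          fix \<tau>
          have "norm (H k (\<tau> *\<^sub>R w)) \<le> norm (G (\<tau> *\<^sub>R w)) + norm (H k (\<tau> *\<^sub>R w) - G (\<tau> *\<^sub>R w))" by norm
          then show "indicator {t..s} \<tau> * ennreal (norm (H k (\<tau> *\<^sub>R w))) \<le> indicator {t..s} \<tau> * ennreal (norm (G (\<tau> *\<^sub>R w))) + indicator {t..s} \<tau> * h k (\<tau> *\<^sub>R w)"
            using inB[of \<tau>] by (auto simp: h_def ennreal_plus[symmetric] simp del: ennreal_plus intro!: ennreal_leI split: split_indicator)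
        qed
        also have "\<dots> = A + (\<integral>\<^sup>+\<tau>. indicator {t..s} \<tau> * h k (\<tau> *\<^sub>R w) \<partial>lborel)"
          unfolding A_def by (rule nn_integral_add) measurable
        also have "\<dots> \<le> A + I k w" using subI by (rule add_left_mono)
        finally show ?thesis .
      qed
      moreover have "(\<lambda>k. ennreal (norm (F k (s *\<^sub>R w) - F k (t *\<^sub>R w)))) \<longlonglongrightarrow> ennreal (norm (f (s *\<^sub>R w) - f (t *\<^sub>R w)))"
        using ts by (intro tendsto_ennrealI tendsto_intros limF) auto
      moreover have "(\<lambda>k. A + I k w) \<longlonglongrightarrow> A + 0"
        by (intro tendsto_add tendsto_const I0)
      ultimately have 1: "ennreal (norm (f (s *\<^sub>R w) - f (t *\<^sub>R w))) \<le> A"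
        using LIMSEQ_le[of "\<lambda>k. ennreal (norm (F k (s *\<^sub>R w) - F k (t *\<^sub>R w)))" _ "\<lambda>k. A + I k w" "A + 0"] by simp
      \<comment> \<open>A positive lower bound of \<open>norm (f x)\<close> on the compact ball:
        once \<open>F k\<close> is uniformly within \<open>c / 2\<close> of \<open>f\<close>, its
        norm is at least half that of \<open>f\<close>. This makes \<open>ln (norm (F k x))\<close>
        differentiable and accounts for the factor 2 in front of \<open>log_density\<close>.\<close>
      obtain c where c: "c > 0" "\<And>x. x \<in> cball 0 R \<Longrightarrow> c \<le> norm (f x)"
      proof -
        have sub: "cball (0::real^'n) R \<subseteq> ball 0 1" using R by auto
        have "continuous_on (cball 0 R) (\<lambda>x. norm (f x))"
          by (intro continuous_intros continuous_on_subset[OF cont sub])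
        moreover have "cball (0::real^'n) R \<noteq> {}" using R by simp
        ultimately obtain x0 where x0: "x0 \<in> cball 0 R" "\<forall>x\<in>cball 0 R. norm (f x0) \<le> norm (f x)"
          using continuous_attains_inf[OF compact_cball, of "0::real^'n" R] by blast
        then show ?thesis using that[of "norm (f x0)"] nz sub by force
      qed
      have "\<forall>\<^sub>F k in sequentially. \<forall>x\<in>?B. dist (F k x) (f x) < c / 2"
      proof -
        have "c / 2 > 0" using c by simp
        from unif[unfolded uniform_limit_iff, THEN spec, THEN mp, OF this] show ?thesis .
      qed
      then have ev: "\<forall>\<^sub>F k in sequentially. ennreal \<bar>ln (norm (F k (s *\<^sub>R w))) - ln (norm (F k (t *\<^sub>R w)))\<bar> \<le> 2 * A' + ennreal (2 / c) * I k w"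
      proof eventually_elim
        case (elim k)
        have Fk: "norm (F k x) \<ge> norm (f x) / 2" "norm (F k x) > 0" "norm (f x) \<ge> c" if x: "x \<in> ?B" for x
        proof -
          have "norm (f x) \<le> norm (F k x) + dist (F k x) (f x)" unfolding dist_norm by norm
          moreover have "dist (F k x) (f x) < c / 2" using elim x by blast
          moreover show "c \<le> norm (f x)" using c(2) x by simp
          ultimately show "norm (F k x) \<ge> norm (f x) / 2" "norm (F k x) > 0" using c(1) by linarith+
        qed
        have cF: "continuous_on ?B (F k)"
          by (rule has_derivative_continuous_on[OF has_derivative_at_withinI[OF der]])
        have "ennreal (norm (ln (norm (F k (s *\<^sub>R w))) - ln (norm (F k (t *\<^sub>R w)))))
          \<le> (\<integral>\<^sup>+\<tau>. indicator {t..s} \<tau> * ennreal (norm (H k (\<tau> *\<^sub>R w)) / norm (F k (\<tau> *\<^sub>R w))) \<partial>lborel)"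
        proof (rule norm_diff_le_nn_integral_radial[where R=R and D="\<lambda>x v. inverse (norm (F k x)) * ((H k x *v v) \<bullet> sgn (F k x))" and g="\<lambda>x. norm (H k x) / norm (F k x)"])
          show "((\<lambda>a. ln (norm (F k a))) has_derivative (\<lambda>v. inverse (norm (F k y)) * ((H k y *v v) \<bullet> sgn (F k y)))) (at y)" if "y \<in> ?B" for y
            using Fk(2)[OF that] by (intro has_derivative_ln_norm der that) auto
          show "continuous_on ?B (\<lambda>x. norm (H k x) / norm (F k x))"
            using Fk(2) by (intro continuous_intros cH cF) auto
          fix y v assume y: "y \<in> ?B"
          have "\<bar>(H k y *v v) \<bullet> sgn (F k y)\<bar> \<le> norm (H k y *v v) * norm (sgn (F k y))" by (rule Cauchy_Schwarz_ineq2)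
          also have "\<dots> = norm (H k y *v v)" using Fk(2)[OF y] by (simp add: norm_sgn)
          also have "\<dots> \<le> norm (H k y) * norm v" by (rule norm_matrix_vector_mult_le)
          finally show "norm (inverse (norm (F k y)) * ((H k y *v v) \<bullet> sgn (F k y))) \<le> norm (H k y) / norm (F k y) * norm v"
            using Fk(2)[OF y] by (simp add: abs_mult divide_inverse mult_left_mono mult.commute[of _ "inverse (norm (F k y))"] mult.assoc)
        qed (use w ts in auto)
        also have "\<dots> \<le> (\<integral>\<^sup>+\<tau>. 2 * (indicator {t..s} \<tau> * log_density (\<tau> *\<^sub>R w)) + ennreal (2 / c) * (indicator {t..s} \<tau> * h k (\<tau> *\<^sub>R w)) \<partial>lborel)"
        proof (rule nn_integral_mono)
          fix \<tau>
          show "indicator {t..s} \<tau> * ennreal (norm (H k (\<tau> *\<^sub>R w)) / norm (F k (\<tau> *\<^sub>R w)))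
            \<le> 2 * (indicator {t..s} \<tau> * log_density (\<tau> *\<^sub>R w)) + ennreal (2 / c) * (indicator {t..s} \<tau> * h k (\<tau> *\<^sub>R w))"
          proof (cases "\<tau> \<in> {t..s}")
            case True
            define y where "y = \<tau> *\<^sub>R w"
            have y: "y \<in> ?B" "y \<in> ball 0 1" using inB[OF True] R by (auto simp: y_def)
            note b = Fk[OF y(1)]
            have fp: "norm (f y) > 0" using b c by linarith
            have "norm (H k y) / norm (F k y) \<le> (norm (G y) + norm (H k y - G y)) / (norm (f y) / 2)"
            proof (rule frac_le)
              show "norm (H k y) \<le> norm (G y) + norm (H k y - G y)" by norm
            qed (use b fp in auto)
            also have "\<dots> = 2 * (norm (G y) / norm (f y)) + 2 / norm (f y) * norm (H k y - G y)"
              using fp by (simp add: field_simps)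
            also have "\<dots> \<le> 2 * (norm (G y) / norm (f y)) + 2 / c * norm (H k y - G y)"
            proof (intro add_left_mono mult_right_mono)
              show "2 / norm (f y) \<le> 2 / c"
                by (rule divide_left_mono[OF b(3) _ mult_pos_pos[OF fp c(1)]]) simp
            qed simp
            finally have "ennreal (norm (H k y) / norm (F k y)) \<le> ennreal (2 * (norm (G y) / norm (f y)) + 2 / c * norm (H k y - G y))"
              by (rule ennreal_leI)
            also have "\<dots> = ennreal (2 * (norm (G y) / norm (f y))) + ennreal (2 / c * norm (H k y - G y))"
              using c by (intro ennreal_plus) auto
            also have "\<dots> = 2 * log_density y + ennreal (2 / c) * h k y"
            proof -
              have "ennreal (2 * (norm (G y) / norm (f y))) = ennreal 2 * ennreal (norm (G y) / norm (f y))"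
                by (rule ennreal_mult) auto
              moreover have "ennreal (2 / c * norm (H k y - G y)) = ennreal (2 / c) * ennreal (norm (H k y - G y))"
                using c by (intro ennreal_mult) auto
              ultimately show ?thesis using y by (simp add: log_density_def h_def)
            qed
            finally show ?thesis using True by (simp add: y_def)
          qed simp
        qed
        also have "\<dots> = (\<integral>\<^sup>+\<tau>. 2 * (indicator {t..s} \<tau> * log_density (\<tau> *\<^sub>R w)) \<partial>lborel) + (\<integral>\<^sup>+\<tau>. ennreal (2 / c) * (indicator {t..s} \<tau> * h k (\<tau> *\<^sub>R w)) \<partial>lborel)"
          by (rule nn_integral_add) measurable
        also have "(\<integral>\<^sup>+\<tau>. 2 * (indicator {t..s} \<tau> * log_density (\<tau> *\<^sub>R w)) \<partial>lborel) = 2 * A'"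
          unfolding A'_def by (rule nn_integral_cmult) measurable
        also have "(\<integral>\<^sup>+\<tau>. ennreal (2 / c) * (indicator {t..s} \<tau> * h k (\<tau> *\<^sub>R w)) \<partial>lborel) = ennreal (2 / c) * (\<integral>\<^sup>+\<tau>. indicator {t..s} \<tau> * h k (\<tau> *\<^sub>R w) \<partial>lborel)"
          by (rule nn_integral_cmult) measurable
        also have "2 * A' + \<dots> \<le> 2 * A' + ennreal (2 / c) * I k w"
          using subI by (intro add_left_mono mult_left_mono) auto
        finally show ?case by simp
      qed
      have pos: "norm (f (\<tau> *\<^sub>R w)) \<noteq> 0" if "\<tau> \<in> {t..s}" for \<tau>
        using nz[of "\<tau> *\<^sub>R w"] inB[OF that] R by auto
      have lim1: "(\<lambda>k. ennreal \<bar>ln (norm (F k (s *\<^sub>R w))) - ln (norm (F k (t *\<^sub>R w)))\<bar>) \<longlonglongrightarrow> ennreal \<bar>ln (norm (f (s *\<^sub>R w))) - ln (norm (f (t *\<^sub>R w)))\<bar>"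
        using ts pos by (intro tendsto_ennrealI tendsto_intros limF) auto
      have lim2: "(\<lambda>k. 2 * A' + ennreal (2 / c) * I k w) \<longlonglongrightarrow> 2 * A' + ennreal (2 / c) * 0"
        by (intro tendsto_add tendsto_const ennreal_tendsto_cmult I0) simp
      have "ennreal \<bar>ln (norm (f (s *\<^sub>R w))) - ln (norm (f (t *\<^sub>R w)))\<bar> \<le> 2 * A' + ennreal (2 / c) * 0"
        by (rule tendsto_le[OF trivial_limit_sequentially lim2 lim1 ev])
      then have 2: "ennreal \<bar>ln (norm (f (s *\<^sub>R w))) - ln (norm (f (t *\<^sub>R w)))\<bar> \<le> 2 * A'" by simp
      show "ennreal (norm (f (s *\<^sub>R w) - f (t *\<^sub>R w))) \<le> (\<integral>\<^sup>+\<tau>. indicator {t..s} \<tau> * ennreal (norm (G (\<tau> *\<^sub>R w))) \<partial>lborel) \<and>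
        ennreal \<bar>ln (norm (f (s *\<^sub>R w))) - ln (norm (f (t *\<^sub>R w)))\<bar> \<le> 2 * (\<integral>\<^sup>+\<tau>. indicator {t..s} \<tau> * log_density (\<tau> *\<^sub>R w) \<partial>lborel)"
        using 1 2 by (simp add: A_def A'_def)
    qed
  qed
qed

lemma AE_radial:
  assumes nz: "\<And>x. x \<in> ball 0 1 \<Longrightarrow> f x \<noteq> 0"
  shows "AE w in sphere_measure. \<forall>t s. 1/2 \<le> t \<and> t < s \<and> s < 1 \<longrightarrow>
    ennreal (norm (f (s *\<^sub>R w) - f (t *\<^sub>R w))) \<le> (\<integral>\<^sup>+\<tau>. indicator {t..s} \<tau> * ennreal (norm (G (\<tau> *\<^sub>R w))) \<partial>lborel) \<and>
    ennreal \<bar>ln (norm (f (s *\<^sub>R w))) - ln (norm (f (t *\<^sub>R w)))\<bar> \<le> 2 * (\<integral>\<^sup>+\<tau>. indicator {t..s} \<tau> * log_density (\<tau> *\<^sub>R w) \<partial>lborel)"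
proof -
  \<comment> \<open>The \<open>+ 3\<close> keeps \<open>R j\<close> strictly above 1/2, as
    \<open>AE_radial_aux\<close> requires.\<close>
  define R where "R j = 1 - 1 / (real j + 3)" for j :: nat
  have R: "1/2 < R j" "R j < 1" for j by (auto simp: R_def field_simps)
  have "AE w in sphere_measure. \<forall>j. \<forall>t s. 1/2 \<le> t \<and> t < s \<and> s < R j \<longrightarrow>
    ennreal (norm (f (s *\<^sub>R w) - f (t *\<^sub>R w))) \<le> (\<integral>\<^sup>+\<tau>. indicator {t..s} \<tau> * ennreal (norm (G (\<tau> *\<^sub>R w))) \<partial>lborel) \<and>
    ennreal \<bar>ln (norm (f (s *\<^sub>R w))) - ln (norm (f (t *\<^sub>R w)))\<bar> \<le> 2 * (\<integral>\<^sup>+\<tau>. indicator {t..s} \<tau> * log_density (\<tau> *\<^sub>R w) \<partial>lborel)"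
    unfolding AE_all_countable using AE_radial_aux[OF nz R] by blast
  then show ?thesis
  proof eventually_elim
    case (elim w)
    have ex: "\<exists>j. s < R j" if s: "s < 1" for s
    proof -
      obtain j :: nat where j: "1 / (1 - s) < real j" using reals_Archimedean2 by blast
      have "1 / (real j + 3) < 1 - s"
      proof -
        have "1 < real j * (1 - s)" using j s by (simp add: field_simps)
        also have "\<dots> \<le> (real j + 3) * (1 - s)" using s by (intro mult_right_mono) auto
        finally show ?thesis using s by (simp add: field_simps)
      qed
      then have "s < R j" by (simp add: R_def)
      then show ?thesis ..
    qed
    show ?case
    proof (intro allI impI)
      fix t s :: real assume ts: "1/2 \<le> t \<and> t < s \<and> s < 1"
      obtain j where "s < R j" using ex ts by blast
      with ts elim show "ennreal (norm (f (s *\<^sub>R w) - f (t *\<^sub>R w))) \<le> (\<integral>\<^sup>+\<tau>. indicator {t..s} \<tau> * ennreal (norm (G (\<tau> *\<^sub>R w))) \<partial>lborel) \<and>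
        ennreal \<bar>ln (norm (f (s *\<^sub>R w))) - ln (norm (f (t *\<^sub>R w)))\<bar> \<le> 2 * (\<integral>\<^sup>+\<tau>. indicator {t..s} \<tau> * log_density (\<tau> *\<^sub>R w) \<partial>lborel)"
        by blast
    qed
  qed
qed

end

subsection \<open>Radial limits\<close>

text \<open>The radii 1/2, 2/3, 3/4 and so on; the \<open>+ 2\<close> starts them where the radial
  estimates begin.\<close>

definition radius :: "nat \<Rightarrow> real" where
  "radius k = 1 - 1 / (real k + 2)"

lemma radius_bounds: "1/2 \<le> radius k" "radius k < 1"
  by (auto simp: radius_def field_simps)

lemma radius_tendsto: "radius \<longlonglongrightarrow> 1"
proof -
  have "(\<lambda>k. 1 / real (k + 2)) \<longlonglongrightarrow> 0"
    using LIMSEQ_ignore_initial_segment[OF lim_1_over_n, of 2] by simp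
  then have "(\<lambda>k. 1 - 1 / real (k + 2)) \<longlonglongrightarrow> 1 - 0"
    by (intro tendsto_diff tendsto_const)
  then show ?thesis by (simp add: radius_def[abs_def] add.commute)
qed

lemma radius_tendsto_at_left: "filterlim radius (at_left 1) sequentially"
  unfolding filterlim_at using radius_tendsto radius_bounds(2) radius_bounds(2)[THEN less_imp_neq]
  by (auto intro!: always_eventually)

lemma ex_radius_greater: "b < 1 \<Longrightarrow> \<exists>k. b < radius k"
  using order_tendstoD(1)[OF radius_tendsto, of b] by (auto simp: eventually_sequentially)

lemma radius_mono: "k \<le> l \<Longrightarrow> radius k \<le> radius l"
  by (simp add: radius_def frac_le)

lemma tendsto_at_left_Cauchy:
  fixes F :: "real \<Rightarrow> 'b::banach"
  assumes "\<And>\<epsilon>. \<epsilon> > 0 \<Longrightarrow> \<exists>b<1. \<forall>s t. b < s \<and> s < 1 \<and> b < t \<and> t < 1 \<longrightarrow> norm (F s - F t) \<le> \<epsilon>"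
  shows "\<exists>l. (F \<longlongrightarrow> l) (at_left 1)"
proof -
  have "Cauchy (\<lambda>k. F (radius k))"
  proof (rule CauchyI)
    fix e :: real assume "e > 0"
    then obtain b where b: "b < 1" "\<forall>s t. b < s \<and> s < 1 \<and> b < t \<and> t < 1 \<longrightarrow> norm (F s - F t) \<le> e / 2"
      using assms[of "e / 2"] by auto
    obtain k where "b < radius k" using ex_radius_greater[OF b(1)] ..
    then have "norm (F (radius i) - F (radius j)) < e" if "i \<ge> k" "j \<ge> k" for i j
      using b(2)[rule_format, of "radius i" "radius j"] radius_mono[OF that(1)] radius_mono[OF that(2)] radius_bounds \<open>e > 0\<close> by force
    then show "\<exists>M. \<forall>m\<ge>M. \<forall>n\<ge>M. norm (F (radius m) - F (radius n)) < e" by blast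
  qed
  then obtain l where l: "(\<lambda>k. F (radius k)) \<longlonglongrightarrow> l"
    using Cauchy_convergent convergent_def by blast
  have "(F \<longlongrightarrow> l) (at_left 1)"
  proof (rule tendstoI)
    fix e :: real assume "e > 0"
    then obtain b where b: "b < 1" "\<forall>s t. b < s \<and> s < 1 \<and> b < t \<and> t < 1 \<longrightarrow> norm (F s - F t) \<le> e / 2"
      using assms[of "e / 2"] by auto
    have "dist (F s) l < e" if s: "b < s" "s < 1" for s
    proof -
      have "(\<lambda>k. norm (F s - F (radius k))) \<longlonglongrightarrow> norm (F s - l)"
        by (intro tendsto_intros l)
      moreover have "\<forall>\<^sub>F k in sequentially. norm (F s - F (radius k)) \<le> e / 2"
        using order_tendstoD(1)[OF radius_tendsto b(1)]
        by eventually_elim (use b(2) s radius_bounds in auto)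
      ultimately have "norm (F s - l) \<le> e / 2"
        by (rule tendsto_upperbound) simp
      then show ?thesis using \<open>e > 0\<close> by (simp add: dist_norm)
    qed
    then show "\<forall>\<^sub>F s in at_left 1. dist (F s) l < e"
      using b(1) by (auto simp: eventually_at_left_field)
  qed
  then show ?thesis ..
qed

lemma ex_rat_sequence_Ioo:
  fixes s :: real
  assumes "r < s" "s < 1"
  obtains q :: "nat \<Rightarrow> rat" where "\<And>i. r < of_rat (q i)" "\<And>i. of_rat (q i) < (1::real)" "(\<lambda>i. of_rat (q i)) \<longlonglongrightarrow> s"
proof -
  have "\<exists>q. s < of_rat q \<and> of_rat q < s + (1 - s) / real (Suc i)" for i
    using assms by (intro of_rat_dense) simp
  then obtain q where q: "\<And>i. s < of_rat (q i)" "\<And>i. of_rat (q i) < s + (1 - s) / real (Suc i)"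
    by metis
  have "(\<lambda>i. s + (1 - s) * (1 / real (Suc i))) \<longlonglongrightarrow> s + (1 - s) * 0"
    by (intro tendsto_intros LIMSEQ_Suc[OF lim_1_over_n])
  then have up: "(\<lambda>i. s + (1 - s) / real (Suc i)) \<longlonglongrightarrow> s" by simp
  show ?thesis
  proof (rule that[of q])
    show "r < of_rat (q i)" for i using q(1)[of i] assms by linarith
    show "of_rat (q i) < (1::real)" for i
    proof -
      have "(1 - s) / real (Suc i) \<le> (1 - s) / 1" using assms by (intro divide_left_mono) auto
      then have "(1 - s) / real (Suc i) \<le> 1 - s" by (simp only: div_by_1)
      then show ?thesis using q(2)[of i] by linarith
    qed
    show "(\<lambda>i. of_rat (q i)) \<longlonglongrightarrow> s"
      by (rule tendsto_sandwich[OF _ _ tendsto_const up]) (use q in \<open>auto intro!: always_eventually less_imp_le\<close>)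
  qed
qed

text \<open>By continuity, rational radii decide the Cauchy condition. The existence of a radial
  limit thereby becomes a condition with countable quantifiers, and the set of directions where it
  holds is Borel.\<close>

lemma tendsto_at_left_iff_rational_Cauchy:
  fixes F :: "real \<Rightarrow> 'b::banach"
  assumes F: "continuous_on {0<..<1} F"
  shows "(\<exists>l. (F \<longlongrightarrow> l) (at_left 1)) \<longleftrightarrow>
    (\<forall>j::nat. \<exists>k::nat. \<forall>p q::rat. radius k \<le> of_rat p \<and> of_rat p < (1::real) \<and> radius k \<le> of_rat q \<and> of_rat q < (1::real)
      \<longrightarrow> norm (F (of_rat p) - F (of_rat q)) \<le> 1 / real (Suc j))" (is "?L \<longleftrightarrow> ?R")
proof
  assume ?L
  then obtain l where l: "(F \<longlongrightarrow> l) (at_left 1)" ..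
  show ?R
  proof
    fix j :: nat
    have "\<forall>\<^sub>F s in at_left 1. dist (F s) l < 1 / (2 * real (Suc j))"
      using l by (rule tendstoD) simp
    then obtain b where b: "b < 1" "\<And>s. b < s \<Longrightarrow> s < 1 \<Longrightarrow> dist (F s) l < 1 / (2 * real (Suc j))"
      unfolding eventually_at_left_field by blast
    obtain k where k: "b < radius k" using ex_radius_greater[OF b(1)] ..
    have "norm (F s - F t) \<le> 1 / real (Suc j)" if "radius k \<le> s" "s < 1" "radius k \<le> t" "t < 1" for s t
    proof -
      have "norm (F s - F t) \<le> dist (F s) l + dist (F t) l" unfolding dist_norm by norm
      also have "\<dots> \<le> 1 / (2 * real (Suc j)) + 1 / (2 * real (Suc j))"
        using b(2)[of s] b(2)[of t] that k by (intro add_mono) auto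
      also have "\<dots> = 1 / real (Suc j)" by (simp add: field_simps)
      finally show ?thesis .
    qed
    then show "\<exists>k::nat. \<forall>p q::rat. radius k \<le> of_rat p \<and> of_rat p < (1::real) \<and> radius k \<le> of_rat q \<and> of_rat q < (1::real)
      \<longrightarrow> norm (F (of_rat p) - F (of_rat q)) \<le> 1 / real (Suc j)" by blast
  qed
next
  assume R: ?R
  show ?L
  proof (rule tendsto_at_left_Cauchy)
    fix \<epsilon> :: real assume "\<epsilon> > 0"
    then obtain j where j: "1 / real (Suc j) < \<epsilon>"
      using reals_Archimedean by (auto simp: inverse_eq_divide)
    obtain k where k: "\<And>p q::rat. radius k \<le> of_rat p \<Longrightarrow> of_rat p < (1::real) \<Longrightarrow> radius k \<le> of_rat q \<Longrightarrow> of_rat q < (1::real)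
      \<Longrightarrow> norm (F (of_rat p) - F (of_rat q)) \<le> 1 / real (Suc j)"
      using R[THEN spec, of j] by blast
    have "norm (F s - F t) \<le> \<epsilon>" if st: "radius k < s" "s < 1" "radius k < t" "t < 1" for s t
    proof -
      obtain p where p: "\<And>i. radius k < of_rat (p i)" "\<And>i. of_rat (p i) < (1::real)" "(\<lambda>i. of_rat (p i)) \<longlonglongrightarrow> s"
        using ex_rat_sequence_Ioo[OF st(1,2)] by blast
      obtain q where q: "\<And>i. radius k < of_rat (q i)" "\<And>i. of_rat (q i) < (1::real)" "(\<lambda>i. of_rat (q i)) \<longlonglongrightarrow> t"
        using ex_rat_sequence_Ioo[OF st(3,4)] by blast
      have conv: "(\<lambda>i. F (x i)) \<longlonglongrightarrow> F y" if "x \<longlonglongrightarrow> y" "y \<in> {0<..<1}" "\<And>i. x i \<in> {0<..<1}" for x y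
        using F that by (auto simp: continuous_on_sequentially comp_def)
      have "radius k > 0" using radius_bounds(1)[of k] by linarith
      then have "of_rat (p i) \<in> {0<..<1::real}" "of_rat (q i) \<in> {0<..<1::real}" "s \<in> {0<..<1}" "t \<in> {0<..<1}" for i
        unfolding greaterThanLessThan_iff using p(1,2)[of i] q(1,2)[of i] st by (meson less_trans)+
      then have "(\<lambda>i. F (of_rat (p i))) \<longlonglongrightarrow> F s" "(\<lambda>i. F (of_rat (q i))) \<longlonglongrightarrow> F t"
        by (intro conv p(3) q(3); blast)+
      then have "(\<lambda>i. norm (F (of_rat (p i)) - F (of_rat (q i)))) \<longlonglongrightarrow> norm (F s - F t)"
        by (intro tendsto_intros)
      then have "norm (F s - F t) \<le> 1 / real (Suc j)"
        by (rule tendsto_upperbound) (intro always_eventually allI k less_imp_le p(1,2) q(1,2), simp)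
      then show ?thesis using j by linarith
    qed
    then show "\<exists>b<1. \<forall>s t. b < s \<and> s < 1 \<and> b < t \<and> t < 1 \<longrightarrow> norm (F s - F t) \<le> \<epsilon>"
      using radius_bounds(2)[of k] by blast
  qed
qed

lemma continuous_on_ray:
  fixes f :: "'a::real_normed_vector \<Rightarrow> 'b::topological_space"
  assumes f: "continuous_on (ball 0 1) f" and w: "norm w = 1"
  shows "continuous_on {0<..<1} (\<lambda>s. f (s *\<^sub>R w))"
  by (rule continuous_on_compose2[OF f]) (use w in \<open>auto intro!: continuous_intros\<close>)

text \<open>Off the set of convergence \<open>Lim\<close> takes one and the same unspecified value, so \<open>boundary_map f\<close> is constant there.\<close>

lemma borel_measurable_boundary_map:
  fixes f :: "real^'n \<Rightarrow> real^'n"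
  assumes f: "continuous_on (ball 0 1) f"
  shows "boundary_map f \<in> borel_measurable sphere_measure"
proof -
  define g where "g x = indicator (ball 0 1) x *\<^sub>R f x" for x
  have g [measurable]: "g \<in> borel_measurable borel"
    unfolding g_def using f by (intro borel_measurable_continuous_on_indicator) auto
  define P where "P w \<longleftrightarrow> (\<forall>j::nat. \<exists>k::nat. \<forall>p q::rat. radius k \<le> of_rat p \<and> of_rat p < (1::real) \<and> radius k \<le> of_rat q \<and> of_rat q < (1::real)
      \<longrightarrow> norm (g (of_rat p *\<^sub>R w) - g (of_rat q *\<^sub>R w)) \<le> 1 / real (Suc j))" for w
  have [measurable]: "Measurable.pred borel P"
    unfolding P_def by measurable
  define c where "c = (THE l :: real^'n. False)"
  define b where "b w = (if P w then lim (\<lambda>i. g (radius i *\<^sub>R w)) else c)" for w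
  have "b \<in> borel_measurable borel"
    unfolding b_def by measurable
  then have "b \<in> borel_measurable sphere_measure"
    by (rule borel_measurable_sphere_measure)
  moreover have "boundary_map f w = b w" if "w \<in> space sphere_measure" for w
  proof -
    have w: "norm w = 1" using that by (simp add: space_sphere_measure)
    have eq: "g (s *\<^sub>R w) = f (s *\<^sub>R w)" if "0 < s" "s < 1" for s
      using w that by (simp add: g_def)
    have rk: "0 < radius k" for k using radius_bounds(1)[of k] by linarith
    have P: "(\<exists>l. ((\<lambda>s. f (s *\<^sub>R w)) \<longlongrightarrow> l) (at_left 1)) \<longleftrightarrow> P w"
    proof -
      have e: "g (of_rat p *\<^sub>R w) = f (of_rat p *\<^sub>R w)" if "radius k \<le> of_rat p" "of_rat p < (1::real)" for k p
        using eq[of "of_rat p"] rk[of k] that by linarith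
      have "(radius k \<le> of_rat p \<and> of_rat p < (1::real) \<and> radius k \<le> of_rat q \<and> of_rat q < (1::real)
          \<longrightarrow> norm (g (of_rat p *\<^sub>R w) - g (of_rat q *\<^sub>R w)) \<le> 1 / real (Suc j)) \<longleftrightarrow>
        (radius k \<le> of_rat p \<and> of_rat p < (1::real) \<and> radius k \<le> of_rat q \<and> of_rat q < (1::real)
          \<longrightarrow> norm (f (of_rat p *\<^sub>R w) - f (of_rat q *\<^sub>R w)) \<le> 1 / real (Suc j))" for j k p q
        using e[of k p] e[of k q] by presburger
      then show ?thesis
        unfolding tendsto_at_left_iff_rational_Cauchy[OF continuous_on_ray[OF f w]] P_def by (simp only:)
    qed
    show ?thesis
    proof (cases "P w")
      case True
      then obtain l where l: "((\<lambda>s. f (s *\<^sub>R w)) \<longlongrightarrow> l) (at_left 1)" using P by blast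
      have "(\<lambda>i. f (radius i *\<^sub>R w)) \<longlonglongrightarrow> l"
        by (rule filterlim_compose[OF l radius_tendsto_at_left])
      then have "(\<lambda>i. g (radius i *\<^sub>R w)) \<longlonglongrightarrow> l"
        using eq rk radius_bounds(2) by simp
      then have "b w = l" using True by (simp add: b_def limI)
      moreover have "boundary_map f w = l"
        unfolding boundary_map_def by (rule tendsto_Lim[OF _ l]) simp
      ultimately show ?thesis by simp
    next
      case False
      then have "(\<lambda>l. ((\<lambda>s. f (s *\<^sub>R w)) \<longlongrightarrow> l) (at_left 1)) = (\<lambda>l. False)" using P by auto
      then show ?thesis using False by (simp add: boundary_map_def t2_space_class.Lim_def b_def c_def)
    qed
  qed
  ultimately show ?thesis
    by (simp cong: measurable_cong)
qed

context distortion_map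
begin

text \<open>A finite integral of \<open>log_density\<close> bounds
  \<open>ln (norm (f (s *\<^sub>R w)))\<close> by a constant \<open>U\<close> along the ray. The
  upper bound \<open>exp U\<close> for \<open>norm (f (s *\<^sub>R w))\<close> converts
  \<open>log_density\<close> into a majorant of \<open>norm (G (s *\<^sub>R w))\<close>, whose tails
  vanish, so \<open>f\<close> is Cauchy along the ray; the lower bound \<open>exp (- U)\<close>
  keeps the limit away from 0 and permits taking logarithms in the limit.\<close>

lemma radial_limit:
  assumes nz: "\<And>x. x \<in> ball 0 1 \<Longrightarrow> f x \<noteq> 0" and w: "norm w = 1"
    and rad: "\<forall>t s. 1/2 \<le> t \<and> t < s \<and> s < 1 \<longrightarrow>
      ennreal (norm (f (s *\<^sub>R w) - f (t *\<^sub>R w))) \<le> (\<integral>\<^sup>+\<tau>. indicator {t..s} \<tau> * ennreal (norm (G (\<tau> *\<^sub>R w))) \<partial>lborel) \<and>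
      ennreal \<bar>ln (norm (f (s *\<^sub>R w))) - ln (norm (f (t *\<^sub>R w)))\<bar> \<le> 2 * (\<integral>\<^sup>+\<tau>. indicator {t..s} \<tau> * log_density (\<tau> *\<^sub>R w) \<partial>lborel)"
    and fin: "(\<integral>\<^sup>+\<tau>. indicator {1/2..<1} \<tau> * log_density (\<tau> *\<^sub>R w) \<partial>lborel) < \<infinity>"
  obtains "((\<lambda>r. f (r *\<^sub>R w)) \<longlongrightarrow> boundary_map f w) (at_left 1)" "boundary_map f w \<noteq> 0"
    "\<And>t. 1/2 \<le> t \<Longrightarrow> t < 1 \<Longrightarrow> ennreal \<bar>ln (norm (boundary_map f w)) - ln (norm (f (t *\<^sub>R w)))\<bar>
      \<le> 2 * (\<integral>\<^sup>+\<tau>. indicator {t..<1} \<tau> * log_density (\<tau> *\<^sub>R w) \<partial>lborel)"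
proof -
  define A where "A t = (\<integral>\<^sup>+\<tau>. indicator {t..<1} \<tau> * log_density (\<tau> *\<^sub>R w) \<partial>lborel)" for t
  obtain a where a: "A (1/2) = ennreal a" "a \<ge> 0"
    using fin by (cases "A (1/2)" rule: ennreal_cases) (auto simp: A_def)
  have le_A: "(\<integral>\<^sup>+\<tau>. indicator {t..s} \<tau> * log_density (\<tau> *\<^sub>R w) \<partial>lborel) \<le> A t" if "s < 1" for s t
    unfolding A_def using that by (intro nn_integral_mono) (auto split: split_indicator)
  have pos: "norm (f (s *\<^sub>R w)) > 0" if "1/2 \<le> s" "s < 1" for s
    using nz[of "s *\<^sub>R w"] w that by auto
  define U where "U = \<bar>ln (norm (f ((1/2) *\<^sub>R w)))\<bar> + 2 * a"
  have lnU: "\<bar>ln (norm (f (s *\<^sub>R w)))\<bar> \<le> U" if s: "1/2 \<le> s" "s < 1" for s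
  proof (cases "s = 1/2")
    case True
    show ?thesis unfolding True U_def using a by simp
  next
    case False
    then have "ennreal \<bar>ln (norm (f (s *\<^sub>R w))) - ln (norm (f ((1/2) *\<^sub>R w)))\<bar> \<le> 2 * (\<integral>\<^sup>+\<tau>. indicator {1/2..s} \<tau> * log_density (\<tau> *\<^sub>R w) \<partial>lborel)"
      using rad s by auto
    also have "\<dots> \<le> 2 * ennreal a" unfolding a(1)[symmetric] by (intro mult_left_mono le_A s) simp
    also have "\<dots> = ennreal (2 * a)" using a by (simp add: ennreal_mult')
    finally have "\<bar>ln (norm (f (s *\<^sub>R w))) - ln (norm (f ((1/2) *\<^sub>R w)))\<bar> \<le> 2 * a" using a by simp
    then show ?thesis by (simp add: U_def)
  qed
  have fU: "norm (f (s *\<^sub>R w)) \<le> exp U" "exp (- U) \<le> norm (f (s *\<^sub>R w))" if s: "1/2 \<le> s" "s < 1" for s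
  proof -
    have "exp (ln (norm (f (s *\<^sub>R w)))) \<le> exp U" "exp (- U) \<le> exp (ln (norm (f (s *\<^sub>R w))))"
      using lnU[OF s] by auto
    then show "norm (f (s *\<^sub>R w)) \<le> exp U" "exp (- U) \<le> norm (f (s *\<^sub>R w))"
      by (simp_all only: exp_ln[OF pos[OF s]])
  qed
  have diff: "ennreal (norm (f (s *\<^sub>R w) - f (t *\<^sub>R w))) \<le> ennreal (exp U) * A b" if "1/2 \<le> b" "b \<le> t" "t < s" "s < 1" for b s t
  proof -
    have "ennreal (norm (f (s *\<^sub>R w) - f (t *\<^sub>R w))) \<le> (\<integral>\<^sup>+\<tau>. indicator {t..s} \<tau> * ennreal (norm (G (\<tau> *\<^sub>R w))) \<partial>lborel)"
      using rad that by auto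
    also have "\<dots> \<le> (\<integral>\<^sup>+\<tau>. ennreal (exp U) * (indicator {b..<1} \<tau> * log_density (\<tau> *\<^sub>R w)) \<partial>lborel)"
    proof (rule nn_integral_mono)
      fix \<tau>
      show "indicator {t..s} \<tau> * ennreal (norm (G (\<tau> *\<^sub>R w))) \<le> ennreal (exp U) * (indicator {b..<1} \<tau> * log_density (\<tau> *\<^sub>R w))"
      proof (cases "\<tau> \<in> {t..s}")
        case True
        then have \<tau>: "1/2 \<le> \<tau>" "\<tau> < 1" "b \<le> \<tau>" using that by auto
        have "norm (G (\<tau> *\<^sub>R w)) = norm (f (\<tau> *\<^sub>R w)) * (norm (G (\<tau> *\<^sub>R w)) / norm (f (\<tau> *\<^sub>R w)))"
          using pos[OF \<tau>(1,2)] by simp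
        also have "\<dots> \<le> exp U * (norm (G (\<tau> *\<^sub>R w)) / norm (f (\<tau> *\<^sub>R w)))"
          using fU(1)[OF \<tau>(1,2)] by (intro mult_right_mono) auto
        finally have "ennreal (norm (G (\<tau> *\<^sub>R w))) \<le> ennreal (exp U) * ennreal (norm (G (\<tau> *\<^sub>R w)) / norm (f (\<tau> *\<^sub>R w)))"
          by (simp add: ennreal_mult'[symmetric] ennreal_leI)
        then show ?thesis using True \<tau> w by (simp add: log_density_def)
      qed simp
    qed
    also have "\<dots> = ennreal (exp U) * A b"
      unfolding A_def by (rule nn_integral_cmult) measurable
    finally show ?thesis .
  qed
  have A0: "(\<lambda>k. A (radius k)) \<longlonglongrightarrow> 0"
  proof -
    define M where "M = density lborel (\<lambda>\<tau>. indicator {1/2..<1} \<tau> * log_density (\<tau> *\<^sub>R w))"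
    have eA: "emeasure M {radius k..<1} = A (radius k)" for k
      unfolding M_def A_def using radius_bounds(1)[of k]
      by (subst emeasure_density) (auto intro!: nn_integral_cong split: split_indicator)
    have "(\<lambda>k. emeasure M {radius k..<1}) \<longlonglongrightarrow> emeasure M (\<Inter>k. {radius k..<1})"
    proof (rule Lim_emeasure_decseq)
      show "decseq (\<lambda>k. {radius k..<1})"
        using radius_mono by (fastforce simp: decseq_def)
      show "emeasure M {radius k..<1} \<noteq> \<infinity>" for k
      proof -
        have "A (radius k) \<le> A (1/2)"
          unfolding A_def using radius_bounds(1)[of k] by (intro nn_integral_mono) (auto split: split_indicator)
        then show ?thesis using a by (auto simp: eA top_unique)
      qed
    qed (auto simp: M_def)
    also have "(\<Inter>k. {radius k..<1}) = {}"
    proof -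
      have "\<exists>k. \<not> radius k \<le> x" if "x < 1" for x
        using ex_radius_greater[OF that] by (auto simp: not_le)
      then show ?thesis by fastforce
    qed
    finally show ?thesis by (simp add: eA)
  qed
  have "\<exists>l. ((\<lambda>r. f (r *\<^sub>R w)) \<longlongrightarrow> l) (at_left 1)"
  proof (rule tendsto_at_left_Cauchy)
    fix \<epsilon> :: real assume \<epsilon>: "\<epsilon> > 0"
    have "\<forall>\<^sub>F k in sequentially. A (radius k) < ennreal (\<epsilon> / exp U)"
      using A0 \<epsilon> by (intro order_tendstoD(2)) auto
    then obtain k where k: "A (radius k) < ennreal (\<epsilon> / exp U)"
      by (auto simp: eventually_sequentially)
    have ts: "norm (f (s *\<^sub>R w) - f (t *\<^sub>R w)) \<le> \<epsilon>" if "radius k < t" "t < s" "s < 1" for s t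
    proof -
      have "ennreal (norm (f (s *\<^sub>R w) - f (t *\<^sub>R w))) \<le> ennreal (exp U) * A (radius k)"
        using radius_bounds(1)[of k] that by (intro diff) auto
      also have "\<dots> \<le> ennreal (exp U) * ennreal (\<epsilon> / exp U)" using k by (intro mult_left_mono) auto
      also have "\<dots> = ennreal \<epsilon>" using \<epsilon> by (simp add: ennreal_mult'[symmetric])
      finally show ?thesis using \<epsilon> by simp
    qed
    have "norm (f (s *\<^sub>R w) - f (t *\<^sub>R w)) \<le> \<epsilon>" if "radius k < t" "t < 1" "radius k < s" "s < 1" for s t
      using ts[of s t] ts[of t s] that \<epsilon> by (cases s t rule: linorder_cases) (auto simp: norm_minus_commute)
    then show "\<exists>b<1. \<forall>s t. b < s \<and> s < 1 \<and> b < t \<and> t < 1 \<longrightarrow> norm (f (s *\<^sub>R w) - f (t *\<^sub>R w)) \<le> \<epsilon>"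
      using radius_bounds(2)[of k] by blast
  qed
  then obtain l where l: "((\<lambda>r. f (r *\<^sub>R w)) \<longlongrightarrow> l) (at_left 1)" ..
  have bl: "boundary_map f w = l"
    unfolding boundary_map_def by (rule tendsto_Lim[OF _ l]) simp
  have ev: "\<forall>\<^sub>F s in at_left 1. t < s \<and> s < 1" if "t < 1" for t :: real
    using that by (auto simp: eventually_at_left_field intro!: exI[of _ t])
  have "exp (- U) \<le> norm l"
  proof (rule tendsto_lowerbound)
    show "((\<lambda>r. norm (f (r *\<^sub>R w))) \<longlongrightarrow> norm l) (at_left 1)" by (intro tendsto_intros l)
    show "\<forall>\<^sub>F s in at_left 1. exp (- U) \<le> norm (f (s *\<^sub>R w))"
      using ev[of "1/2"] by (simp, elim eventually_mono) (use fU(2) in auto)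
  qed simp
  then have l0: "l \<noteq> 0" by (metis exp_gt_zero norm_zero not_less)
  show ?thesis
  proof (rule that)
    show "((\<lambda>r. f (r *\<^sub>R w)) \<longlongrightarrow> boundary_map f w) (at_left 1)" "boundary_map f w \<noteq> 0"
      unfolding bl by (rule l, rule l0)
    fix t :: real assume t: "1/2 \<le> t" "t < 1"
    have "ennreal \<bar>ln (norm l) - ln (norm (f (t *\<^sub>R w)))\<bar> \<le> 2 * A t"
    proof (rule tendsto_upperbound)
      show "((\<lambda>s. ennreal \<bar>ln (norm (f (s *\<^sub>R w))) - ln (norm (f (t *\<^sub>R w)))\<bar>) \<longlongrightarrow> ennreal \<bar>ln (norm l) - ln (norm (f (t *\<^sub>R w)))\<bar>) (at_left 1)"
        using l0 by (intro tendsto_ennrealI tendsto_intros l) auto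
      show "\<forall>\<^sub>F s in at_left 1. ennreal \<bar>ln (norm (f (s *\<^sub>R w))) - ln (norm (f (t *\<^sub>R w)))\<bar> \<le> 2 * A t"
        using ev[OF t(2)]
      proof eventually_elim
        case (elim s)
        then have "ennreal \<bar>ln (norm (f (s *\<^sub>R w))) - ln (norm (f (t *\<^sub>R w)))\<bar> \<le> 2 * (\<integral>\<^sup>+\<tau>. indicator {t..s} \<tau> * log_density (\<tau> *\<^sub>R w) \<partial>lborel)"
          using rad t by auto
        also have "\<dots> \<le> 2 * A t" using elim by (intro mult_left_mono le_A) auto
        finally show ?case .
      qed
    qed simp
    then show "ennreal \<bar>ln (norm (boundary_map f w)) - ln (norm (f (t *\<^sub>R w)))\<bar> \<le> 2 * (\<integral>\<^sup>+\<tau>. indicator {t..<1} \<tau> * log_density (\<tau> *\<^sub>R w) \<partial>lborel)"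
      unfolding bl A_def .
  qed
qed

end

subsection \<open>Carleson boxes and mean oscillation\<close>

text \<open>A weighted Young inequality with constant 1: either \<open>p\<close> is below the dual
  weight, or raising the opposite inequality to the power \<open>n - 1\<close> gives
  \<open>1 \<le> p^(n - 1) * w powr b\<close>.\<close>

lemma le_power_weight:
  fixes p w b :: real
  assumes p: "p \<ge> 0" and w: "w > 0" and n: "n \<ge> 2"
  shows "p \<le> p ^ n * w powr b + w powr (- (b / (real n - 1)))"
proof (cases "p \<le> w powr (- (b / (real n - 1)))")
  case True
  then show ?thesis using p by (simp add: add_increasing)
next
  case False
  then have big: "w powr (- (b / (real n - 1))) \<le> p" by simp
  have n1: "real n - 1 = real (n - 1)" "real n - 1 \<noteq> 0" using n by auto
  have "w powr (- b) = w powr (- (b / (real n - 1)) * (real n - 1))" using n1(2) by simp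
  also have "\<dots> = (w powr (- (b / (real n - 1)))) powr real (n - 1)" by (simp add: powr_powr n1(1))
  also have "\<dots> = (w powr (- (b / (real n - 1)))) ^ (n - 1)" using w by (simp add: powr_realpow)
  also have "\<dots> \<le> p ^ (n - 1)" using big by (intro power_mono) auto
  finally have "w powr (- b) * w powr b \<le> p ^ (n - 1) * w powr b" by (intro mult_right_mono) auto
  then have "1 \<le> p ^ (n - 1) * w powr b" using w by (simp add: powr_minus)
  then have "p * 1 \<le> p * (p ^ (n - 1) * w powr b)" using p by (rule mult_left_mono)
  moreover have "p * p ^ (n - 1) = p ^ n" using n by (cases n) auto
  ultimately have "p \<le> p ^ n * w powr b" by (simp add: mult.assoc[symmetric])
  then show ?thesis by (simp add: add_increasing2)
qed

lemma power_powr_swap: "x > 0 \<Longrightarrow> (x ^ k) powr b = (x powr b) ^ k"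
  for x b :: real
  by (induction k) (auto simp: powr_mult)

lemma emeasure_le_multiplicity:
  fixes f :: "real^'n \<Rightarrow> real^'n"
  assumes "multiplicity_condition a f"
  obtains C where "C > 0"
    "\<And>(E :: (real^'n) set) r x y. 0 < r \<Longrightarrow> r < 1 \<Longrightarrow> x \<in> ball 0 1 \<Longrightarrow> E \<subseteq> hball x r \<Longrightarrow>
      emeasure (count_space UNIV) {z \<in> E. f z = y} \<le> ennreal (C / (1 - r) powr a)"
proof -
  obtain C where C: "C > 0" "\<And>r. 0 < r \<Longrightarrow> r < 1 \<Longrightarrow> (SUP x \<in> ball 0 1. multiplicity_on f (hball x r)) \<le> ennreal (C / (1 - r) powr a)"
    using assms by (auto simp: multiplicity_condition_def)
  show ?thesis
  proof (rule that[OF C(1)])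
    fix E :: "(real^'n) set" and r x y assume r: "0 < r" "r < (1::real)" and x: "x \<in> ball 0 1" and E: "E \<subseteq> hball x r"
    have "emeasure (count_space UNIV) {z \<in> E. f z = y} \<le> emeasure (count_space UNIV) {z \<in> hball x r. f z = y}"
      using E by (intro emeasure_mono) auto
    also have "\<dots> \<le> multiplicity_on f (hball x r)"
      unfolding multiplicity_on_def by (rule SUP_upper) simp
    also have "\<dots> \<le> (SUP x \<in> ball 0 1. multiplicity_on f (hball x r))"
      using x by (rule SUP_upper)
    finally show "emeasure (count_space UNIV) {z \<in> E. f z = y} \<le> ennreal (C / (1 - r) powr a)"
      using C(2)[OF r] by (rule order_trans)
  qed
qed

section \<open>Layers of a Carleson box under (M) and (Min)\<close>

locale miniowitz_map = distortion_map f G K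
  for f :: "real^'n \<Rightarrow> real^'n" and G :: "real^'n \<Rightarrow> real^'n^'n" and K :: real +
  fixes C m :: "nat \<Rightarrow> real \<Rightarrow> real" and a :: real
  assumes dim: "CARD('n) \<ge> 2"
    and miniowitz: "miniowitz_class C m K f"
    and exponent: "0 \<le> a" "a < real CARD('n) - 1"
    and multiplicity: "multiplicity_condition a f"
begin

lemma nonzero: "x \<in> ball 0 1 \<Longrightarrow> f x \<noteq> 0"
  using miniowitz by (auto simp: miniowitz_class_def)

text \<open>\<open>osc_const + osc_slope * real k\<close> bounds the oscillation in layer
  \<open>k\<close>. It arises from \<open>miniowitz_bounds\<close> with the lower bound
  \<open>(1/2) ^ k / 392\<close> for its \<open>q\<close>: 98 comes from
  \<open>one_minus_norm_ball_aut_ge\<close>, a factor 2 from the lower end of the layer and another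
  2 from the denominator \<open>1 + T\<close>.\<close>

definition osc_const :: real where
  "osc_const = \<bar>ln (C CARD('n) K)\<bar> + m CARD('n) K * ln 392"

definition osc_slope :: real where
  "osc_slope = m CARD('n) K * ln 2"

lemma osc_nonneg: "osc_const \<ge> 0" "osc_slope \<ge> 0"
  using miniowitz by (auto simp: osc_const_def osc_slope_def miniowitz_class_def Let_def)

text \<open>In layer \<open>k\<close> the distance to the sphere exceeds
  \<open>(1/2) ^ Suc k * r\<close>, so the hyperbolic radius seen from the top of the box stays
  below \<open>1 - (1/2) ^ Suc k / 98\<close>, independently of \<open>r\<close>. This one bound
  feeds both (M) and (Min). The distance \<open>4 * r\<close> admits all directions when
  \<open>r = 1/2\<close>, since the sphere has diameter 2.\<close>

lemma layer_bounds:
  assumes w: "norm w0 = 1" "norm w = 1" and r: "0 < r" "r \<le> 1/2" and ww: "norm (w - w0) \<le> 4 * r"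
    and s: "1 - (1/2) ^ k * r \<le> s" "s < 1 - (1/2) ^ Suc k * r"
  shows "s *\<^sub>R w \<in> hball ((1 - r) *\<^sub>R w0) (1 - (1/2) ^ Suc k / 98)"
    and "\<bar>ln (norm (f (s *\<^sub>R w))) - ln (norm (f ((1 - r) *\<^sub>R w0)))\<bar> \<le> osc_const + osc_slope * real k"
proof -
  define x where "x = (1 - r) *\<^sub>R w0"
  have pk: "(1/2::real) ^ k \<le> 1" "(1/2::real) ^ Suc k > 0" by (auto simp: power_le_one)
  have s1: "1 - r \<le> s" "s < 1"
  proof -
    have "(1/2) ^ k * r \<le> 1 * r" using pk r by (intro mult_right_mono) auto
    then show "1 - r \<le> s" using s by simp
    have "(1/2) ^ Suc k * r > 0" using pk r by (intro mult_pos_pos) auto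
    then show "s < 1" using s by linarith
  qed
  have x: "x \<noteq> 0" "norm x < 1" using w r by (auto simp: x_def)
  have y: "norm (s *\<^sub>R w) < 1" using w r s1 by simp
  define T where "T = norm (ball_aut x (s *\<^sub>R w))"
  have "T < 1" unfolding T_def by (rule norm_ball_aut_less_1[OF x y])
  have T0: "T \<ge> 0" by (simp add: T_def)
  have "(1/2) ^ Suc k / 98 = (1/2) ^ Suc k * r / (98 * r)" using r by simp
  also have "\<dots> < (1 - s) / (98 * r)" using r s(2) by (intro divide_strict_right_mono) auto
  also have "\<dots> \<le> 1 - T"
    unfolding T_def x_def by (rule one_minus_norm_ball_aut_ge[OF w r s1 ww])
  finally have T: "(1/2) ^ Suc k / 98 < 1 - T" .
  then show "s *\<^sub>R w \<in> hball ((1 - r) *\<^sub>R w0) (1 - (1/2) ^ Suc k / 98)"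
    unfolding hball_def using y by (auto simp: T_def x_def)
  note mb = miniowitz_bounds[OF miniowitz x y, folded T_def]
  have q: "(1/2) ^ k / 392 \<le> (1 - T) / (1 + T)"
  proof -
    have "(1/2) ^ k / 392 = (1/2 :: real) ^ Suc k / 98 / 2" by simp
    also have "\<dots> \<le> (1 - T) / 2" using T by simp
    also have "\<dots> \<le> (1 - T) / (1 + T)" using \<open>T < 1\<close> T0 by (intro divide_left_mono) auto
    finally show ?thesis .
  qed
  have "ln ((1/2) ^ k / 392) \<le> ln ((1 - T) / (1 + T))"
    using q pk by (intro ln_mono) auto
  moreover have "ln ((1/2::real) ^ k / 392) = - (real k * ln 2 + ln 392)"
    by (simp add: ln_div ln_realpow)
  ultimately have "m CARD('n) K * (- (real k * ln 2 + ln 392)) \<le> m CARD('n) K * ln ((1 - T) / (1 + T))"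
    using mb(4) by (intro mult_left_mono) auto
  then show "\<bar>ln (norm (f (s *\<^sub>R w))) - ln (norm (f ((1 - r) *\<^sub>R w0)))\<bar> \<le> osc_const + osc_slope * real k"
    using mb(5) unfolding x_def[symmetric] osc_const_def osc_slope_def
    by (simp add: algebra_simps)
qed

text \<open>Layer \<open>k\<close> carries the weight \<open>(1/2) ^ k\<close>. The energy part of
  the estimate scales like \<open>r^(n - 1)\<close>, which \<open>emeasure_sphere_cap_ge\<close>
  bounds by the measure of the cap; the dual part is directly a multiple of that measure. Hence
  \<open>M\<close> depends on neither centre nor radius.\<close>

lemma cap_energy:
  obtains M where "M \<ge> 0"
    "\<And>w0 R r. norm w0 = 1 \<Longrightarrow> R > 0 \<Longrightarrow> r = min R (1/2) \<Longrightarrow>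
      (\<integral>\<^sup>+w. indicator (ball w0 R) w * (\<integral>\<^sup>+s. indicator {1 - r..<1} s * log_density (s *\<^sub>R w) \<partial>lborel) \<partial>sphere_measure)
      \<le> ennreal M * emeasure sphere_measure (sphere_cap w0 R)"
proof -
  let ?n = "CARD('n)"
  obtain N where N: "N > 0" "\<And>E r x y. 0 < r \<Longrightarrow> r < 1 \<Longrightarrow> x \<in> ball 0 1 \<Longrightarrow> E \<subseteq> hball x r \<Longrightarrow>
      emeasure (count_space UNIV) {z \<in> E. f z = y} \<le> ennreal (N / (1 - r) powr a)"
    using emeasure_le_multiplicity[OF multiplicity] by blast
  obtain e0 where e0: "energy_const = ennreal e0" "e0 \<ge> 0"
    using energy_const_finite by (cases energy_const rule: ennreal_cases) auto
  \<comment> \<open>\<open>a < b\<close> makes \<open>al\<close> summable, \<open>b < n - 1\<close> makes \<open>ga\<close> summable.\<close>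
  define b where "b = (a + (real ?n - 1)) / 2"
  have b: "a < b" "b < real ?n - 1" using exponent by (auto simp: b_def)
  define \<beta> where "\<beta> = b / (real ?n - 1)"
  have \<beta>: "\<beta> < 1" using b exponent by (simp add: \<beta>_def)
  \<comment> \<open>\<open>\<theta>\<close> is the growth \<open>2 powr a\<close> of the
    multiplicity per layer times the decay \<open>2 powr (- b)\<close> of the weight. Likewise
    \<open>\<eta>\<close> below is the growth \<open>2 powr \<beta>\<close> of the dual weight times
    the factor 1/2 by which the layers become thinner.\<close>
  define \<theta> :: real where "\<theta> = 2 powr (a - b)"
  have \<theta>: "0 < \<theta>" "\<theta> < 1" using b by (auto simp: \<theta>_def powr_less_one)
  define \<eta> :: real where "\<eta> = 2 powr (\<beta> - 1)"
  have \<eta>: "0 < \<eta>" "\<eta> < 1" using \<beta> by (auto simp: \<eta>_def powr_less_one)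
  define B where "B k = osc_const + osc_slope * real k" for k :: nat
  have B: "B k \<ge> 0" for k using osc_nonneg by (simp add: B_def)
  \<comment> \<open>The energy bound of layer \<open>k\<close> without its factor
    \<open>r^(n - 1)\<close>: \<open>2 ^ (?n - 1)\<close> bounds the polar weight for radii at least
    1/2, \<open>2 * B k + 3\<close> counts the shells of \<open>energy_log\<close>, and
    \<open>196 = 2 * 98\<close> comes from the hyperbolic radius
    \<open>1 - (1/2) ^ Suc k / 98\<close>. The half in \<open>ga\<close> is due to the thickness
    \<open>(1/2) ^ Suc k * r\<close> of the layer.\<close>
  define al where "al k = 2 ^ (?n - 1) * (2 * B k + 3) * e0 * N * 196 powr a * \<theta> ^ k" for k
  define ga where "ga k = \<eta> ^ k / 2" for k :: nat
  have al0: "al k \<ge> 0" for k using B[of k] e0 N \<theta> by (simp add: al_def)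
  have ga0: "ga k \<ge> 0" for k using \<eta> by (simp add: ga_def)
  have sal: "summable al"
  proof -
    \<comment> \<open>\<open>B k\<close> grows linearly, so \<open>al\<close> is a combination of
      the geometric series and its derivative; writing \<open>k\<close> as \<open>Suc k - 1\<close>
      produces the correction \<open>- 2 * osc_slope\<close>.\<close>
    have "summable (\<lambda>k. of_nat (Suc k) * \<theta> ^ k)"
      using geometric_deriv_sums[of \<theta>] \<theta> by (auto simp: sums_iff)
    moreover have "summable (\<lambda>k. \<theta> ^ k)" using \<theta> by (intro summable_geometric) auto
    ultimately have "summable (\<lambda>k. (2 ^ (?n - 1) * e0 * N * 196 powr a) *
       (2 * osc_slope * (of_nat (Suc k) * \<theta> ^ k) + (2 * osc_const + 3 - 2 * osc_slope) * \<theta> ^ k))"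
      by (intro summable_mult summable_add)
    moreover have "al = (\<lambda>k. (2 ^ (?n - 1) * e0 * N * 196 powr a) *
       (2 * osc_slope * (of_nat (Suc k) * \<theta> ^ k) + (2 * osc_const + 3 - 2 * osc_slope) * \<theta> ^ k))"
      by (simp add: fun_eq_iff al_def B_def algebra_simps)
    ultimately show ?thesis by simp
  qed
  have sga: "summable ga"
    unfolding ga_def using \<eta> by (intro summable_divide summable_geometric) auto
  define c1 where "c1 = 16 ^ ?n / unit_ball_vol (real ?n)"
  have c1: "c1 \<ge> 0" by (simp add: c1_def)
  define M where "M = suminf al * c1 + suminf ga"
  have M: "M \<ge> 0" using suminf_nonneg[OF sal al0] suminf_nonneg[OF sga ga0] c1 by (simp add: M_def)
  show ?thesis
  proof (rule that[OF M])
    fix w0 :: "real^'n" and R r :: real assume w0: "norm w0 = 1" and R: "R > 0" and r_def: "r = min R (1/2)"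
    have r: "0 < r" "r \<le> 1/2" using R by (auto simp: r_def)
    let ?D = "ball w0 R" and ?S = "emeasure sphere_measure (sphere_cap w0 R)"
    define I where "I k = {1 - (1/2) ^ k * r ..< 1 - (1/2) ^ Suc k * r}" for k
    define Q where "Q k = {z :: real^'n. norm z \<in> I k \<and> z /\<^sub>R norm z \<in> ?D}" for k
    have pk: "0 < (1/2::real) ^ k * r" "(1/2::real) ^ k * r \<le> 1/2" for k
    proof -
      show "0 < (1/2::real) ^ k * r" using r by simp
      have "(1/2::real) ^ k * r \<le> 1 * (1/2)" using r by (intro mult_mono) (auto simp: power_le_one)
      then show "(1/2::real) ^ k * r \<le> 1/2" by simp
    qed
    have Isub: "I k \<subseteq> {1/2..<1}" for k
      unfolding I_def using pk[of k] pk[of "Suc k"] by auto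
    note borel_measurable_f [measurable]
    have [measurable]: "I k \<in> sets borel" "ball (0::real^'n) 1 \<in> sets borel" for k by (simp_all add: I_def)
    have [measurable]: "?D \<in> sets borel" by simp
    have Qm [measurable]: "Q k \<in> sets borel" for k unfolding Q_def by measurable
    have len: "emeasure lborel (I k) = ennreal ((1/2) ^ Suc k * r)" for k
    proof -
      have "emeasure lborel (I k) = ennreal ((1 - (1/2) ^ Suc k * r) - (1 - (1/2) ^ k * r))"
        unfolding I_def using r by (intro emeasure_lborel_Ico) simp
      then show ?thesis by (simp add: mult_ac)
    qed
    \<comment> \<open>For \<open>R > 1/2\<close> the cap may be the whole sphere, of diameter 2, and
      then \<open>4 * r = 2\<close>.\<close>
    have close: "norm (w - w0) \<le> 4 * r" if "w \<in> ?D" "norm w = 1" for w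
    proof (cases "R \<le> 1/2")
      case True
      then show ?thesis using that R by (simp add: r_def dist_norm norm_minus_commute)
    next
      case False
      have "norm (w - w0) \<le> norm w + norm w0" by (rule norm_triangle_ineq4)
      then show ?thesis using False that w0 by (simp add: r_def)
    qed
    define x0 where "x0 = (1 - r) *\<^sub>R w0"
    have x0: "x0 \<in> ball 0 1" using w0 r by (simp add: x0_def)
    have zQ: "z \<in> hball x0 (1 - (1/2) ^ Suc k / 98)" "\<bar>ln (norm (f z)) - ln (norm (f x0))\<bar> \<le> B k"
        "norm z < 1" "1/2 \<le> norm z" "z \<in> ball 0 (1 - (1/2) ^ Suc k * r)" if z: "z \<in> Q k" for z k
    proof -
      have nz: "norm z \<in> I k" using z by (simp add: Q_def)
      then show n: "norm z < 1" "1/2 \<le> norm z" using Isub[of k] by auto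
      show "z \<in> ball 0 (1 - (1/2) ^ Suc k * r)" using nz by (simp add: I_def)
      have "norm z \<noteq> 0" using n by linarith
      then have eq: "z = norm z *\<^sub>R (z /\<^sub>R norm z)" by simp
      have "norm (z /\<^sub>R norm z) = 1" using \<open>norm z \<noteq> 0\<close> by simp
      moreover have "z /\<^sub>R norm z \<in> ?D" using z by (simp add: Q_def)
      ultimately have lb: "norm z *\<^sub>R (z /\<^sub>R norm z) \<in> hball x0 (1 - (1/2) ^ Suc k / 98)"
        "\<bar>ln (norm (f (norm z *\<^sub>R (z /\<^sub>R norm z)))) - ln (norm (f x0))\<bar> \<le> osc_const + osc_slope * real k"
        unfolding x0_def using nz by (intro layer_bounds w0 r close; simp add: I_def)+
      then show "z \<in> hball x0 (1 - (1/2) ^ Suc k / 98)" "\<bar>ln (norm (f z)) - ln (norm (f x0))\<bar> \<le> B k"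
        using eq by (simp_all add: B_def)
    qed
    have energy: "(\<integral>\<^sup>+x. indicator (Q k) x * ennreal ((norm (G x) / norm (f x)) ^ ?n) \<partial>lborel)
        \<le> ennreal ((2 * B k + 3) * (e0 * (N / ((1/2) ^ Suc k / 98) powr a)))" for k
    proof -
      have hk: "0 < 1 - (1/2::real) ^ Suc k / 98" "1 - (1/2::real) ^ Suc k / 98 < 1"
      proof -
        have "(1/2::real) ^ Suc k \<le> 1" by (rule power_le_one) auto
        then show "0 < 1 - (1/2::real) ^ Suc k / 98" by simp
      qed simp
      have "(\<integral>\<^sup>+x. indicator (Q k) x * ennreal ((norm (G x) / norm (f x)) ^ ?n) \<partial>lborel)
        \<le> ennreal (2 * B k + 3) * (energy_const * ennreal (N / ((1/2) ^ Suc k / 98) powr a))"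
      proof (rule energy_log[OF Qm _ _ B])
        show "Q k \<subseteq> ball 0 (1 - (1/2) ^ Suc k * r)" using zQ(5) by blast
        show "1 - (1/2) ^ Suc k * r < 1" using pk(1)[of "Suc k"] by simp
        show "f x \<noteq> 0 \<and> \<bar>ln (norm (f x)) - ln (norm (f x0))\<bar> \<le> B k" if "x \<in> Q k" for x
          using zQ(2,3)[OF that] nonzero by simp
        have "Q k \<subseteq> hball x0 (1 - (1/2) ^ Suc k / 98)" using zQ(1) by blast
        from N(2)[OF hk x0 this] show "emeasure (count_space UNIV) {x \<in> Q k. f x = y} \<le> ennreal (N / ((1/2) ^ Suc k / 98) powr a)" for y
          by simp
      qed
      also have "\<dots> = ennreal ((2 * B k + 3) * (e0 * (N / ((1/2) ^ Suc k / 98) powr a)))"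
      proof -
        have h: "0 \<le> 2 * B k + 3" using B[of k] by simp
        have NN: "0 \<le> N / ((1/2) ^ Suc k / 98) powr a" using N(1) by (intro divide_nonneg_nonneg) auto
        show ?thesis
          unfolding e0(1) ennreal_mult[OF h mult_nonneg_nonneg[OF e0(2) NN]] ennreal_mult[OF e0(2) NN] ..
      qed
      finally show ?thesis .
    qed
    have layer: "(\<integral>\<^sup>+z. indicator (Q k) z * (log_density z * ennreal (1 / norm z ^ (?n - 1))) \<partial>lborel)
        \<le> ennreal (r ^ (?n - 1) * al k) + ennreal (ga k) * ?S" for k
    proof -
      define w :: real where "w = (1/2) ^ k"
      have w: "w > 0" by (simp add: w_def)
      define c where "c = 2 ^ (?n - 1) * (r ^ (?n - 1) * w powr b)"
      have c: "c \<ge> 0" using r by (simp add: c_def)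
      define d where "d = w powr (- \<beta>) / r"
      have d: "d \<ge> 0" using r by (simp add: d_def)
      have "(\<integral>\<^sup>+z. indicator (Q k) z * (log_density z * ennreal (1 / norm z ^ (?n - 1))) \<partial>lborel)
        \<le> (\<integral>\<^sup>+z. ennreal c * (indicator (Q k) z * ennreal ((norm (G z) / norm (indicator (ball 0 1) z *\<^sub>R f z)) ^ ?n))
            + ennreal d * (indicator (Q k) z * ennreal (1 / norm z ^ (?n - 1))) \<partial>lborel)"
      proof (rule nn_integral_mono)
        fix z :: "real^'n"
        show "indicator (Q k) z * (log_density z * ennreal (1 / norm z ^ (?n - 1)))
          \<le> ennreal c * (indicator (Q k) z * ennreal ((norm (G z) / norm (indicator (ball 0 1) z *\<^sub>R f z)) ^ ?n))
            + ennreal d * (indicator (Q k) z * ennreal (1 / norm z ^ (?n - 1)))"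
        proof (cases "z \<in> Q k")
          case True
          note zz = zQ[OF True]
          define \<rho> where "\<rho> = norm (G z) / norm (f z)"
          have \<rho>: "\<rho> \<ge> 0" by (simp add: \<rho>_def)
          define j where "j = 1 / norm z ^ (?n - 1)"
          have j: "0 \<le> j" "j \<le> 2 ^ (?n - 1)"
          proof -
            have "1 \<le> (2 * norm z) ^ (?n - 1)" using zz(4) by (intro one_le_power) simp
            moreover have "norm z ^ (?n - 1) > 0" using zz(4) by (intro zero_less_power) linarith
            ultimately show "j \<le> 2 ^ (?n - 1)" by (simp add: j_def field_simps power_mult_distrib)
          qed (simp add: j_def)
          \<comment> \<open>Young's inequality is applied to the scale free quantity
            \<open>r * \<rho>\<close>. After division by \<open>r\<close> the energy term carries
            \<open>r^(n - 1)\<close>, and the dual term carries \<open>1 / r\<close>, which the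
            thickness of the layer cancels.\<close>
          have "r * \<rho> \<le> (r * \<rho>) ^ ?n * w powr b + w powr (- \<beta>)"
            unfolding \<beta>_def using r \<rho> w dim by (intro le_power_weight) auto
          then have "\<rho> \<le> ((r * \<rho>) ^ ?n * w powr b + w powr (- \<beta>)) / r"
            using r by (simp add: pos_le_divide_eq mult.commute)
          also have "\<dots> = r ^ (?n - 1) * w powr b * \<rho> ^ ?n + d"
          proof -
            have "(r * \<rho>) ^ ?n = r * r ^ (?n - 1) * \<rho> ^ ?n"
              using dim by (cases ?n) (auto simp: power_mult_distrib)
            then show ?thesis using r by (simp add: d_def add_divide_distrib)
          qed
          finally have "\<rho> * j \<le> (r ^ (?n - 1) * w powr b * \<rho> ^ ?n + d) * j"
            using j by (intro mult_right_mono)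
          also have "\<dots> = (r ^ (?n - 1) * w powr b * \<rho> ^ ?n) * j + d * j" by (simp add: distrib_right)
          also have "\<dots> \<le> (r ^ (?n - 1) * w powr b * \<rho> ^ ?n) * 2 ^ (?n - 1) + d * j"
            using j r \<rho> by (intro add_right_mono mult_left_mono) auto
          also have "\<dots> = c * \<rho> ^ ?n + d * j" by (simp add: c_def mult_ac)
          finally have "ennreal (\<rho> * j) \<le> ennreal (c * \<rho> ^ ?n + d * j)" by (rule ennreal_leI)
          also have "\<dots> = ennreal c * ennreal (\<rho> ^ ?n) + ennreal d * ennreal j"
            using c d j \<rho> by (simp add: ennreal_mult)
          finally have "ennreal \<rho> * ennreal j \<le> ennreal c * ennreal (\<rho> ^ ?n) + ennreal d * ennreal j"
            using j by (simp add: ennreal_mult'')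
          then show ?thesis using True zz(3) by (simp add: log_density_def \<rho>_def j_def)
        qed simp
      qed
      also have "\<dots> = (\<integral>\<^sup>+z. ennreal c * (indicator (Q k) z * ennreal ((norm (G z) / norm (indicator (ball 0 1) z *\<^sub>R f z)) ^ ?n)) \<partial>lborel)
          + (\<integral>\<^sup>+z. ennreal d * (indicator (Q k) z * ennreal (1 / norm z ^ (?n - 1))) \<partial>lborel)"
        by (rule nn_integral_add) measurable
      also have "(\<integral>\<^sup>+z. ennreal c * (indicator (Q k) z * ennreal ((norm (G z) / norm (indicator (ball 0 1) z *\<^sub>R f z)) ^ ?n)) \<partial>lborel)
          = ennreal c * (\<integral>\<^sup>+z. indicator (Q k) z * ennreal ((norm (G z) / norm (indicator (ball 0 1) z *\<^sub>R f z)) ^ ?n) \<partial>lborel)"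
        by (rule nn_integral_cmult) measurable
      also have "(\<integral>\<^sup>+z. indicator (Q k) z * ennreal ((norm (G z) / norm (indicator (ball 0 1) z *\<^sub>R f z)) ^ ?n) \<partial>lborel)
          = (\<integral>\<^sup>+z. indicator (Q k) z * ennreal ((norm (G z) / norm (f z)) ^ ?n) \<partial>lborel)"
      proof (rule nn_integral_cong)
        fix z
        show "indicator (Q k) z * ennreal ((norm (G z) / norm (indicator (ball 0 1) z *\<^sub>R f z)) ^ ?n) = indicator (Q k) z * ennreal ((norm (G z) / norm (f z)) ^ ?n)"
          using zQ(3)[of z k] by (cases "z \<in> Q k") auto
      qed
      also have "(\<integral>\<^sup>+z. ennreal d * (indicator (Q k) z * ennreal (1 / norm z ^ (?n - 1))) \<partial>lborel)
          = ennreal d * (\<integral>\<^sup>+z. indicator (Q k) z * ennreal (1 / norm z ^ (?n - 1)) \<partial>lborel)"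
        by (rule nn_integral_cmult) measurable
      also have "(\<integral>\<^sup>+z. indicator (Q k) z * ennreal (1 / norm z ^ (?n - 1)) \<partial>lborel) = emeasure lborel (I k) * ?S"
        unfolding Q_def sphere_cap_def using Isub[of k] by (intro nn_integral_polar_sector_const) auto
      also have "emeasure lborel (I k) = ennreal ((1/2) ^ Suc k * r)" by (rule len)
      also have "ennreal d * (ennreal ((1/2) ^ Suc k * r) * ?S) = ennreal (ga k) * ?S"
      proof -
        have "w powr (- \<beta>) * w = w powr (- \<beta>) * w powr 1" using w by simp
        also have "\<dots> = w powr (1 - \<beta>)" by (simp only: powr_add[symmetric] uminus_add_conv_diff)
        also have "\<dots> = ((1/2) powr (1 - \<beta>)) ^ k" unfolding w_def by (rule power_powr_swap) simp
        also have "(1/2) powr (1 - \<beta>) = \<eta>"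
        proof -
          have "(1/2 :: real) powr (1 - \<beta>) = 1 / 2 powr (1 - \<beta>)" by (simp add: powr_divide)
          also have "\<dots> = 2 powr (- (1 - \<beta>))" by (simp only: powr_minus_divide)
          finally show ?thesis by (simp add: \<eta>_def)
        qed
        finally have "d * ((1/2) ^ Suc k * r) = ga k"
          using r by (simp add: d_def ga_def w_def[symmetric])
        then show ?thesis using d r by (simp add: mult.assoc[symmetric] ennreal_mult'[symmetric])
      qed
      also have "ennreal c * (\<integral>\<^sup>+z. indicator (Q k) z * ennreal ((norm (G z) / norm (f z)) ^ ?n) \<partial>lborel)
          \<le> ennreal c * ennreal ((2 * B k + 3) * (e0 * (N / ((1/2) ^ Suc k / 98) powr a)))"
        by (intro mult_left_mono energy) simp
      also have "\<dots> = ennreal (r ^ (?n - 1) * al k)"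
      proof -
        have p1: "1 / ((1/2::real) ^ Suc k / 98) powr a = 196 powr a * (2 powr a) ^ k"
        proof -
          have "1 / ((1/2::real) ^ Suc k / 98) powr a = (1 / ((1/2) ^ Suc k / 98)) powr a"
            by (simp add: powr_divide)
          also have "1 / ((1/2::real) ^ Suc k / 98) = 196 * 2 ^ k" by (simp add: field_simps)
          also have "(196 * 2 ^ k :: real) powr a = 196 powr a * (2 powr a) ^ k"
            by (simp add: powr_mult power_powr_swap)
          finally show ?thesis .
        qed
        have p2: "w powr b * (2 powr a) ^ k = \<theta> ^ k"
        proof -
          have "w powr b = ((1/2) powr b) ^ k" unfolding w_def by (rule power_powr_swap) simp
          then have "w powr b * (2 powr a) ^ k = ((1/2) powr b * 2 powr a) ^ k" by (simp add: power_mult_distrib)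
          also have "(1/2 :: real) powr b * 2 powr a = 2 powr a / 2 powr b" by (simp add: powr_divide)
          also have "\<dots> = \<theta>" by (simp add: \<theta>_def powr_diff)
          finally show ?thesis .
        qed
        have "c * ((2 * B k + 3) * (e0 * (N / ((1/2) ^ Suc k / 98) powr a)))
          = 2 ^ (?n - 1) * r ^ (?n - 1) * (2 * B k + 3) * e0 * N * (w powr b * (1 / ((1/2) ^ Suc k / 98) powr a))"
          by (simp add: c_def)
        also have "\<dots> = 2 ^ (?n - 1) * r ^ (?n - 1) * (2 * B k + 3) * e0 * N * 196 powr a * (w powr b * (2 powr a) ^ k)"
          unfolding p1 by (simp only: mult_ac)
        also have "\<dots> = r ^ (?n - 1) * al k"
          unfolding p2 al_def by (simp only: mult_ac)
        finally show ?thesis using c by (simp add: ennreal_mult'[symmetric])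
      qed
      finally show ?thesis by (simp add: add_right_mono)
    qed
    have "(\<integral>\<^sup>+w. indicator ?D w * (\<integral>\<^sup>+s. indicator {1 - r..<1} s * log_density (s *\<^sub>R w) \<partial>lborel) \<partial>sphere_measure)
      = (\<integral>\<^sup>+z. indicator {z. norm z \<in> {1 - r..<1} \<and> z /\<^sub>R norm z \<in> ?D} z * (log_density z * ennreal (1 / norm z ^ (?n - 1))) \<partial>lborel)"
      using r by (intro nn_integral_polar_sector) auto
    also have "\<dots> \<le> (\<integral>\<^sup>+z. (\<Sum>k. indicator (Q k) z * (log_density z * ennreal (1 / norm z ^ (?n - 1)))) \<partial>lborel)"
    proof (rule nn_integral_mono)
      fix z :: "real^'n"
      show "indicator {z. norm z \<in> {1 - r..<1} \<and> z /\<^sub>R norm z \<in> ?D} z * (log_density z * ennreal (1 / norm z ^ (?n - 1)))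
        \<le> (\<Sum>k. indicator (Q k) z * (log_density z * ennreal (1 / norm z ^ (?n - 1))))"
      proof (cases "norm z \<in> {1 - r..<1} \<and> z /\<^sub>R norm z \<in> ?D")
        case True
        \<comment> \<open>The layer containing \<open>z\<close> is the first one whose outer radius
          exceeds \<open>norm z\<close>; minimality gives the bound from below.\<close>
        define P where "P k \<longleftrightarrow> norm z < 1 - (1/2) ^ Suc k * r" for k
        obtain k0 where "(1/2) ^ k0 < (1 - norm z) / r"
          using real_arch_pow_inv[of "(1 - norm z) / r" "1/2"] True r by auto
        then have "(1/2) ^ k0 * r < 1 - norm z" using r by (simp add: field_simps)
        moreover have "(1/2) ^ Suc k0 * r \<le> (1/2) ^ k0 * r" using r by simp
        ultimately have "P k0" unfolding P_def by linarith
        define k where "k = (LEAST k. P k)"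
        have "P k" unfolding k_def by (rule LeastI) (rule \<open>P k0\<close>)
        have "1 - (1/2) ^ k * r \<le> norm z"
        proof (cases k)
          case 0
          then show ?thesis using True by simp
        next
          case (Suc i)
          then have "\<not> P i" unfolding k_def using not_less_Least by (metis lessI)
          then show ?thesis by (simp add: P_def Suc)
        qed
        then have "z \<in> Q k" using \<open>P k\<close> True by (simp add: Q_def I_def P_def)
        then show ?thesis
          using True sum_le_suminf[of "\<lambda>k. indicator (Q k) z * (log_density z * ennreal (1 / norm z ^ (?n - 1)))" "{k}"] by simp
      qed simp
    qed
    also have "\<dots> = (\<Sum>k. \<integral>\<^sup>+z. indicator (Q k) z * (log_density z * ennreal (1 / norm z ^ (?n - 1))) \<partial>lborel)"
      by (rule nn_integral_suminf) measurable
    also have "\<dots> \<le> (\<Sum>k. ennreal (r ^ (?n - 1) * al k) + ennreal (ga k) * ?S)"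
      by (intro suminf_le layer) auto
    also have "\<dots> = (\<Sum>k. ennreal (r ^ (?n - 1) * al k)) + (\<Sum>k. ennreal (ga k) * ?S)"
      by (rule suminf_add[symmetric]) auto
    also have "(\<Sum>k. ennreal (r ^ (?n - 1) * al k)) = ennreal (r ^ (?n - 1) * suminf al)"
      using sal al0 r by (intro suminf_ennreal_eq sums_mult summable_sums) auto
    also have "(\<Sum>k. ennreal (ga k) * ?S) = ennreal (suminf ga) * ?S"
    proof -
      have "(\<Sum>k. ennreal (ga k)) = ennreal (suminf ga)"
        using sga ga0 by (intro suminf_ennreal_eq summable_sums) auto
      then show ?thesis by simp
    qed
    \<comment> \<open>The power of \<open>r\<close> is traded for the measure of the cap, so that
      both terms become multiples of \<open>?S\<close>.\<close>
    also have "ennreal (r ^ (?n - 1) * suminf al) \<le> ennreal (suminf al * c1) * ?S"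
    proof -
      have "ennreal (r ^ (?n - 1)) \<le> ennreal c1 * ?S"
        unfolding c1_def r_def by (rule emeasure_sphere_cap_ge[OF w0 R])
      then have "ennreal (suminf al) * ennreal (r ^ (?n - 1)) \<le> ennreal (suminf al) * (ennreal c1 * ?S)"
        by (rule mult_left_mono) simp
      moreover have "ennreal (r ^ (?n - 1) * suminf al) = ennreal (suminf al) * ennreal (r ^ (?n - 1))"
        using suminf_nonneg[OF sal al0] r by (subst mult.commute) (rule ennreal_mult, auto)
      moreover have "ennreal (suminf al * c1) * ?S = ennreal (suminf al) * (ennreal c1 * ?S)"
        using suminf_nonneg[OF sal al0] c1 by (simp add: ennreal_mult mult.assoc)
      ultimately show ?thesis by simp
    qed
    also have "ennreal (suminf al * c1) * ?S + ennreal (suminf ga) * ?S = ennreal M * ?S"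
      using suminf_nonneg[OF sal al0] suminf_nonneg[OF sga ga0] c1 by (simp add: M_def ennreal_plus distrib_right)
    finally show "(\<integral>\<^sup>+w. indicator ?D w * (\<integral>\<^sup>+s. indicator {1 - r..<1} s * log_density (s *\<^sub>R w) \<partial>lborel) \<partial>sphere_measure)
      \<le> ennreal M * ?S" by (simp add: add_right_mono)
  qed
qed

end

text \<open>The mean differs from any constant \<open>c\<close> by at most the average of
  \<open>\<bar>v x - c\<bar>\<close>, so replacing \<open>c\<close> by the mean at most doubles the
  average oscillation.\<close>

lemma mean_oscillation_le:
  fixes v :: "'a \<Rightarrow> real"
  assumes fin: "finite_measure N" and v: "integrable N v" and D: "D \<in> sets N" "measure N D > 0"
    and B: "B \<ge> 0" and le: "(\<integral>\<^sup>+x. indicator D x * ennreal \<bar>v x - c\<bar> \<partial>N) \<le> ennreal B * emeasure N D"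
  shows "(LINT x:D|N. \<bar>v x - (LINT x:D|N. v x) / measure N D\<bar>) / measure N D \<le> 2 * B"
proof -
  interpret finite_measure N by fact
  define s where "s = measure N D"
  define \<mu> where "\<mu> = (LINT x:D|N. v x) / s"
  have s: "s > 0" using D by (simp add: s_def)
  have [measurable]: "D \<in> sets N" by (rule D)
  have indk [simp]: "integrable N (\<lambda>x. indicator D x * k)" for k :: real
    by (intro integrable_mult_left integrable_real_indicator) (auto simp: less_top[symmetric])
  have int_ind: "(\<integral>x. indicator D x * k \<partial>N) = s * k" for k :: real
    by (simp add: s_def)
  have iv: "integrable N (\<lambda>x. indicator D x * v x)"
    using integrable_mult_indicator[OF D(1) v] by simp
  have id: "integrable N (\<lambda>x. indicator D x * (v x - k))" for k
    using Bochner_Integration.integrable_diff[OF iv indk[of k]] by (simp only: right_diff_distrib)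
  have ia: "integrable N (\<lambda>x. indicator D x * \<bar>v x - k\<bar>)" for k
    using integrable_abs[OF id[of k]] by (simp add: abs_mult)
  have "ennreal (\<integral>x. indicator D x * \<bar>v x - c\<bar> \<partial>N) = (\<integral>\<^sup>+x. ennreal (indicator D x * \<bar>v x - c\<bar>) \<partial>N)"
    by (rule nn_integral_eq_integral[symmetric, OF ia]) simp
  also have "\<dots> = (\<integral>\<^sup>+x. indicator D x * ennreal \<bar>v x - c\<bar> \<partial>N)"
    by (intro nn_integral_cong) (auto split: split_indicator)
  also have "\<dots> \<le> ennreal B * ennreal s" using le by (simp add: s_def emeasure_eq_measure)
  also have "\<dots> = ennreal (B * s)" using B by (simp add: ennreal_mult')
  finally have osc: "(\<integral>x. indicator D x * \<bar>v x - c\<bar> \<partial>N) \<le> B * s"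
    using B s by simp
  have "(\<mu> - c) * s = (\<integral>x. indicator D x * v x \<partial>N) - (\<integral>x. indicator D x * c \<partial>N)"
  proof -
    have ms: "\<mu> * s = (\<integral>x. indicator D x * v x \<partial>N)"
      using s by (simp add: \<mu>_def set_lebesgue_integral_def)
    show ?thesis unfolding int_ind ms[symmetric] by (simp add: algebra_simps)
  qed
  also have "\<dots> = (\<integral>x. indicator D x * (v x - c) \<partial>N)"
    using Bochner_Integration.integral_diff[OF iv indk[of c]] by (simp only: right_diff_distrib)
  finally have eq: "(\<mu> - c) * s = (\<integral>x. indicator D x * (v x - c) \<partial>N)" .
  have "\<bar>\<mu> - c\<bar> * s = \<bar>\<integral>x. indicator D x * (v x - c) \<partial>N\<bar>"
    unfolding eq[symmetric] using s by (simp add: abs_mult)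
  also have "\<dots> \<le> (\<integral>x. \<bar>indicator D x * (v x - c)\<bar> \<partial>N)"
    by (rule integral_abs_bound)
  also have "\<dots> = (\<integral>x. indicator D x * \<bar>v x - c\<bar> \<partial>N)"
    by (simp add: abs_mult)
  finally have mean: "\<bar>\<mu> - c\<bar> * s \<le> B * s" using osc by simp
  have "(\<integral>x. indicator D x * \<bar>v x - \<mu>\<bar> \<partial>N) \<le> (\<integral>x. indicator D x * \<bar>v x - c\<bar> + indicator D x * \<bar>\<mu> - c\<bar> \<partial>N)"
  proof (rule integral_mono[OF ia Bochner_Integration.integrable_add[OF ia]])
    fix x
    show "indicator D x * \<bar>v x - \<mu>\<bar> \<le> indicator D x * \<bar>v x - c\<bar> + indicator D x * \<bar>\<mu> - c\<bar>"
      by (auto split: split_indicator)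
  qed (rule indk)
  also have "\<dots> = (\<integral>x. indicator D x * \<bar>v x - c\<bar> \<partial>N) + (\<integral>x. indicator D x * \<bar>\<mu> - c\<bar> \<partial>N)"
    by (rule Bochner_Integration.integral_add[OF ia indk])
  also have "\<dots> \<le> B * s + B * s"
    unfolding int_ind using osc mean by (simp add: mult.commute)
  finally have "(\<integral>x. indicator D x * \<bar>v x - \<mu>\<bar> \<partial>N) \<le> (2 * B) * s" by simp
  then have "(\<integral>x. indicator D x * \<bar>v x - \<mu>\<bar> \<partial>N) / s \<le> 2 * B"
    using s by (simp add: pos_divide_le_eq)
  then show ?thesis by (simp add: \<mu>_def s_def set_lebesgue_integral_def)
qed

section \<open>Boundary values and their mean oscillation\<close>

context miniowitz_map
begin

lemma boundary_values:
  shows "AE w in sphere_measure. ((\<lambda>r. f (r *\<^sub>R w)) \<longlongrightarrow> boundary_map f w) (at_left 1) \<and> boundary_map f w \<noteq> 0 \<and>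
    (\<forall>t. 1/2 \<le> t \<and> t < 1 \<longrightarrow> ennreal \<bar>ln (norm (boundary_map f w)) - ln (norm (f (t *\<^sub>R w)))\<bar>
      \<le> 2 * (\<integral>\<^sup>+\<tau>. indicator {t..<1} \<tau> * log_density (\<tau> *\<^sub>R w) \<partial>lborel))"
proof -
  interpret finite_measure "sphere_measure :: (real^'n) measure" by (rule finite_sphere_measure)
  define w1 :: "real^'n" where "w1 = axis undefined 1"
  have w1: "norm w1 = 1" by (simp add: w1_def norm_axis_1)
  \<comment> \<open>A cap of radius 3 is the whole sphere, and its box reaches down to radius 1/2,
    so \<open>cap_energy\<close> shows that the radial integrals from 1/2 on are finite in almost
    every direction.\<close>
  have min3: "1/2 = min 3 (1/2::real)" by simp
  have [measurable]: "ball w1 3 \<in> sets borel" by simp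
  define J where "J w = (\<integral>\<^sup>+s. indicator {1/2..<1} s * log_density (s *\<^sub>R w) \<partial>lborel)" for w
  have Jm [measurable]: "J \<in> borel_measurable borel" unfolding J_def by measurable
  obtain M where M_all: "M \<ge> 0"
    "\<And>w0 R r. norm w0 = 1 \<Longrightarrow> R > 0 \<Longrightarrow> r = min R (1/2) \<Longrightarrow>
      (\<integral>\<^sup>+w. indicator (ball w0 R) w * (\<integral>\<^sup>+s. indicator {1 - r..<1} s * log_density (s *\<^sub>R w) \<partial>lborel) \<partial>sphere_measure)
      \<le> ennreal M * emeasure sphere_measure (sphere_cap w0 R)"
    by (rule cap_energy) (rule that, assumption+)
  have M: "(\<integral>\<^sup>+w. indicator (ball w1 3) w * (\<integral>\<^sup>+s. indicator {1 - 1/2..<1} s * log_density (s *\<^sub>R w) \<partial>lborel) \<partial>sphere_measure)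
      \<le> ennreal M * emeasure sphere_measure (sphere_cap w1 3)"
    by (rule M_all(2)[OF w1 _ min3]) simp
  have "(\<integral>\<^sup>+w. indicator (ball w1 3) w * J w \<partial>sphere_measure) \<noteq> \<infinity>"
  proof -
    have "(1::real) - 1/2 = 1/2" by simp
    with M have "(\<integral>\<^sup>+w. indicator (ball w1 3) w * J w \<partial>sphere_measure) \<le> ennreal M * emeasure sphere_measure (sphere_cap w1 3)"
      by (simp only: J_def)
    also have "\<dots> < \<infinity>" by (metis emeasure_finite ennreal_mult_eq_top_iff ennreal_neq_top infinity_ennreal_def less_top)
    finally show ?thesis by simp
  qed
  then have "AE w in sphere_measure. indicator (ball w1 3) w * J w \<noteq> \<infinity>"
    by (intro nn_integral_PInf_AE borel_measurable_sphere_measure) measurable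
  moreover have "AE w in sphere_measure. w \<in> space (sphere_measure :: (real^'n) measure)" by (rule AE_space)
  moreover have "AE w in sphere_measure. \<forall>t s. 1/2 \<le> t \<and> t < s \<and> s < 1 \<longrightarrow>
    ennreal (norm (f (s *\<^sub>R w) - f (t *\<^sub>R w))) \<le> (\<integral>\<^sup>+\<tau>. indicator {t..s} \<tau> * ennreal (norm (G (\<tau> *\<^sub>R w))) \<partial>lborel) \<and>
    ennreal \<bar>ln (norm (f (s *\<^sub>R w))) - ln (norm (f (t *\<^sub>R w)))\<bar> \<le> 2 * (\<integral>\<^sup>+\<tau>. indicator {t..s} \<tau> * log_density (\<tau> *\<^sub>R w) \<partial>lborel)"
    by (rule AE_radial) (rule nonzero)
  ultimately show ?thesis
  proof eventually_elim
    case (elim w)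
    then have w: "norm w = 1" by (simp add: space_sphere_measure)
    have "norm (w1 - w) \<le> norm w1 + norm w" by (rule norm_triangle_ineq4)
    then have "w \<in> ball w1 3" using w w1 by (simp add: dist_norm)
    then have fin: "(\<integral>\<^sup>+s. indicator {1/2..<1} s * log_density (s *\<^sub>R w) \<partial>lborel) < \<infinity>"
      using elim(1) by (simp add: J_def less_top[symmetric])
    show ?case
      by (rule radial_limit[OF nonzero w elim(3) fin]) auto
  qed
qed

text \<open>The constant \<open>c\<close> is the value of \<open>ln (norm (f x))\<close> at the top
  \<open>x = (1 - r) *\<^sub>R w0\<close> of the box. From the boundary point \<open>w\<close> one
  descends the radius to \<open>(1 - r) *\<^sub>R w\<close>, at the cost of twice the integral of
  \<open>log_density\<close>, and then moves across to the top, at a cost bounded through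
  (Min).\<close>

lemma cap_oscillation:
  obtains B where "B \<ge> 0"
    "\<And>w0 R. norm w0 = 1 \<Longrightarrow> R > 0 \<Longrightarrow> \<exists>c.
      (\<integral>\<^sup>+w. indicator (sphere_cap w0 R) w * ennreal \<bar>ln (norm (boundary_map f w)) - c\<bar> \<partial>sphere_measure)
      \<le> ennreal B * emeasure sphere_measure (sphere_cap w0 R)"
proof -
  obtain M where M: "M \<ge> 0"
    "\<And>w0 R r. norm w0 = 1 \<Longrightarrow> R > 0 \<Longrightarrow> r = min R (1/2) \<Longrightarrow>
      (\<integral>\<^sup>+w. indicator (ball w0 R) w * (\<integral>\<^sup>+s. indicator {1 - r..<1} s * log_density (s *\<^sub>R w) \<partial>lborel) \<partial>sphere_measure)
      \<le> ennreal M * emeasure sphere_measure (sphere_cap w0 R)"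
    by (rule cap_energy) (rule that, assumption+)
  show ?thesis
  proof (rule that[of "2 * M + osc_const"])
    show "2 * M + osc_const \<ge> 0" using M osc_nonneg by simp
    fix w0 :: "real^'n" and R :: real assume w0: "norm w0 = 1" and R: "R > 0"
    define r where "r = min R (1/2)"
    have r: "0 < r" "r \<le> 1/2" using R by (auto simp: r_def)
    define c where "c = ln (norm (f ((1 - r) *\<^sub>R w0)))"
    define J where "J w = indicator (ball w0 R) w * (\<integral>\<^sup>+s. indicator {1 - r..<1} s * log_density (s *\<^sub>R w) \<partial>lborel)" for w
    have [measurable]: "ball w0 R \<in> sets borel" by simp
    have Jm: "J \<in> borel_measurable sphere_measure"
      unfolding J_def by (intro borel_measurable_sphere_measure) measurable
    have cm: "(\<lambda>w. indicator (sphere_cap w0 R) w :: ennreal) \<in> borel_measurable sphere_measure"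
      by (rule borel_measurable_indicator[OF sets_sphere_cap])
    have "(\<integral>\<^sup>+w. indicator (sphere_cap w0 R) w * ennreal \<bar>ln (norm (boundary_map f w)) - c\<bar> \<partial>sphere_measure)
      \<le> (\<integral>\<^sup>+w. 2 * J w + ennreal osc_const * indicator (sphere_cap w0 R) w \<partial>sphere_measure)"
    proof (rule nn_integral_mono_AE)
      show "AE w in sphere_measure. indicator (sphere_cap w0 R) w * ennreal \<bar>ln (norm (boundary_map f w)) - c\<bar>
        \<le> 2 * J w + ennreal osc_const * indicator (sphere_cap w0 R) w"
        using boundary_values
      proof eventually_elim
        case (elim w)
        show ?case
        proof (cases "w \<in> sphere_cap w0 R")
          case True
          then have w: "norm w = 1" "w \<in> ball w0 R" by (auto simp: sphere_cap_def)
          have close: "norm (w - w0) \<le> 4 * r"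
          proof (cases "R \<le> 1/2")
            case True
            then show ?thesis using w R by (simp add: r_def dist_norm norm_minus_commute)
          next
            case False
            have "norm (w - w0) \<le> norm w + norm w0" by (rule norm_triangle_ineq4)
            then show ?thesis using False w w0 by (simp add: r_def)
          qed
          \<comment> \<open>The bottom of layer 0 is the level \<open>1 - r\<close> itself, so
            \<open>osc_slope\<close> does not enter.\<close>
          have a: "\<bar>ln (norm (f ((1 - r) *\<^sub>R w))) - c\<bar> \<le> osc_const"
            using layer_bounds(2)[OF w0 w(1) r close, of 0 "1 - r"] r by (simp add: c_def)
          have "ennreal \<bar>ln (norm (boundary_map f w)) - ln (norm (f ((1 - r) *\<^sub>R w)))\<bar> \<le> 2 * (\<integral>\<^sup>+\<tau>. indicator {1 - r..<1} \<tau> * log_density (\<tau> *\<^sub>R w) \<partial>lborel)"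
            using elim r by auto
          then have b: "ennreal \<bar>ln (norm (boundary_map f w)) - ln (norm (f ((1 - r) *\<^sub>R w)))\<bar> \<le> 2 * J w"
            using w by (simp add: J_def)
          have "\<bar>ln (norm (boundary_map f w)) - c\<bar> \<le> \<bar>ln (norm (boundary_map f w)) - ln (norm (f ((1 - r) *\<^sub>R w)))\<bar> + osc_const"
            using a by linarith
          then have "ennreal \<bar>ln (norm (boundary_map f w)) - c\<bar> \<le> ennreal (\<bar>ln (norm (boundary_map f w)) - ln (norm (f ((1 - r) *\<^sub>R w)))\<bar> + osc_const)"
            by (rule ennreal_leI)
          also have "\<dots> = ennreal \<bar>ln (norm (boundary_map f w)) - ln (norm (f ((1 - r) *\<^sub>R w)))\<bar> + ennreal osc_const"
            using osc_nonneg by (intro ennreal_plus) auto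
          also have "\<dots> \<le> 2 * J w + ennreal osc_const" using b by (rule add_right_mono)
          finally show ?thesis using True by simp
        qed simp
      qed
    qed
    also have "\<dots> = (\<integral>\<^sup>+w. 2 * J w \<partial>sphere_measure) + (\<integral>\<^sup>+w. ennreal osc_const * indicator (sphere_cap w0 R) w \<partial>sphere_measure)"
      by (intro nn_integral_add borel_measurable_times_ennreal borel_measurable_const Jm cm)
    also have "(\<integral>\<^sup>+w. ennreal osc_const * indicator (sphere_cap w0 R) w \<partial>sphere_measure) = ennreal osc_const * emeasure sphere_measure (sphere_cap w0 R)"
      by (rule nn_integral_cmult_indicator[OF sets_sphere_cap])
    also have "(\<integral>\<^sup>+w. 2 * J w \<partial>sphere_measure) = 2 * (\<integral>\<^sup>+w. J w \<partial>sphere_measure)"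
      by (rule nn_integral_cmult[OF Jm])
    also have "\<dots> \<le> 2 * (ennreal M * emeasure sphere_measure (sphere_cap w0 R))"
      unfolding J_def by (intro mult_left_mono M(2)[OF w0 R r_def]) simp
    also have "2 * (ennreal M * emeasure sphere_measure (sphere_cap w0 R)) + ennreal osc_const * emeasure sphere_measure (sphere_cap w0 R)
      = ennreal (2 * M + osc_const) * emeasure sphere_measure (sphere_cap w0 R)"
      using M(1) osc_nonneg by (simp add: ennreal_plus ennreal_mult' distrib_right mult.assoc)
    finally show "\<exists>c. (\<integral>\<^sup>+w. indicator (sphere_cap w0 R) w * ennreal \<bar>ln (norm (boundary_map f w)) - c\<bar> \<partial>sphere_measure)
      \<le> ennreal (2 * M + osc_const) * emeasure sphere_measure (sphere_cap w0 R)"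
      by (intro exI[of _ c]) (simp add: add_right_mono)
  qed
qed

lemma bmo_sphere_boundary_map: "bmo_sphere (\<lambda>w. ln (norm (boundary_map f w)))"
proof -
  interpret finite_measure "sphere_measure :: (real^'n) measure" by (rule finite_sphere_measure)
  let ?v = "\<lambda>w. ln (norm (boundary_map f w))"
  note borel_measurable_boundary_map[OF cont, measurable]
  have vm [measurable]: "?v \<in> borel_measurable sphere_measure" by measurable
  obtain B where B: "B \<ge> 0" "\<And>w0 R. norm w0 = 1 \<Longrightarrow> R > 0 \<Longrightarrow> \<exists>c.
      (\<integral>\<^sup>+w. indicator (sphere_cap w0 R) w * ennreal \<bar>?v w - c\<bar> \<partial>sphere_measure)
      \<le> ennreal B * emeasure sphere_measure (sphere_cap w0 R)"
    by (rule cap_oscillation) (rule that, assumption+)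
  have int: "integrable sphere_measure ?v"
  proof -
    define w1 :: "real^'n" where "w1 = axis undefined 1"
    have w1: "norm w1 = 1" by (simp add: w1_def norm_axis_1)
    obtain c where c: "(\<integral>\<^sup>+w. indicator (sphere_cap w1 3) w * ennreal \<bar>?v w - c\<bar> \<partial>sphere_measure)
      \<le> ennreal B * emeasure sphere_measure (sphere_cap w1 3)"
      using B(2)[OF w1, of 3] by auto
    \<comment> \<open>Since the sphere is itself a cap, the oscillation estimate also yields
      integrability.\<close>
    have all: "sphere_cap w1 3 = sphere 0 1"
    proof -
      have "w \<in> ball w1 3" if "norm w = 1" for w
      proof -
        have "norm (w1 - w) \<le> norm w1 + norm w" by (rule norm_triangle_ineq4)
        then show ?thesis using that w1 by (simp add: dist_norm)
      qed
      then show ?thesis by (auto simp: sphere_cap_def)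
    qed
    have "(\<integral>\<^sup>+w. ennreal (norm (?v w - c)) \<partial>sphere_measure) = (\<integral>\<^sup>+w. indicator (sphere_cap w1 3) w * ennreal \<bar>?v w - c\<bar> \<partial>sphere_measure)"
      by (intro nn_integral_cong) (simp add: all space_sphere_measure)
    also note c
    also have "ennreal B * emeasure sphere_measure (sphere_cap w1 3) < \<infinity>"
      by (metis emeasure_finite ennreal_mult_eq_top_iff ennreal_neq_top infinity_ennreal_def less_top)
    finally have "integrable sphere_measure (\<lambda>w. ?v w - c)"
      by (intro integrableI_bounded) measurable
    then have "integrable sphere_measure (\<lambda>w. (?v w - c) + c)"
      by (intro Bochner_Integration.integrable_add) auto
    then show ?thesis by simp
  qed
  have "cap_mean \<Delta> (\<lambda>w. \<bar>?v w - cap_mean \<Delta> ?v\<bar>) \<le> 2 * B"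
    if "w0 \<in> sphere 0 1" "R > 0" "\<Delta> = sphere_cap w0 R" for \<Delta> w0 and R :: real
  proof -
    note cap = that
    have w0: "norm w0 = 1" using cap by simp
    obtain c where c: "(\<integral>\<^sup>+w. indicator \<Delta> w * ennreal \<bar>?v w - c\<bar> \<partial>sphere_measure) \<le> ennreal B * emeasure sphere_measure \<Delta>"
      using B(2)[OF w0 cap(2)] cap by auto
    \<comment> \<open>\<open>cap_mean\<close> divides by this measure; a null cap would contradict
      the lower bound \<open>emeasure_sphere_cap_ge\<close>.\<close>
    have "measure sphere_measure \<Delta> > 0"
    proof (rule ccontr)
      assume "\<not> ?thesis"
      then have "emeasure sphere_measure \<Delta> = 0"
        by (simp add: emeasure_eq_measure not_less measure_le_0_iff)
      then have "ennreal (min R (1/2) ^ (CARD('n) - 1)) = 0"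
        using emeasure_sphere_cap_ge[OF w0 cap(2)] cap(3) by (simp only: mult_zero_right le_zero_eq)
      then have "min R (1/2) ^ (CARD('n) - 1) \<le> 0" by (simp only: ennreal_eq_0_iff)
      moreover have "min R (1/2) > 0" using cap(2) by simp
      then have "min R (1/2) ^ (CARD('n) - 1) > 0" by (rule zero_less_power)
      ultimately show False by linarith
    qed
    then show ?thesis
      unfolding cap_mean_def using cap c
      by (intro mean_oscillation_le[OF finite_sphere_measure int _ _ B(1)]) (auto intro: sets_sphere_cap)
  qed
  then show ?thesis
    unfolding bmo_sphere_def using int by (intro conjI bdd_aboveI[of _ "2 * B"]) auto
qed

end

text \<open>\<open>Lim\<close> and \<open>ln\<close> are total functions. The almost everywhere part
  certifies that, off a null set, the function in the BMO statement is the logarithm of the norm of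
  a genuine nonzero radial limit and not a default value.\<close>

theorem theorem4p1:
  fixes f :: "real^'n \<Rightarrow> real^'n"
    and K a :: real
    and C m :: "nat \<Rightarrow> real \<Rightarrow> real"
  assumes "CARD('n) \<ge> 2"
    and "quasiregular_on K (ball 0 1) f"
    and "miniowitz_class C m K f"
    and "0 \<le> a" and "a < real CARD('n) - 1"
    and "multiplicity_condition a f"
  shows "(AE \<omega> in sphere_measure.
            ((\<lambda>r. f (r *\<^sub>R \<omega>)) \<longlongrightarrow> boundary_map f \<omega>) (at_left 1) \<and> boundary_map f \<omega> \<noteq> 0)
         \<and> bmo_sphere (\<lambda>\<omega>. ln (norm (boundary_map f \<omega>)))"
proof -
  obtain G where "distortion_map f G K"
    using quasiregular_on_distortion_map[OF assms(1,2)] .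
  then interpret distortion_map f G K .
  interpret miniowitz_map f G K C m a
    by unfold_locales (use assms in auto)
  have "AE \<omega> in sphere_measure. ((\<lambda>r. f (r *\<^sub>R \<omega>)) \<longlongrightarrow> boundary_map f \<omega>) (at_left 1) \<and> boundary_map f \<omega> \<noteq> 0"
    using boundary_values by eventually_elim blast
  then show ?thesis using bmo_sphere_boundary_map by blast
qed

end
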